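(* \textsc{ConsCheck: ($k$-)Path} admits an algorithm which runs in time $2^{\mathcal{O}(k+t^-)}\cdot|\mathcal{I}|^{\mathcal{O}(1)}$; in particular, the problem is fixed-parameter tractable when parameterized by $k+t^-$.
   Context: \textsc{ConsCheck: ($k$-)Path}: Input $\mathcal{I}$: a finite vertex set $V$, labeled samples $(E_i,\lambda_i)_{i\in[t]}$ where each $G_i=(V,E_i)$ is a graph and $\lambda_i\in\{0,1\}$, and an integer $k$. Task: compute $F\subseteq\binom{V}{2}$ with $|F|=k$ such that for each $i\in[t]$, $F$ forms a path in $G_i$ ($F\subseteq E_i$ and $F$ is the edge set of a simple path) iff $\lambda_i=1$, or report that none exists. $t^-=|\{i:\lambda_i=0\}|$ is the number of negative samples. *)

theory Defs
  imports Main
begin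

section \<open>Model of computation\<close>

text \<open>
  A first-order, call-by-value, recursive functional language over binary trees, in the style of
  the tree-manipulating languages of N. D. Jones, \<^emph>\<open>Computability and Complexity\<close> (1997).
  Its only data operations are building a cell, taking its components, and testing for the atom; each
  evaluation step costs one unit. Since trees can be shared, such a step is a constant-time
  pointer operation, so running times agree with those of Turing machines up to a polynomial.
\<close>

datatype tree = Atom | Cell tree tree

primrec tree_size :: "tree \<Rightarrow> nat" where
  "tree_size Atom = 1"
| "tree_size (Cell a b) = Suc (tree_size a + tree_size b)"

fun head :: "tree \<Rightarrow> tree" where
  "head Atom = Atom"
| "head (Cell a b) = a"

fun tail :: "tree \<Rightarrow> tree" where
  "tail Atom = Atom"
| "tail (Cell a b) = b"

text \<open>
  Variables are de Bruijn indices into the environment. In \<open>Cond c a b\<close>, the branch \<open>a\<close> is taken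
  if \<open>c\<close> evaluates to a cell and \<open>b\<close> if it evaluates to the atom. A program is a list of function bodies;
  \<open>Call f\<close> refers to the body at position \<open>f\<close>, evaluated in the environment consisting of the
  arguments. Execution starts with function \<open>0\<close>, whose only argument is the input.
\<close>

datatype expr =
    Var nat
  | EAtom
  | ECell expr expr
  | EHead expr
  | ETail expr
  | Cond expr expr expr
  | LetIn expr expr
  | Call nat "expr list"

type_synonym program = "expr list"

inductive eval :: "program \<Rightarrow> tree list \<Rightarrow> expr \<Rightarrow> tree \<Rightarrow> nat \<Rightarrow> bool"
  and evals :: "program \<Rightarrow> tree list \<Rightarrow> expr list \<Rightarrow> tree list \<Rightarrow> nat \<Rightarrow> bool"
  for P :: program
where
  eval_Var: "i < length \<rho> \<Longrightarrow> eval P \<rho> (Var i) (\<rho> ! i) 1"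
| eval_EAtom: "eval P \<rho> EAtom Atom 1"
| eval_ECell: "eval P \<rho> a x s \<Longrightarrow> eval P \<rho> b y t \<Longrightarrow> eval P \<rho> (ECell a b) (Cell x y) (Suc (s + t))"
| eval_EHead: "eval P \<rho> a x t \<Longrightarrow> eval P \<rho> (EHead a) (head x) (Suc t)"
| eval_ETail: "eval P \<rho> a x t \<Longrightarrow> eval P \<rho> (ETail a) (tail x) (Suc t)"
| eval_Cond_Cell: "eval P \<rho> c (Cell u v) s \<Longrightarrow> eval P \<rho> a x t \<Longrightarrow> eval P \<rho> (Cond c a b) x (Suc (s + t))"
| eval_Cond_Atom: "eval P \<rho> c Atom s \<Longrightarrow> eval P \<rho> b x t \<Longrightarrow> eval P \<rho> (Cond c a b) x (Suc (s + t))"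
| eval_LetIn: "eval P \<rho> a x s \<Longrightarrow> eval P (x # \<rho>) b y t \<Longrightarrow> eval P \<rho> (LetIn a b) y (Suc (s + t))"
| eval_Call: "evals P \<rho> as xs s \<Longrightarrow> f < length P \<Longrightarrow> eval P xs (P ! f) y t
    \<Longrightarrow> eval P \<rho> (Call f as) y (Suc (s + t))"
| evals_Nil: "evals P \<rho> [] [] 0"
| evals_Cons: "eval P \<rho> a x s \<Longrightarrow> evals P \<rho> as xs t \<Longrightarrow> evals P \<rho> (a # as) (x # xs) (s + t)"

inductive_cases eval_elims:
  "eval P \<rho> (Var i) y t"
  "eval P \<rho> EAtom y t"
  "eval P \<rho> (ECell a b) y t"
  "eval P \<rho> (EHead a) y t"
  "eval P \<rho> (ETail a) y t"
  "eval P \<rho> (Cond c a b) y t"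
  "eval P \<rho> (LetIn a b) y t"
  "eval P \<rho> (Call f as) y t"

inductive_cases evals_elims:
  "evals P \<rho> [] ys t"
  "evals P \<rho> (a # as) ys t"

definition runs :: "program \<Rightarrow> tree \<Rightarrow> tree \<Rightarrow> nat \<Rightarrow> bool" where
  "runs P x y t \<longleftrightarrow> eval P [x] (Call 0 [Var 0]) y t"

lemma eval_deterministic:
  "eval P \<rho> e y t \<Longrightarrow> eval P \<rho> e y' t' \<Longrightarrow> y' = y \<and> t' = t"
  "evals P \<rho> es ys t \<Longrightarrow> evals P \<rho> es ys' t' \<Longrightarrow> ys' = ys \<and> t' = t"
proof (induction arbitrary: y' t' and ys' t' rule: eval_evals.inducts)
  case (eval_Var i \<rho>)
  then show ?case by (auto elim: eval_elims(1))
next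
  case (eval_EAtom \<rho>)
  then show ?case by (auto elim: eval_elims(2))
next
  case (eval_ECell \<rho> a x s b y t)
  from eval_ECell.prems show ?case
    by (rule eval_elims(3)) (use eval_ECell.IH in metis)
next
  case (eval_EHead \<rho> a x t)
  from eval_EHead.prems show ?case
    by (rule eval_elims(4)) (use eval_EHead.IH in metis)
next
  case (eval_ETail \<rho> a x t)
  from eval_ETail.prems show ?case
    by (rule eval_elims(5)) (use eval_ETail.IH in metis)
next
  case (eval_Cond_Cell \<rho> c u v s a x t b)
  from eval_Cond_Cell.prems show ?case
    by (rule eval_elims(6)) (use eval_Cond_Cell.IH in \<open>metis tree.distinct(1)\<close>)+
next
  case (eval_Cond_Atom \<rho> c s b x t a)
  from eval_Cond_Atom.prems show ?case
    by (rule eval_elims(6)) (use eval_Cond_Atom.IH in \<open>metis tree.distinct(1)\<close>)+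
next
  case (eval_LetIn \<rho> a x s b y t)
  from eval_LetIn.prems show ?case
    by (rule eval_elims(7)) (use eval_LetIn.IH in metis)
next
  case (eval_Call \<rho> as xs s f y t)
  from eval_Call.prems show ?case
    by (rule eval_elims(8)) (use eval_Call.IH in metis)
next
  case (evals_Nil \<rho>)
  then show ?case by (auto elim: evals_elims(1))
next
  case (evals_Cons \<rho> a x s as xs t)
  from evals_Cons.prems show ?case
    by (rule evals_elims(2)) (use evals_Cons.IH in metis)
qed

lemma runs_deterministic: "runs P x y t \<Longrightarrow> runs P x y' t' \<Longrightarrow> y' = y \<and> t' = t"
  unfolding runs_def by (rule eval_deterministic)


section \<open>Encodings as trees\<close>

fun enc_bool :: "bool \<Rightarrow> tree" where
  "enc_bool False = Atom"
| "enc_bool True = Cell Atom Atom"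

text \<open>Numbers are written in binary, least significant bit first, without leading zeros.\<close>

fun enc_nat :: "nat \<Rightarrow> tree" where
  "enc_nat n = (if n = 0 then Atom else Cell (enc_bool (odd n)) (enc_nat (n div 2)))"

declare enc_nat.simps [simp del]

fun enc_list :: "('a \<Rightarrow> tree) \<Rightarrow> 'a list \<Rightarrow> tree" where
  "enc_list f [] = Atom"
| "enc_list f (x # xs) = Cell (f x) (enc_list f xs)"

fun enc_pair :: "('a \<Rightarrow> tree) \<Rightarrow> ('b \<Rightarrow> tree) \<Rightarrow> 'a \<times> 'b \<Rightarrow> tree" where
  "enc_pair f g (x, y) = Cell (f x) (g y)"

fun enc_option :: "('a \<Rightarrow> tree) \<Rightarrow> 'a option \<Rightarrow> tree" where
  "enc_option f None = Atom"
| "enc_option f (Some x) = Cell (f x) Atom"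

lemma inj_enc_nat: "inj enc_nat"
proof (rule injI)
  fix m n :: nat
  assume "enc_nat m = enc_nat n"
  then show "m = n"
  proof (induction m arbitrary: n rule: less_induct)
    case (less m)
    have bool: "enc_bool a = enc_bool b \<Longrightarrow> a = b" for a b
      by (cases a; cases b) simp_all
    show ?case
    proof (cases "m = 0 \<or> n = 0")
      case True
      with less.prems show ?thesis
        unfolding enc_nat.simps[of m] enc_nat.simps[of n] by (auto split: if_splits)
    next
      case False
      with less.prems have *: "enc_bool (odd m) = enc_bool (odd n)"
          "enc_nat (m div 2) = enc_nat (n div 2)"
        unfolding enc_nat.simps[of m] enc_nat.simps[of n] by simp_all
      from *(1) bool have "odd m = odd n" by blast
      moreover have "m div 2 = n div 2"
        using less.IH[OF _ *(2)] False by simp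
      ultimately show ?thesis
        by presburger
    qed
  qed
qed

lemma inj_enc_list: "inj f \<Longrightarrow> inj (enc_list f)"
proof (rule injI)
  fix xs ys :: "'a list"
  assume "inj f" "enc_list f xs = enc_list f ys"
  then show "xs = ys"
  proof (induction xs arbitrary: ys)
    case Nil
    then show ?case by (cases ys) auto
  next
    case (Cons x xs)
    then show ?case by (cases ys) (auto dest: injD)
  qed
qed

lemma inj_enc_pair: "inj f \<Longrightarrow> inj g \<Longrightarrow> inj (enc_pair f g)"
  by (auto intro!: injI dest: injD)

lemma inj_enc_option: "inj f \<Longrightarrow> inj (enc_option f)"
proof (rule injI)
  fix x y :: "'a option"
  assume "inj f" "enc_option f x = enc_option f y"
  then show "x = y" by (cases x; cases y) (auto dest: injD)
qed

definition computable :: "(nat \<Rightarrow> nat) \<Rightarrow> bool" where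
  "computable f \<longleftrightarrow> (\<exists>P. \<forall>n. \<exists>t. runs P (enc_nat n) (enc_nat (f n)) t)"


section \<open>Consistency checking for paths\<close>

definition path_edges :: "'v list \<Rightarrow> 'v set set" where
  "path_edges p = {{p ! i, p ! Suc i} | i. Suc i < length p}"

text \<open>The empty set is the edge set of a one-vertex path.\<close>

definition is_path :: "'v set \<Rightarrow> 'v set set \<Rightarrow> bool" where
  "is_path V F \<longleftrightarrow> (\<exists>p. p \<noteq> [] \<and> distinct p \<and> set p \<subseteq> V \<and> F = path_edges p)"

definition forms_path_in :: "'v set \<Rightarrow> 'v set set \<Rightarrow> 'v set set \<Rightarrow> bool" where
  "forms_path_in V E F \<longleftrightarrow> F \<subseteq> E \<and> is_path V F"

definition all_edges :: "'v set \<Rightarrow> 'v set set" where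
  "all_edges V = {e. e \<subseteq> V \<and> card e = 2}"

definition consistent ::
    "'v set \<Rightarrow> ('v set set \<times> bool) list \<Rightarrow> nat \<Rightarrow> 'v set set \<Rightarrow> bool" where
  "consistent V samples k F \<longleftrightarrow>
     F \<subseteq> all_edges V \<and> card F = k \<and>
     (\<forall>(E, l) \<in> set samples. forms_path_in V E F \<longleftrightarrow> l)"

text \<open>
  Instances as presented to an algorithm: vertices are named by natural numbers, and
  finite sets are given as lists without repetitions, an edge \<open>{u, v}\<close> being written as
  either \<open>(u, v)\<close> or \<open>(v, u)\<close>.
\<close>

definition edge_set :: "('v \<times> 'v) list \<Rightarrow> 'v set set" where
  "edge_set es = (\<lambda>(u, v). {u, v}) ` set es"

definition edge_list :: "'v set \<Rightarrow> ('v \<times> 'v) list \<Rightarrow> bool" where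
  "edge_list V es \<longleftrightarrow> distinct (map (\<lambda>(u, v). {u, v}) es) \<and> edge_set es \<subseteq> all_edges V"

record inst =
  verts :: "nat list"
  samples :: "((nat \<times> nat) list \<times> bool) list"
  len :: nat

definition valid_inst :: "inst \<Rightarrow> bool" where
  "valid_inst I \<longleftrightarrow> distinct (verts I) \<and> (\<forall>(es, l) \<in> set (samples I). edge_list (set (verts I)) es)"

definition solution :: "inst \<Rightarrow> nat set set \<Rightarrow> bool" where
  "solution I F \<longleftrightarrow>
     consistent (set (verts I)) (map (\<lambda>(es, l). (edge_set es, l)) (samples I)) (len I) F"

definition neg_count :: "inst \<Rightarrow> nat" where
  "neg_count I = length (filter (\<lambda>(es, l). \<not> l) (samples I))"

definition enc_edges :: "(nat \<times> nat) list \<Rightarrow> tree" where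
  "enc_edges = enc_list (enc_pair enc_nat enc_nat)"

definition enc_inst :: "inst \<Rightarrow> tree" where
  "enc_inst I = Cell (enc_list enc_nat (verts I))
     (Cell (enc_list (enc_pair enc_edges enc_bool) (samples I)) (enc_nat (len I)))"

definition inst_size :: "inst \<Rightarrow> nat" where
  "inst_size I = tree_size (enc_inst I)"

text \<open>The answer \<open>None\<close> reports that there is no solution.\<close>

fun correct_answer :: "inst \<Rightarrow> (nat \<times> nat) list option \<Rightarrow> bool" where
  "correct_answer I None \<longleftrightarrow> (\<nexists>F. solution I F)"
| "correct_answer I (Some es) \<longleftrightarrow> edge_list (set (verts I)) es \<and> solution I (edge_set es)"

definition solves_ConsCheck_Path_within :: "program \<Rightarrow> (inst \<Rightarrow> nat) \<Rightarrow> bool" where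
  "solves_ConsCheck_Path_within P T \<longleftrightarrow>
     (\<forall>I. valid_inst I \<longrightarrow>
        (\<exists>r t. runs P (enc_inst I) (enc_option enc_edges r) t \<and> correct_answer I r \<and> t \<le> T I))"

definition fpt_ConsCheck_Path :: "(inst \<Rightarrow> nat) \<Rightarrow> bool" where
  "fpt_ConsCheck_Path \<kappa> \<longleftrightarrow>
     (\<exists>P f d. computable f \<and> solves_ConsCheck_Path_within P (\<lambda>I. f (\<kappa> I) * inst_size I ^ d))"

end

theory Submission
  imports Defs "Jordan_Normal_Form.Determinant"
begin

text \<open>
  If some sample is positive, one looks for a path with \<open>k\<close> edges in the intersection of the
  positive samples that is contained in no negative sample. Fix its first vertex and let
  \<open>w\<^sub>1, \<dots>, w\<^sub>k\<close> be the further vertices of a walk. The Vandermonde determinant of the \<open>w\<^sub>i\<close>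
  vanishes exactly if the walk repeats a vertex, so the sum of its squares over all walks that
  leave every negative sample is nonzero exactly if there is such a path (the deterministic case
  of the extensor coding of Brand, Dell and Husfeldt). Laplace expansion of both factors turns
  this sum into a dynamic program over states that record the current vertex, the exponents still
  unused in either factor, the negative samples not yet left, and a sign; there are
  \<open>2\<^bsup>O(k + t\<^sup>-)\<^esup> |V|\<close> states, and the partial sums have polynomially many bits. Positive and negative
  contributions are added up separately as natural numbers. The path itself is found by deleting
  edges as long as a path remains.

  Without positive samples one first looks for a path in the complete graph. If there is none,
  only edge sets that are not paths remain: two disjoint edges for \<open>k = 2\<close>, and any \<open>k\<close> edges
  including a triangle for \<open>k \<ge> 3\<close>.
\<close>

section \<open>Combining programs\<close>

text \<open>The samples constrain a path only through containment: the edge set of a path on V forms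
  a path in a sample exactly if all its edges occur there. A positive sample thus merely removes
  edges, and a negative one asks for a missing edge, which a walk can check edge by edge. A set that
  is no path satisfies every negative and no positive sample, whence the split on positive samples.
  A single copy of the determinant would not do: walks through the same vertices in different orders
  may differ in sign and cancel. Squares cannot cancel; the price is a second set of exponents in
  the state, so about 4^k pairs of sets instead of 2^k. The running time is not polynomial in the
  input, so time bounds are proved relative to a budget that is added to the input size. The budget
  is 2^(k + t^-) and pays for enumerating subsets; everything else is polynomial in the lists so
  obtained. The program is never written out but assembled by closure lemmas.\<close>

primrec shift :: "nat \<Rightarrow> expr \<Rightarrow> expr" where
  "shift n (Var i) = Var i"
| "shift n EAtom = EAtom"
| "shift n (ECell a b) = ECell (shift n a) (shift n b)"
| "shift n (EHead a) = EHead (shift n a)"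
| "shift n (ETail a) = ETail (shift n a)"
| "shift n (Cond c a b) = Cond (shift n c) (shift n a) (shift n b)"
| "shift n (LetIn a b) = LetIn (shift n a) (shift n b)"
| "shift n (Call f as) = Call (n + f) (map (shift n) as)"

text \<open>Calls name absolute positions, so code placed behind \<open>Q\<close> stays correct once
  its call targets are raised by the length of \<open>Q\<close>. The cost is unchanged.\<close>

lemma eval_shift:
  "eval P \<rho> e y t \<Longrightarrow> eval (Q @ map (shift (length Q)) P @ R) \<rho> (shift (length Q) e) y t"
  "evals P \<rho> es ys t \<Longrightarrow> evals (Q @ map (shift (length Q)) P @ R) \<rho> (map (shift (length Q)) es) ys t"
proof (induction rule: eval_evals.inducts)
  case (eval_Call \<rho> as xs s f y t)
  then show ?case
    by (auto intro!: eval_evals.eval_Call simp: nth_append)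
qed (auto intro: eval_evals.intros eval_Var[simplified] eval_EAtom[simplified])

text \<open>Binders push at the front of the environment, so extra values at the far end disturb no
  index. This lets an expression written for the input alone run below further binders.\<close>

lemma eval_append_env:
  "eval P \<rho> e y t \<Longrightarrow> eval P (\<rho> @ \<sigma>) e y t"
  "evals P \<rho> es ys t \<Longrightarrow> evals P (\<rho> @ \<sigma>) es ys t"
proof (induction rule: eval_evals.inducts)
  case (eval_Var i \<rho>)
  then show ?case
    using eval_evals.eval_Var[of i "\<rho> @ \<sigma>" P] by (simp add: nth_append)
next
  case (eval_LetIn \<rho> a x s b y t)
  then show ?case by (auto intro: eval_evals.eval_LetIn)
next
  case (eval_Call \<rho> as xs s f y t)
  then show ?case by (auto intro: eval_evals.eval_Call)
qed (auto intro: eval_evals.intros eval_EAtom[simplified])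

lemma eval_Cons_env: "eval P [x] e y t \<Longrightarrow> eval P (x # \<sigma>) e y t"
  using eval_append_env(1)[of P "[x]" e y t \<sigma>] by simp

lemma merge_programs:
  "\<exists>P e1' e2'. (\<forall>\<rho> y t. eval P1 \<rho> e1 y t \<longrightarrow> eval P \<rho> e1' y t) \<and>
     (\<forall>\<rho> y t. eval P2 \<rho> e2 y t \<longrightarrow> eval P \<rho> e2' y t)"
proof (intro exI conjI allI impI)
  fix \<rho> y t
  assume "eval P1 \<rho> e1 y t"
  from eval_shift(1)[OF this, of "[]" "map (shift (length P1)) P2"]
  show "eval (map (shift 0) P1 @ map (shift (length P1)) P2) \<rho> (shift 0 e1) y t"
    by simp
next
  fix \<rho> y t
  assume "eval P2 \<rho> e2 y t"
  from eval_shift(1)[OF this, of "map (shift 0) P1" "[]"]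
  show "eval (map (shift 0) P1 @ map (shift (length P1)) P2) \<rho> (shift (length P1) e2) y t"
    by simp
qed

section \<open>Polynomial bounds\<close>

text \<open>The summand 2 makes the base at least 2, so constants, sums and products are all
  absorbed by a larger exponent and one number \<open>d\<close> describes the bound.\<close>

definition scale :: "('a \<Rightarrow> nat) \<Rightarrow> ('a \<Rightarrow> tree) \<Rightarrow> 'a \<Rightarrow> nat" where
  "scale m ex x = m x + tree_size (ex x) + 2"

definition poly_bounded :: "('a \<Rightarrow> nat) \<Rightarrow> ('a \<Rightarrow> tree) \<Rightarrow> ('a \<Rightarrow> nat) \<Rightarrow> bool" where
  "poly_bounded m ex g \<longleftrightarrow> (\<exists>d. \<forall>x. g x \<le> scale m ex x ^ d)"

lemma scale_ge_2: "2 \<le> scale m ex x"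
  by (simp add: scale_def)

lemma scale_power_mono: "d \<le> e \<Longrightarrow> scale m ex x ^ d \<le> scale m ex x ^ e"
  using scale_ge_2[of m ex x] by (intro power_increasing) simp_all

lemma poly_boundedI: "(\<And>x. g x \<le> scale m ex x ^ d) \<Longrightarrow> poly_bounded m ex g"
  by (auto simp: poly_bounded_def)

lemma poly_bounded_mono: "poly_bounded m ex g \<Longrightarrow> (\<And>x. f x \<le> g x) \<Longrightarrow> poly_bounded m ex f"
  unfolding poly_bounded_def using le_trans by blast

lemma poly_bounded_const: "poly_bounded m ex (\<lambda>_. c)"
proof (rule poly_boundedI)
  fix x
  have "c \<le> 2 ^ c" by (simp add: less_imp_le)
  also have "\<dots> \<le> scale m ex x ^ c" by (intro power_mono scale_ge_2) simp
  finally show "c \<le> scale m ex x ^ c" .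
qed

lemma poly_bounded_add:
  assumes "poly_bounded m ex f" "poly_bounded m ex g"
  shows "poly_bounded m ex (\<lambda>x. f x + g x)"
proof -
  obtain d e where de: "\<And>x. f x \<le> scale m ex x ^ d" "\<And>x. g x \<le> scale m ex x ^ e"
    using assms by (auto simp: poly_bounded_def)
  show ?thesis
  proof (rule poly_boundedI)
    fix x
    have "f x + g x \<le> scale m ex x ^ max d e + scale m ex x ^ max d e"
      using de[of x] scale_power_mono[of d "max d e" m ex x] scale_power_mono[of e "max d e" m ex x]
      by simp
    also have "\<dots> = 2 * scale m ex x ^ max d e" by simp
    also have "\<dots> \<le> scale m ex x ^ Suc (max d e)"
      using scale_ge_2[of m ex x] by simp
    finally show "f x + g x \<le> scale m ex x ^ Suc (max d e)" .
  qed
qed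

lemma poly_bounded_Suc: "poly_bounded m ex f \<Longrightarrow> poly_bounded m ex (\<lambda>x. Suc (f x))"
  using poly_bounded_add[OF _ poly_bounded_const, of m ex f 1] by simp

lemma poly_bounded_mult:
  assumes "poly_bounded m ex f" "poly_bounded m ex g"
  shows "poly_bounded m ex (\<lambda>x. f x * g x)"
proof -
  obtain d e where de: "\<And>x. f x \<le> scale m ex x ^ d" "\<And>x. g x \<le> scale m ex x ^ e"
    using assms by (auto simp: poly_bounded_def)
  show ?thesis
    by (rule poly_boundedI[where d = "d + e"]) (simp add: power_add mult_mono de)
qed

lemma poly_bounded_power:
  assumes "poly_bounded m ex f"
  shows "poly_bounded m ex (\<lambda>x. f x ^ n)"
  by (induction n) (simp_all add: assms poly_bounded_const poly_bounded_mult)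

lemma poly_bounded_scale: "poly_bounded m ex (scale m ex)"
  by (rule poly_boundedI[where d = 1]) simp

lemma poly_bounded_budget: "poly_bounded m ex m"
  by (rule poly_bounded_mono[OF poly_bounded_scale]) (simp add: scale_def)

lemma poly_bounded_input: "poly_bounded m ex (\<lambda>x. tree_size (ex x))"
  by (rule poly_bounded_mono[OF poly_bounded_scale]) (simp add: scale_def)

lemmas pb_intros = poly_bounded_const poly_bounded_add poly_bounded_Suc poly_bounded_mult
  poly_bounded_power poly_bounded_scale poly_bounded_budget poly_bounded_input

lemma poly_bounded_comp:
  assumes "poly_bounded m' ey h" "poly_bounded m ex (\<lambda>x. m' (f x))"
    "poly_bounded m ex (\<lambda>x. tree_size (ey (f x)))"
  shows "poly_bounded m ex (\<lambda>x. h (f x))"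
proof -
  obtain d where d: "\<And>y. h y \<le> scale m' ey y ^ d"
    using assms(1) by (auto simp: poly_bounded_def)
  have "poly_bounded m ex (\<lambda>x. (m' (f x) + tree_size (ey (f x)) + 2) ^ d)"
    by (intro pb_intros assms(2,3))
  then show ?thesis
    by (rule poly_bounded_mono) (use d in \<open>auto simp: scale_def\<close>)
qed

text \<open>Meant for loops: \<open>R x y\<close> says that \<open>y\<close> occurs as an
  intermediate argument in the computation on \<open>x\<close>, and the cost at all such
  \<open>y\<close> is bounded in terms of \<open>x\<close> alone.\<close>

lemma poly_bounded_uniform:
  assumes "poly_bounded m' ey h" "poly_bounded m ex B"
    "\<And>x y. R x y \<Longrightarrow> m' y \<le> B x" "\<And>x y. R x y \<Longrightarrow> tree_size (ey y) \<le> B x"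
  obtains H where "poly_bounded m ex H" "\<And>x y. R x y \<Longrightarrow> h y \<le> H x"
proof -
  obtain d where d: "\<And>y. h y \<le> scale m' ey y ^ d"
    using assms(1) by (auto simp: poly_bounded_def)
  show thesis
  proof
    show "poly_bounded m ex (\<lambda>x. (B x + B x + 2) ^ d)"
      by (intro pb_intros assms(2))
    fix x y
    assume R: "R x y"
    have "scale m' ey y ^ d \<le> (B x + B x + 2) ^ d"
      unfolding scale_def by (intro power_mono add_mono assms(3,4) R) simp_all
    then show "h y \<le> (B x + B x + 2) ^ d"
      using d[of y] by linarith
  qed
qed

section \<open>Functions computable in polynomial time\<close>

text \<open>
  \<open>pt m ex ey f\<close>: the function \<open>f\<close>, with arguments encoded by \<open>ex\<close> and results encoded by
  \<open>ey\<close>, is computed in time polynomial in the size of the argument \<open>x\<close> and an extra budget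
  \<open>m x\<close>. The size of the result has to be bounded separately, since by sharing a computation
  of \<open>t\<close> steps can build a tree of size exponential in \<open>t\<close>.
\<close>

definition pt :: "('a \<Rightarrow> nat) \<Rightarrow> ('a \<Rightarrow> tree) \<Rightarrow> ('b \<Rightarrow> tree) \<Rightarrow> ('a \<Rightarrow> 'b) \<Rightarrow> bool" where
  "pt m ex ey f \<longleftrightarrow> poly_bounded m ex (\<lambda>x. tree_size (ey (f x))) \<and>
     (\<exists>P e T. poly_bounded m ex T \<and> (\<forall>x. \<exists>t\<le>T x. eval P [ex x] e (ey (f x)) t))"

lemma ptI:
  assumes "poly_bounded m ex (\<lambda>x. tree_size (ey (f x)))" "poly_bounded m ex T"
    "\<And>x. \<exists>t\<le>T x. eval P [ex x] e (ey (f x)) t"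
  shows "pt m ex ey f"
  using assms unfolding pt_def by blast

lemma pt_size: "pt m ex ey f \<Longrightarrow> poly_bounded m ex (\<lambda>x. tree_size (ey (f x)))"
  by (simp add: pt_def)

lemma ptE:
  assumes "pt m ex ey f"
  obtains P e T where "poly_bounded m ex T" "\<And>x. \<exists>t\<le>T x. eval P [ex x] e (ey (f x)) t"
  using assms unfolding pt_def by blast

text \<open>A compound expression must call both parts, so the two witnesses have to live in one
  common program.\<close>

lemma pt2E:
  assumes "pt m ex ey f" "pt m' ex' ey' f'"
  obtains P e T e' T' where "poly_bounded m ex T" "\<And>x. \<exists>t\<le>T x. eval P [ex x] e (ey (f x)) t"
    "poly_bounded m' ex' T'" "\<And>x. \<exists>t\<le>T' x. eval P [ex' x] e' (ey' (f' x)) t"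
proof -
  obtain P1 e1 T1 where 1: "poly_bounded m ex T1" "\<And>x. \<exists>t\<le>T1 x. eval P1 [ex x] e1 (ey (f x)) t"
    using assms(1) by (rule ptE) (rule that)
  obtain P2 e2 T2 where 2: "poly_bounded m' ex' T2" "\<And>x. \<exists>t\<le>T2 x. eval P2 [ex' x] e2 (ey' (f' x)) t"
    using assms(2) by (rule ptE) (rule that)
  obtain P e1' e2' where P: "\<And>\<rho> y t. eval P1 \<rho> e1 y t \<Longrightarrow> eval P \<rho> e1' y t"
     "\<And>\<rho> y t. eval P2 \<rho> e2 y t \<Longrightarrow> eval P \<rho> e2' y t"
    using merge_programs[of P1 e1 P2 e2] by blast
  show thesis
  proof (rule that)
    show "\<exists>t\<le>T1 x. eval P [ex x] e1' (ey (f x)) t" for x using 1(2)[of x] P(1) by blast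
    show "\<exists>t\<le>T2 x. eval P [ex' x] e2' (ey' (f' x)) t" for x using 2(2)[of x] P(2) by blast
  qed (fact 1 2)+
qed

lemma pt3E:
  assumes "pt m ex ey f" "pt m' ex' ey' f'" "pt m'' ex'' ey'' f''"
  obtains P e T e' T' e'' T'' where
    "poly_bounded m ex T" "\<And>x. \<exists>t\<le>T x. eval P [ex x] e (ey (f x)) t"
    "poly_bounded m' ex' T'" "\<And>x. \<exists>t\<le>T' x. eval P [ex' x] e' (ey' (f' x)) t"
    "poly_bounded m'' ex'' T''" "\<And>x. \<exists>t\<le>T'' x. eval P [ex'' x] e'' (ey'' (f'' x)) t"
proof -
  obtain P1 e1 T1 e2 T2 where 1: "poly_bounded m ex T1" "\<And>x. \<exists>t\<le>T1 x. eval P1 [ex x] e1 (ey (f x)) t"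
    "poly_bounded m' ex' T2" "\<And>x. \<exists>t\<le>T2 x. eval P1 [ex' x] e2 (ey' (f' x)) t"
    using assms(1,2) by (rule pt2E) (rule that)
  obtain P3 e3 T3 where 3: "poly_bounded m'' ex'' T3" "\<And>x. \<exists>t\<le>T3 x. eval P3 [ex'' x] e3 (ey'' (f'' x)) t"
    using assms(3) by (rule ptE) (rule that)
  let ?P = "P1 @ map (shift (length P1)) P3"
  have s0: "shift 0 e = e" for e
    by (induction e) (auto intro: map_idI)
  have P: "eval P1 \<rho> e y t \<Longrightarrow> eval ?P \<rho> e y t"
    "eval P3 \<rho> e3 y t \<Longrightarrow> eval ?P \<rho> (shift (length P1) e3) y t" for \<rho> e y t
    using eval_shift(1)[of P1 \<rho> e y t "[]" "map (shift (length P1)) P3"]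
      eval_shift(1)[of P3 \<rho> e3 y t "P1" "[]"] by (simp_all add: s0 map_idI[OF s0])
  show thesis
  proof (rule that)
    show "\<exists>t\<le>T1 x. eval ?P [ex x] e1 (ey (f x)) t" for x using 1(2)[of x] P(1) by blast
    show "\<exists>t\<le>T2 x. eval ?P [ex' x] e2 (ey' (f' x)) t" for x using 1(4)[of x] P(1) by blast
    show "\<exists>t\<le>T3 x. eval ?P [ex'' x] (shift (length P1) e3) (ey'' (f'' x)) t" for x
      using 3(2)[of x] P(2) by blast
  qed (fact 1 3)+
qed

section \<open>Closure under composition, pairing and case distinction\<close>

named_theorems pt_intros

lemma pt_id [pt_intros]: "pt m ex ex (\<lambda>x. x)"
proof (rule ptI)
  show "\<exists>t\<le>1. eval [] [ex x] (Var 0) (ex x) t" for x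
    using eval_Var[of 0 "[ex x]" "[]"] by auto
qed (rule pb_intros)+

primrec literal :: "tree \<Rightarrow> expr" where
  "literal Atom = EAtom"
| "literal (Cell a b) = ECell (literal a) (literal b)"

lemma eval_literal: "eval P \<rho> (literal x) x (tree_size x)"
proof (induction x)
  case Atom
  then show ?case by (auto intro: eval_EAtom[simplified])
next
  case (Cell a b)
  then show ?case by (auto intro: eval_ECell)
qed

lemma pt_const [pt_intros]: "pt m ex ey (\<lambda>_. c)"
proof (rule ptI)
  show "\<exists>t\<le>tree_size (ey c). eval [] [ex x] (literal (ey c)) (ey c) t" for x
    using eval_literal by blast
qed (rule pb_intros)+

lemma pt_comp:
  assumes f: "pt m ex ey f" and g: "pt m' ey ez g" and m: "poly_bounded m ex (\<lambda>x. m' (f x))"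
  shows "pt m ex ez (\<lambda>x. g (f x))"
proof -
  obtain P e T e' T' where T: "poly_bounded m ex T" "\<And>x. \<exists>t\<le>T x. eval P [ex x] e (ey (f x)) t"
    "poly_bounded m' ey T'" "\<And>x. \<exists>t\<le>T' x. eval P [ey x] e' (ez (g x)) t"
    using f g by (rule pt2E) (rule that)
  show ?thesis
  proof (rule ptI)
    show "poly_bounded m ex (\<lambda>x. tree_size (ez (g (f x))))"
      by (rule poly_bounded_comp[OF pt_size[OF g] m pt_size[OF f]])
    show "poly_bounded m ex (\<lambda>x. Suc (T x + T' (f x)))"
      by (intro pb_intros T(1) poly_bounded_comp[OF T(3) m pt_size[OF f]])
    show "\<exists>t\<le>Suc (T x + T' (f x)). eval P [ex x] (LetIn e e') (ez (g (f x))) t" for x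
    proof -
      obtain s t where "s \<le> T x" "eval P [ex x] e (ey (f x)) s"
        "t \<le> T' (f x)" "eval P [ey (f x)] e' (ez (g (f x))) t"
        using T(2)[of x] T(4)[of "f x"] by blast
      then show ?thesis
        by (intro exI[of _ "Suc (s + t)"] conjI eval_LetIn) (auto intro: eval_Cons_env)
    qed
  qed
qed

lemma enc_pair_Cell: "enc_pair f g p = Cell (f (fst p)) (g (snd p))"
  by (cases p) simp

lemma pt_binop:
  assumes f: "pt m ex ea f" and g: "pt m ex eb g"
    and size: "\<And>x. tree_size (ec (h x)) \<le> c + tree_size (ea (f x)) + tree_size (eb (g x))"
    and prog: "\<And>P e1 e2 x s t. eval P [ex x] e1 (ea (f x)) s \<Longrightarrow> eval P [ex x] e2 (eb (g x)) t \<Longrightarrow>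
      eval P [ex x] (E e1 e2) (ec (h x)) (c + s + t)"
  shows "pt m ex ec h"
proof -
  obtain P e1 T1 e2 T2 where T: "poly_bounded m ex T1" "\<And>x. \<exists>t\<le>T1 x. eval P [ex x] e1 (ea (f x)) t"
    "poly_bounded m ex T2" "\<And>x. \<exists>t\<le>T2 x. eval P [ex x] e2 (eb (g x)) t"
    using f g by (rule pt2E) (rule that)
  show ?thesis
  proof (rule ptI)
    have "poly_bounded m ex (\<lambda>x. c + tree_size (ea (f x)) + tree_size (eb (g x)))"
      by (intro pb_intros pt_size[OF f] pt_size[OF g])
    then show "poly_bounded m ex (\<lambda>x. tree_size (ec (h x)))"
      by (rule poly_bounded_mono) (rule size)
    show "poly_bounded m ex (\<lambda>x. c + T1 x + T2 x)"
      by (intro pb_intros T)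
    show "\<exists>t\<le>c + T1 x + T2 x. eval P [ex x] (E e1 e2) (ec (h x)) t" for x
    proof -
      obtain s t where "s \<le> T1 x" "eval P [ex x] e1 (ea (f x)) s"
        "t \<le> T2 x" "eval P [ex x] e2 (eb (g x)) t"
        using T(2)[of x] T(4)[of x] by blast
      then show ?thesis
        by (intro exI[of _ "c + s + t"] conjI prog) auto
    qed
  qed
qed

lemma pt_Pair [pt_intros]:
  assumes "pt m ex ea f" "pt m ex eb g"
  shows "pt m ex (enc_pair ea eb) (\<lambda>x. (f x, g x))"
  by (rule pt_binop[OF assms, where c = 1 and E = ECell]) (simp_all add: eval_ECell)

lemma pt_Cons [pt_intros]:
  assumes "pt m ex ea f" "pt m ex (enc_list ea) g"
  shows "pt m ex (enc_list ea) (\<lambda>x. f x # g x)"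
  by (rule pt_binop[OF assms, where c = 1 and E = ECell]) (simp_all add: eval_ECell)

lemma pt_unop:
  assumes f: "pt m ex ea f"
    and size: "\<And>x. tree_size (ec (h x)) \<le> c + tree_size (ea (f x))"
    and prog: "\<And>P e x t. eval P [ex x] e (ea (f x)) t \<Longrightarrow> eval P [ex x] (E e) (ec (h x)) (c + t)"
  shows "pt m ex ec h"
proof -
  obtain P e T where T: "poly_bounded m ex T" "\<And>x. \<exists>t\<le>T x. eval P [ex x] e (ea (f x)) t"
    using f by (rule ptE) (rule that)
  show ?thesis
  proof (rule ptI)
    have "poly_bounded m ex (\<lambda>x. c + tree_size (ea (f x)))"
      by (intro pb_intros pt_size[OF f])
    then show "poly_bounded m ex (\<lambda>x. tree_size (ec (h x)))"
      by (rule poly_bounded_mono) (rule size)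
    show "poly_bounded m ex (\<lambda>x. c + T x)"
      by (intro pb_intros T)
    show "\<exists>t\<le>c + T x. eval P [ex x] (E e) (ec (h x)) t" for x
      using T(2)[of x] prog by (meson add_le_mono le_refl)
  qed
qed

text \<open>Values with the same tree are interchangeable at no cost; this is how a number is read
  as its list of bits, or an option as a list.\<close>

lemma pt_recode:
  assumes "pt m ex ea f" "\<And>x. ea (f x) = ec (h x)"
  shows "pt m ex ec h"
  by (rule pt_unop[OF assms(1), where c = 0 and E = "\<lambda>e. e"]) (simp_all add: assms(2))

lemma pt_fst [pt_intros]:
  assumes "pt m ex (enc_pair ea eb) f"
  shows "pt m ex ea (\<lambda>x. fst (f x))"
proof (rule pt_unop[OF assms, where c = 1 and E = EHead])
  show "eval P [ex x] e (enc_pair ea eb (f x)) t \<Longrightarrow> eval P [ex x] (EHead e) (ea (fst (f x))) (1 + t)"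
    for P e x t
    using eval_EHead[of P "[ex x]" e "enc_pair ea eb (f x)" t] by (simp add: enc_pair_Cell)
qed (simp add: enc_pair_Cell)

lemma pt_snd [pt_intros]:
  assumes "pt m ex (enc_pair ea eb) f"
  shows "pt m ex eb (\<lambda>x. snd (f x))"
proof (rule pt_unop[OF assms, where c = 1 and E = ETail])
  show "eval P [ex x] e (enc_pair ea eb (f x)) t \<Longrightarrow> eval P [ex x] (ETail e) (eb (snd (f x))) (1 + t)"
    for P e x t
    using eval_ETail[of P "[ex x]" e "enc_pair ea eb (f x)" t] by (simp add: enc_pair_Cell)
qed (simp add: enc_pair_Cell)

lemma pt_Some [pt_intros]:
  assumes "pt m ex ea f"
  shows "pt m ex (enc_option ea) (\<lambda>x. Some (f x))"
proof (rule pt_unop[OF assms, where c = 2 and E = "\<lambda>e. ECell e EAtom"])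
  show "eval P [ex x] e (ea (f x)) t \<Longrightarrow>
      eval P [ex x] (ECell e EAtom) (enc_option ea (Some (f x))) (2 + t)" for P e x t
    using eval_ECell[of P "[ex x]" e "ea (f x)" t EAtom Atom 1] eval_EAtom[of P "[ex x]"] by simp
qed simp

lemma pt_tl [pt_intros]:
  assumes "pt m ex (enc_list ea) f"
  shows "pt m ex (enc_list ea) (\<lambda>x. tl (f x))"
proof (rule pt_unop[OF assms, where c = 1 and E = ETail])
  have eq: "tail (enc_list ea xs) = enc_list ea (tl xs)" for xs by (cases xs) simp_all
  show "eval P [ex x] e (enc_list ea (f x)) t \<Longrightarrow>
      eval P [ex x] (ETail e) (enc_list ea (tl (f x))) (1 + t)" for P e x t
    using eval_ETail[of P "[ex x]" e "enc_list ea (f x)" t] by (simp add: eq)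
  show "tree_size (enc_list ea (tl (f x))) \<le> 1 + tree_size (enc_list ea (f x))" for x
    by (cases "f x") simp_all
qed

text \<open>The test is on the tree, and \<open>False\<close>, \<open>[]\<close>,
  \<open>None\<close> and 0 are all encoded by the atom. So one rule yields conditionals and the
  case distinctions on lists and options.\<close>

lemma pt_Cond:
  assumes c: "pt m ex ec c" and f: "pt m ex ef f" and g: "pt m ex eg g"
    and eq: "\<And>x. ec (c x) \<noteq> Atom \<Longrightarrow> ey (h x) = ef (f x)" "\<And>x. ec (c x) = Atom \<Longrightarrow> ey (h x) = eg (g x)"
  shows "pt m ex ey h"
proof -
  obtain P e1 T1 e2 T2 e3 T3 where T: "poly_bounded m ex T1" "\<And>x. \<exists>t\<le>T1 x. eval P [ex x] e1 (ec (c x)) t"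
    "poly_bounded m ex T2" "\<And>x. \<exists>t\<le>T2 x. eval P [ex x] e2 (ef (f x)) t"
    "poly_bounded m ex T3" "\<And>x. \<exists>t\<le>T3 x. eval P [ex x] e3 (eg (g x)) t"
    using c f g by (rule pt3E) (rule that)
  show ?thesis
  proof (rule ptI)
    have "poly_bounded m ex (\<lambda>x. tree_size (ef (f x)) + tree_size (eg (g x)))"
      by (intro pb_intros pt_size[OF f] pt_size[OF g])
    then show "poly_bounded m ex (\<lambda>x. tree_size (ey (h x)))"
    proof (rule poly_bounded_mono)
      show "tree_size (ey (h x)) \<le> tree_size (ef (f x)) + tree_size (eg (g x))" for x
        by (cases "ec (c x) = Atom") (simp_all add: eq)
    qed
    show "poly_bounded m ex (\<lambda>x. Suc (T1 x + (T2 x + T3 x)))"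
      by (intro pb_intros T)
    show "\<exists>t\<le>Suc (T1 x + (T2 x + T3 x)). eval P [ex x] (Cond e1 e2 e3) (ey (h x)) t" for x
    proof -
      obtain r s t where rst: "r \<le> T1 x" "eval P [ex x] e1 (ec (c x)) r"
        "s \<le> T2 x" "eval P [ex x] e2 (ef (f x)) s" "t \<le> T3 x" "eval P [ex x] e3 (eg (g x)) t"
        using T(2)[of x] T(4)[of x] T(6)[of x] by blast
      show ?thesis
      proof (cases "ec (c x)")
        case Atom
        then show ?thesis
          using rst eq(2)[of x] by (intro exI[of _ "Suc (r + t)"] conjI eval_Cond_Atom) auto
      next
        case (Cell u v)
        then show ?thesis
          using rst eq(1)[of x] by (intro exI[of _ "Suc (r + s)"] conjI eval_Cond_Cell) auto
      qed
    qed
  qed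
qed

lemma pt_If [pt_intros]:
  assumes "pt m ex enc_bool b" "pt m ex ey f" "pt m ex ey g"
  shows "pt m ex ey (\<lambda>x. if b x then f x else g x)"
proof (rule pt_Cond[OF assms])
  show "enc_bool (b x) \<noteq> Atom \<Longrightarrow> ey (if b x then f x else g x) = ey (f x)" for x by (cases "b x") auto
  show "enc_bool (b x) = Atom \<Longrightarrow> ey (if b x then f x else g x) = ey (g x)" for x by (cases "b x") auto
qed

lemma pt_cong: "pt m ex ey f \<Longrightarrow> (\<And>x. f x = g x) \<Longrightarrow> pt m ex ey g"
  unfolding pt_def by simp

lemma pt_not [pt_intros]: "pt m ex enc_bool b \<Longrightarrow> pt m ex enc_bool (\<lambda>x. \<not> b x)"
  by (rule pt_cong[of _ _ _ "\<lambda>x. if b x then False else True"]) (intro pt_intros, simp_all)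

lemma pt_conj [pt_intros]:
  "pt m ex enc_bool b \<Longrightarrow> pt m ex enc_bool c \<Longrightarrow> pt m ex enc_bool (\<lambda>x. b x \<and> c x)"
  by (rule pt_cong[of _ _ _ "\<lambda>x. if b x then c x else False"]) (intro pt_intros, simp_all)

lemma pt_disj [pt_intros]:
  "pt m ex enc_bool b \<Longrightarrow> pt m ex enc_bool c \<Longrightarrow> pt m ex enc_bool (\<lambda>x. b x \<or> c x)"
  by (rule pt_cong[of _ _ _ "\<lambda>x. if b x then True else c x"]) (intro pt_intros, simp_all)

text \<open>With budget 0 the side condition of \<open>pt_comp\<close> is trivial, which is why the
  basic operations are first proved as functions of their encoded arguments with this
  budget.\<close>

lemma pt_lift1:
  assumes "pt (\<lambda>_. 0) ea ey g" "pt m ex ea f"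
  shows "pt m ex ey (\<lambda>x. g (f x))"
  by (rule pt_comp[OF assms(2,1)]) (rule poly_bounded_const)

lemma pt_lift2:
  assumes "pt (\<lambda>_. 0) (enc_pair ea eb) ey (\<lambda>z. g (fst z) (snd z))" "pt m ex ea f1" "pt m ex eb f2"
  shows "pt m ex ey (\<lambda>x. g (f1 x) (f2 x))"
  using pt_lift1[OF assms(1) pt_Pair[OF assms(2,3)]] by simp

lemma pt_lift3:
  assumes "pt (\<lambda>_. 0) (enc_pair ea (enc_pair eb ec)) ey (\<lambda>z. g (fst z) (fst (snd z)) (snd (snd z)))"
    "pt m ex ea f1" "pt m ex eb f2" "pt m ex ec f3"
  shows "pt m ex ey (\<lambda>x. g (f1 x) (f2 x) (f3 x))"
  using pt_lift1[OF assms(1) pt_Pair[OF assms(2) pt_Pair[OF assms(3,4)]]] by simp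

text \<open>The result is a raw tree: for an empty list the head is the atom, which need not encode
  any element.\<close>

lemma pt_head:
  assumes "pt m ex ea f"
  shows "pt m ex (\<lambda>y. y) (\<lambda>x. head (ea (f x)))"
proof (rule pt_unop[OF assms, where c = 1 and E = EHead])
  show "eval P [ex x] e (ea (f x)) t \<Longrightarrow> eval P [ex x] (EHead e) (head (ea (f x))) (1 + t)"
    for P e x t
    using eval_EHead[of P "[ex x]" e "ea (f x)" t] by simp
  show "tree_size (head (ea (f x))) \<le> 1 + tree_size (ea (f x))" for x
    by (cases "ea (f x)") simp_all
qed

lemma pt_case_hd:
  assumes "pt m ex (enc_list ea) f" "pt m ex ea d"
  shows "pt m ex ea (\<lambda>x. case f x of [] \<Rightarrow> d x | a # as \<Rightarrow> a)"
  by (rule pt_Cond[OF assms(1) pt_head[OF assms(1)] assms(2)]) (auto split: list.split)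

lemma pt_case_list [pt_intros]:
  assumes f: "pt m ex (enc_list ea) f" and d: "pt m ex ey d"
    and g: "pt (\<lambda>z. m (fst z)) (enc_pair ex (enc_pair ea (enc_list ea))) ey
      (\<lambda>z. g (fst z) (fst (snd z)) (snd (snd z)))"
  shows "pt m ex ey (\<lambda>x. case f x of [] \<Rightarrow> d x | a # as \<Rightarrow> g x a as)"
proof -
  \<comment> \<open>The branch \<open>g\<close> must be a total function of \<open>x\<close>, so the
    head needs some value even for the empty list. Being a constant, \<open>undefined\<close> can be
    compiled in as a literal.\<close>
  let ?hd = "\<lambda>x. case f x of [] \<Rightarrow> undefined | a # as \<Rightarrow> a"
  have 1: "pt m ex (enc_pair ex (enc_pair ea (enc_list ea))) (\<lambda>x. (x, ?hd x, tl (f x)))"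
    by (rule pt_intros pt_case_hd f)+
  have "pt m ex ey (\<lambda>x. g x (?hd x) (tl (f x)))"
    using pt_comp[OF 1 g] by (simp add: poly_bounded_budget)
  from f this d show ?thesis
    by (rule pt_Cond) (auto split: list.split)
qed

lemma pt_case_option [pt_intros]:
  assumes f: "pt m ex (enc_option ea) f" and d: "pt m ex ey d"
    and g: "pt (\<lambda>z. m (fst z)) (enc_pair ex ea) ey (\<lambda>z. g (fst z) (snd z))"
  shows "pt m ex ey (\<lambda>x. case f x of None \<Rightarrow> d x | Some a \<Rightarrow> g x a)"
proof -
  \<comment> \<open>\<open>Some a\<close> and \<open>[a]\<close> are encoded by the same
    tree.\<close>
  let ?l = "\<lambda>x. case f x of None \<Rightarrow> [] | Some a \<Rightarrow> [a]"
  have 1: "pt m ex (enc_list ea) ?l"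
    by (rule pt_recode[OF f]) (auto split: option.split)
  have 2: "pt (\<lambda>z. m (fst z)) (enc_pair ex (enc_pair ea (enc_list ea))) ey
      (\<lambda>z. g (fst z) (fst (snd z)))"
  proof -
    have "pt (\<lambda>z. m (fst z)) (enc_pair ex (enc_pair ea (enc_list ea))) (enc_pair ex ea)
        (\<lambda>z. (fst z, fst (snd z)))"
      by (rule pt_intros)+
    from pt_comp[OF this g] show ?thesis by (simp add: poly_bounded_budget)
  qed
  show ?thesis
    by (rule pt_cong[OF pt_case_list[OF 1 d 2]]) (simp split: option.split)
qed

lemma pt_Let [pt_intros]:
  assumes f: "pt m ex ea f"
    and g: "pt (\<lambda>z. m (fst z)) (enc_pair ex ea) ey (\<lambda>z. g (fst z) (snd z))"
  shows "pt m ex ey (\<lambda>x. let a = f x in g x a)"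
proof -
  have "pt m ex (enc_pair ex ea) (\<lambda>x. (x, f x))"
    by (rule pt_intros f)+
  from pt_comp[OF this g] show ?thesis by (simp add: poly_bounded_budget)
qed

subsection \<open>Iteration over lists\<close>

lemma tree_size_enc_list: "tree_size (enc_list f xs) = Suc (sum_list (map (\<lambda>x. Suc (tree_size (f x))) xs))"
  by (induction xs) simp_all

lemma length_le_tree_size: "length xs \<le> tree_size (enc_list f xs)"
  by (induction xs) simp_all

lemma tree_size_elem: "x \<in> set xs \<Longrightarrow> tree_size (f x) \<le> tree_size (enc_list f xs)"
  by (induction xs) auto

text \<open>The loop is function 0 with the input, the accumulator and the remaining list as
  arguments; the step \<open>e\<close> receives input, accumulator and current element packed into
  one tree.\<close>

definition fold_body :: "expr \<Rightarrow> expr" where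
  "fold_body e = Cond (Var 2)
     (Call 0 [Var 0, LetIn (ECell (Var 0) (ECell (Var 1) (EHead (Var 2)))) e, ETail (Var 2)]) (Var 1)"

text \<open>The bound \<open>U\<close> is demanded only for accumulators that occur in this run,
  since elsewhere the step may be expensive. One round costs 13 steps besides \<open>e\<close>,
  generously rounded to 20.\<close>

lemma eval_fold_body:
  assumes "\<And>i. i < length xs \<Longrightarrow> \<exists>t\<le>U. eval P [Cell x (Cell (es (foldl h s (take i xs))) (ea (xs ! i)))] e
      (es (foldl h s (take (Suc i) xs))) t"
    and P: "P \<noteq> []" "P ! 0 = fold_body e"
  shows "\<exists>t\<le>20 + length xs * (20 + U). eval P [x, es s, enc_list ea xs] (fold_body e) (es (foldl h s xs)) t"
  using assms(1)
proof (induction xs arbitrary: s)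
  case Nil
  have "eval P [x, es s, Atom] (fold_body e) (es s) (Suc (1 + 1))"
    using eval_Var[of 2 "[x, es s, Atom]" P] eval_Var[of 1 "[x, es s, Atom]" P]
    unfolding fold_body_def by (intro eval_Cond_Atom) simp_all
  then show ?case by (intro exI[of _ "Suc (1 + 1)"]) simp
next
  case (Cons a xs)
  let ?\<rho> = "[x, es s, enc_list ea (a # xs)]"
  have v: "eval P ?\<rho> (Var 0) x 1" "eval P ?\<rho> (Var 1) (es s) 1" "eval P ?\<rho> (Var 2) (enc_list ea (a # xs)) 1"
    using eval_Var[of 0 ?\<rho> P] eval_Var[of 1 ?\<rho> P] eval_Var[of 2 ?\<rho> P] by simp_all
  have 1: "eval P ?\<rho> (ECell (Var 0) (ECell (Var 1) (EHead (Var 2)))) (Cell x (Cell (es s) (ea a))) 6"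
    using eval_ECell[OF v(1) eval_ECell[OF v(2) eval_EHead[OF v(3)]]] by (simp add: numeral_eq_Suc)
  obtain u where u: "u \<le> U" "eval P [Cell x (Cell (es s) (ea a))] e (es (h s a)) u"
    using Cons.prems[of 0] by auto
  have 2: "eval P ?\<rho> (LetIn (ECell (Var 0) (ECell (Var 1) (EHead (Var 2)))) e) (es (h s a)) (Suc (6 + u))"
    by (rule eval_LetIn[OF 1 eval_Cons_env[OF u(2)]])
  have 3: "eval P ?\<rho> (ETail (Var 2)) (enc_list ea xs) 2"
    using eval_ETail[OF v(3)] by (simp add: numeral_2_eq_2)
  have "\<exists>t\<le>20 + length xs * (20 + U). eval P [x, es (h s a), enc_list ea xs] (fold_body e)
      (es (foldl h (h s a) xs)) t"
  proof (rule Cons.IH)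
    fix i
    assume "i < length xs"
    then show "\<exists>t\<le>U. eval P [Cell x (Cell (es (foldl h (h s a) (take i xs))) (ea (xs ! i)))] e
        (es (foldl h (h s a) (take (Suc i) xs))) t"
      using Cons.prems[of "Suc i"] by simp
  qed
  then obtain t where t: "t \<le> 20 + length xs * (20 + U)"
    "eval P [x, es (h s a), enc_list ea xs] (fold_body e) (es (foldl h (h s a) xs)) t"
    by blast
  have 4: "evals P ?\<rho> [Var 0, LetIn (ECell (Var 0) (ECell (Var 1) (EHead (Var 2)))) e, ETail (Var 2)]
     [x, es (h s a), enc_list ea xs] (1 + (Suc (6 + u) + (2 + 0)))"
    by (intro evals_Cons evals_Nil v 2 3)
  have 5: "eval P ?\<rho> (Call 0 [Var 0, LetIn (ECell (Var 0) (ECell (Var 1) (EHead (Var 2)))) e, ETail (Var 2)])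
     (es (foldl h s (a # xs))) (Suc (1 + (Suc (6 + u) + (2 + 0)) + t))"
    by (rule eval_Call[OF 4]) (use P t in simp_all)
  have "eval P ?\<rho> (fold_body e) (es (foldl h s (a # xs))) (Suc (1 + (Suc (1 + (Suc (6 + u) + (2 + 0)) + t))))"
    unfolding fold_body_def using v(3) 5 by (intro eval_Cond_Cell) auto
  moreover have "Suc (1 + (Suc (1 + (Suc (6 + u) + (2 + 0)) + t))) \<le> 20 + length (a # xs) * (20 + U)"
    using u(1) t(1) by simp
  ultimately show ?case by blast
qed

text \<open>A polynomial-time step is not enough, because iterating it may double the accumulator in
  every round. Hence \<open>B\<close> has to bound all intermediate accumulators, and also the
  budget of the step along the run.\<close>

lemma pt_foldl:
  assumes s: "pt m ex es s" and xs: "pt m ex (enc_list ea) xs"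
    and h: "pt m' (enc_pair ex (enc_pair es ea)) es (\<lambda>z. h (fst z) (fst (snd z)) (snd (snd z)))"
    and B: "poly_bounded m ex B"
    and bound: "\<And>x i. i \<le> length (xs x) \<Longrightarrow> tree_size (es (foldl (h x) (s x) (take i (xs x)))) \<le> B x"
    and budget: "\<And>x i. i < length (xs x) \<Longrightarrow> m' (x, foldl (h x) (s x) (take i (xs x)), xs x ! i) \<le> B x"
  shows "pt m ex es (\<lambda>x. foldl (h x) (s x) (xs x))"
proof -
  obtain P1 e1 T1 e2 T2 e3 T3 where T: "poly_bounded m ex T1" "\<And>x. \<exists>t\<le>T1 x. eval P1 [ex x] e1 (es (s x)) t"
    "poly_bounded m ex T2" "\<And>x. \<exists>t\<le>T2 x. eval P1 [ex x] e2 (enc_list ea (xs x)) t"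
    "poly_bounded m' (enc_pair ex (enc_pair es ea)) T3"
    "\<And>z. \<exists>t\<le>T3 z. eval P1 [enc_pair ex (enc_pair es ea) z] e3
        (es (h (fst z) (fst (snd z)) (snd (snd z)))) t"
    using s xs h by (rule pt3E) (rule that)
  define e where "e = shift 1 e3"
  \<comment> \<open>The loop calls itself as function 0, so all earlier code moves up by one
    position.\<close>
  define P where "P = fold_body e # map (shift 1) P1"
  have P: "P \<noteq> []" "P ! 0 = fold_body e" by (simp_all add: P_def)
  have sh: "eval P1 \<rho> a y t \<Longrightarrow> eval P \<rho> (shift 1 a) y t" for \<rho> a y t
    using eval_shift(1)[of P1 \<rho> a y t "[fold_body e]" "[]"] by (simp add: P_def)
  \<comment> \<open>These are exactly the arguments on which the step is executed for input
    \<open>x\<close>.\<close>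
  let ?R = "\<lambda>x z. \<exists>i<length (xs x). z = (x, foldl (h x) (s x) (take i (xs x)), xs x ! i)"
  let ?B = "\<lambda>x. tree_size (ex x) + B x + tree_size (enc_list ea (xs x)) + 2"
  obtain U where U: "poly_bounded m ex U" "\<And>x z. ?R x z \<Longrightarrow> T3 z \<le> U x"
  proof (rule poly_bounded_uniform[OF T(5), of m ex ?B ?R])
    show "poly_bounded m ex ?B"
      by (intro pb_intros B pt_size[OF xs] poly_bounded_input)
    show "m' z \<le> ?B x" if "?R x z" for x z using that budget[of _ x] by (force intro: trans_le_add1)
    show "tree_size (enc_pair ex (enc_pair es ea) z) \<le> ?B x" if z: "?R x z" for x z
    proof -
      obtain i where i: "i < length (xs x)" "z = (x, foldl (h x) (s x) (take i (xs x)), xs x ! i)"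
        using z by blast
      show ?thesis
        using bound[of i x] tree_size_elem[of "xs x ! i" "xs x" ea] i by (auto)
    qed
  qed blast
  show ?thesis
  proof (rule ptI)
    show "poly_bounded m ex (\<lambda>x. tree_size (es (foldl (h x) (s x) (xs x))))"
      by (rule poly_bounded_mono[OF B]) (metis bound le_refl take_all_iff)
    show "poly_bounded m ex (\<lambda>x. Suc (Suc (T1 x + T2 x + (20 + tree_size (enc_list ea (xs x)) * (20 + U x)))))"
      by (intro pb_intros T U(1) pt_size[OF xs])
    fix x
    obtain s' t where st: "s' \<le> T1 x" "eval P1 [ex x] e1 (es (s x)) s'"
        "t \<le> T2 x" "eval P1 [ex x] e2 (enc_list ea (xs x)) t"
      using T(2)[of x] T(4)[of x] by blast
    have "\<exists>t\<le>20 + length (xs x) * (20 + U x). eval P [ex x, es (s x), enc_list ea (xs x)]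
        (fold_body e) (es (foldl (h x) (s x) (xs x))) t"
    proof (rule eval_fold_body[OF _ P])
      fix i
      assume i: "i < length (xs x)"
      let ?z = "(x, foldl (h x) (s x) (take i (xs x)), xs x ! i)"
      have "\<exists>t\<le>T3 ?z. eval P1 [enc_pair ex (enc_pair es ea) ?z] e3 (es (foldl (h x) (s x) (take (Suc i) (xs x)))) t"
        using T(6)[of ?z] i by (simp add: take_Suc_conv_app_nth)
      moreover have "T3 ?z \<le> U x" using U(2) i by blast
      ultimately show "\<exists>t\<le>U x. eval P [Cell (ex x) (Cell (es (foldl (h x) (s x) (take i (xs x)))) (ea (xs x ! i)))] e
          (es (foldl (h x) (s x) (take (Suc i) (xs x)))) t"
        unfolding e_def using sh by (auto intro: le_trans)
    qed
    then obtain r where r: "r \<le> 20 + length (xs x) * (20 + U x)"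
      "eval P [ex x, es (s x), enc_list ea (xs x)] (fold_body e) (es (foldl (h x) (s x) (xs x))) r"
      by blast
    have "evals P [ex x] [Var 0, shift 1 e1, shift 1 e2] [ex x, es (s x), enc_list ea (xs x)] (1 + (s' + (t + 0)))"
      using eval_Var[of 0 "[ex x]" P] by (intro evals_Cons evals_Nil sh st) simp
    then have "eval P [ex x] (Call 0 [Var 0, shift 1 e1, shift 1 e2]) (es (foldl (h x) (s x) (xs x)))
        (Suc (1 + (s' + (t + 0)) + r))"
      by (rule eval_Call) (use P r in simp_all)
    moreover have "length (xs x) * (20 + U x) \<le> tree_size (enc_list ea (xs x)) * (20 + U x)"
      by (intro mult_right_mono length_le_tree_size) simp
    then have "Suc (1 + (s' + (t + 0)) + r) \<le>
        Suc (Suc (T1 x + T2 x + (20 + tree_size (enc_list ea (xs x)) * (20 + U x))))"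
      using st(1,3) r(1) by linarith
    ultimately show "\<exists>t\<le>Suc (Suc (T1 x + T2 x + (20 + tree_size (enc_list ea (xs x)) * (20 + U x)))).
        eval P [ex x] (Call 0 [Var 0, shift 1 e1, shift 1 e2]) (es (foldl (h x) (s x) (xs x))) t"
      by blast
  qed
qed

subsection \<open>Equality\<close>

definition eq_body :: expr where
  "eq_body = Cond (Var 0)
     (Cond (Var 1)
       (Cond (Call 0 [EHead (Var 0), EHead (Var 1)]) (Call 0 [ETail (Var 0), ETail (Var 1)]) EAtom)
       EAtom)
     (Cond (Var 1) EAtom (ECell EAtom EAtom))"

text \<open>Both trees are traversed in parallel and each node of \<open>x\<close> is visited at
  most once, so the size of \<open>x\<close> alone bounds the time; 20 covers the work per
  node.\<close>

lemma eval_eq_body: "\<exists>t\<le>20 * tree_size x. eval [eq_body] [x, y] eq_body (enc_bool (x = y)) t"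
proof (induction x arbitrary: y)
  case Atom
  let ?\<rho> = "[Atom, y]"
  have v: "eval [eq_body] ?\<rho> (Var 0) Atom 1" "eval [eq_body] ?\<rho> (Var 1) y 1"
    using eval_Var[of 0 ?\<rho> "[eq_body]"] eval_Var[of 1 ?\<rho> "[eq_body]"] by simp_all
  show ?case
  proof (cases y)
    case [simp]: Atom
    have "eval [eq_body] ?\<rho> eq_body (Cell Atom Atom) (Suc (1 + Suc (1 + Suc (1 + 1))))"
      by (subst (2) eq_body_def) (use v in \<open>intro eval_Cond_Atom eval_ECell eval_EAtom; simp\<close>)
    then show ?thesis by (intro exI[of _ "Suc (1 + Suc (1 + Suc (1 + 1)))"]) simp
  next
    case [simp]: (Cell u w)
    have "eval [eq_body] ?\<rho> eq_body Atom (Suc (1 + Suc (1 + 1)))"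
      by (subst (2) eq_body_def) (use v in \<open>intro eval_Cond_Atom[of _ _ _ 1] eval_Cond_Cell[of _ _ _ u w 1] eval_EAtom; simp\<close>)
    then show ?thesis by (intro exI[of _ "Suc (1 + Suc (1 + 1))"]) simp
  qed
next
  case (Cell a b)
  let ?P = "[eq_body]" and ?\<rho> = "[Cell a b, y]"
  have v: "eval ?P ?\<rho> (Var 0) (Cell a b) 1" "eval ?P ?\<rho> (Var 1) y 1"
    using eval_Var[of 0 ?\<rho> ?P] eval_Var[of 1 ?\<rho> ?P] by simp_all
  show ?case
  proof (cases y)
    case [simp]: Atom
    have "eval ?P ?\<rho> eq_body Atom (Suc (1 + Suc (1 + 1)))"
      by (subst (2) eq_body_def) (use v in \<open>intro eval_Cond_Cell[of _ _ _ a b 1] eval_Cond_Atom[of _ _ _ 1] eval_EAtom; simp\<close>)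
    then show ?thesis by (intro exI[of _ "Suc (1 + Suc (1 + 1))"]) simp
  next
    case [simp]: (Cell c d)
    obtain s t where s: "s \<le> 20 * tree_size a" "eval ?P [a, c] eq_body (enc_bool (a = c)) s"
      and t: "t \<le> 20 * tree_size b" "eval ?P [b, d] eq_body (enc_bool (b = d)) t"
      using Cell.IH by blast
    have h: "eval ?P ?\<rho> (EHead (Var 0)) a 2" "eval ?P ?\<rho> (EHead (Var 1)) c 2"
      "eval ?P ?\<rho> (ETail (Var 0)) b 2" "eval ?P ?\<rho> (ETail (Var 1)) d 2"
      using eval_EHead[OF v(1)] eval_EHead[OF v(2)] eval_ETail[OF v(1)] eval_ETail[OF v(2)]
      by (simp_all add: numeral_2_eq_2)
    have hs: "evals ?P ?\<rho> [EHead (Var 0), EHead (Var 1)] [a, c] (2 + (2 + 0))"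
      "evals ?P ?\<rho> [ETail (Var 0), ETail (Var 1)] [b, d] (2 + (2 + 0))"
      by (intro evals_Cons evals_Nil h)+
    have 1: "eval ?P ?\<rho> (Call 0 [EHead (Var 0), EHead (Var 1)]) (enc_bool (a = c)) (Suc ((2 + (2 + 0)) + s))"
      by (rule eval_Call[OF hs(1)]) (use s in simp_all)
    have 2: "eval ?P ?\<rho> (Call 0 [ETail (Var 0), ETail (Var 1)]) (enc_bool (b = d)) (Suc ((2 + (2 + 0)) + t))"
      by (rule eval_Call[OF hs(2)]) (use t in simp_all)
    have "\<exists>r\<le>10 + s + t. eval ?P ?\<rho> (Cond (Call 0 [EHead (Var 0), EHead (Var 1)]) (Call 0 [ETail (Var 0), ETail (Var 1)]) EAtom)
        (enc_bool (Cell a b = y)) (Suc r)"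
    proof (cases "a = c")
      case True
      with 1 have one: "eval ?P ?\<rho> (Call 0 [EHead (Var 0), EHead (Var 1)]) (Cell Atom Atom) (Suc ((2 + (2 + 0)) + s))"
        by simp
      show ?thesis using True
        by (intro exI[of _ "Suc ((2 + (2 + 0)) + s) + Suc ((2 + (2 + 0)) + t)"] conjI eval_Cond_Cell[OF one]) (use 2 in simp_all)
    next
      case False
      with 1 have one: "eval ?P ?\<rho> (Call 0 [EHead (Var 0), EHead (Var 1)]) Atom (Suc ((2 + (2 + 0)) + s))"
        by simp
      show ?thesis using False
        by (intro exI[of _ "Suc ((2 + (2 + 0)) + s) + 1"] conjI eval_Cond_Atom[OF one]) (use eval_EAtom[of ?P ?\<rho>] in simp_all)
    qed
    then obtain r where r: "r \<le> 10 + s + t" "eval ?P ?\<rho> (Cond (Call 0 [EHead (Var 0), EHead (Var 1)]) (Call 0 [ETail (Var 0), ETail (Var 1)]) EAtom)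
        (enc_bool (Cell a b = y)) (Suc r)"
      by blast
    have "eval ?P ?\<rho> eq_body (enc_bool (Cell a b = y)) (Suc (1 + Suc (1 + Suc r)))"
      by (subst (2) eq_body_def) (rule eval_Cond_Cell[OF v(1)] eval_Cond_Cell[OF v(2)[unfolded Cell]] r(2)[unfolded Cell] | simp only: Cell)+
    moreover have "Suc (1 + Suc (1 + Suc r)) \<le> 20 * tree_size (Cell a b)"
      using r s t by simp
    ultimately show ?thesis by blast
  qed
qed

lemma pt_eq_tree: "pt m (enc_pair (\<lambda>t. t) (\<lambda>t. t)) enc_bool (\<lambda>z. fst z = snd z)"
proof (rule ptI)
  let ?ep = "enc_pair (\<lambda>t. t) (\<lambda>t. t)"
  show "poly_bounded m ?ep (\<lambda>x. tree_size (enc_bool (fst x = snd x)))"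
  proof (rule poly_bounded_mono[OF poly_bounded_const])
    show "tree_size (enc_bool (fst x = snd x)) \<le> 3" for x :: "tree \<times> tree"
      by (cases "fst x = snd x") auto
  qed
  show "poly_bounded m ?ep (\<lambda>z. 5 + 20 * tree_size (?ep z))"
    by (intro pb_intros)
  fix z :: "tree \<times> tree"
  let ?\<rho> = "[?ep z]" and ?P = "[eq_body]"
  obtain t where t: "t \<le> 20 * tree_size (fst z)" "eval ?P [fst z, snd z] eq_body (enc_bool (fst z = snd z)) t"
    using eval_eq_body by blast
  have v: "eval ?P ?\<rho> (Var 0) (?ep z) 1"
    using eval_Var[of 0 ?\<rho> ?P] by simp
  have h: "eval ?P ?\<rho> (EHead (Var 0)) (fst z) 2" "eval ?P ?\<rho> (ETail (Var 0)) (snd z) 2"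
    using eval_EHead[OF v] eval_ETail[OF v] by (simp_all add: enc_pair_Cell numeral_2_eq_2)
  have 1: "evals ?P ?\<rho> [EHead (Var 0), ETail (Var 0)] [fst z, snd z] (2 + (2 + 0))"
    by (intro evals_Cons evals_Nil h)
  have "eval ?P ?\<rho> (Call 0 [EHead (Var 0), ETail (Var 0)]) (enc_bool (fst z = snd z)) (Suc (2 + (2 + 0) + t))"
    by (rule eval_Call[OF 1]) (use t in simp_all)
  moreover have "Suc (2 + (2 + 0) + t) \<le> 5 + 20 * tree_size (?ep z)"
    using t(1) by (simp add: enc_pair_Cell)
  ultimately show "\<exists>t\<le>5 + 20 * tree_size (?ep z). eval ?P ?\<rho> (Call 0 [EHead (Var 0), ETail (Var 0)]) (enc_bool (fst z = snd z)) t"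
    by blast
qed

lemma pt_eq [pt_intros]:
  assumes "pt m ex ea f" "pt m ex ea g" "inj ea"
  shows "pt m ex enc_bool (\<lambda>x. f x = g x)"
proof -
  have "pt m ex enc_bool (\<lambda>x. ea (f x) = ea (g x))"
    by (rule pt_lift2[OF pt_eq_tree]; rule pt_recode[OF assms(1)] pt_recode[OF assms(2)]) simp_all
  then show ?thesis
    using assms(3) by (simp add: inj_eq)
qed

lemma inj_enc_bool: "inj enc_bool"
  by (rule injI) (metis enc_bool.elims tree.distinct(1))

lemmas [pt_intros] = inj_enc_bool inj_enc_nat inj_enc_list inj_enc_pair inj_enc_option

subsection \<open>Lists\<close>

lemma sum_list_take_le: "sum_list (take i xs) \<le> sum_list (xs :: nat list)"
  by (metis append_take_drop_id le_add1 sum_list_append)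

lemma sum_list_map_take_le: "sum_list (map f (take i xs)) \<le> (sum_list (map f xs) :: nat)"
  by (metis sum_list_take_le take_map)

lemma foldl_Cons_eq: "foldl (\<lambda>s a. h a # s) ys xs = rev (map h xs) @ ys"
  by (induction xs arbitrary: ys) simp_all

lemma pt_rev0: "pt (\<lambda>_. 0) (enc_list ea) (enc_list ea) rev"
proof -
  have "pt (\<lambda>_. 0) (enc_list ea) (enc_list ea) (\<lambda>x. foldl (\<lambda>s a. a # s) [] x)"
  proof (rule pt_foldl[where B = "\<lambda>x. tree_size (enc_list ea x)" and m' = "\<lambda>_. 0"])
    show "tree_size (enc_list ea (foldl (\<lambda>s a. a # s) [] (take i x))) \<le> tree_size (enc_list ea x)" for x i
      by (simp add: foldl_Cons_eq[of "\<lambda>x. x", simplified] tree_size_enc_list sum_list_map_take_le flip: rev_map)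
  qed (rule pt_intros pb_intros | simp)+
  then show ?thesis by (simp add: foldl_Cons_eq[of "\<lambda>x. x", simplified])
qed

lemmas pt_rev [pt_intros] = pt_lift1[OF pt_rev0]

lemma pt_append0: "pt (\<lambda>_. 0) (enc_pair (enc_list ea) (enc_list ea)) (enc_list ea) (\<lambda>z. fst z @ snd z)"
proof -
  let ?e = "enc_pair (enc_list ea) (enc_list ea)"
  have "pt (\<lambda>_. 0) ?e (enc_list ea) (\<lambda>z. foldl (\<lambda>s a. a # s) (snd z) (rev (fst z)))"
  proof (rule pt_foldl[where B = "\<lambda>x. tree_size (?e x)" and m' = "\<lambda>_. 0"])
    show "tree_size (enc_list ea (foldl (\<lambda>s a. a # s) (snd z) (take i (rev (fst z))))) \<le> tree_size (?e z)" for z i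
      using sum_list_map_take_le[of "\<lambda>x. Suc (tree_size (ea x))" i "rev (fst z)"]
      by (simp add: foldl_Cons_eq[of "\<lambda>x. x", simplified] tree_size_enc_list enc_pair_Cell rev_map[symmetric])
  qed (rule pt_intros pb_intros | simp)+
  then show ?thesis by (simp add: foldl_Cons_eq[of "\<lambda>x. x", simplified])
qed

lemmas pt_append [pt_intros] = pt_lift2[OF pt_append0]

lemma foldl_append_eq: "foldl (\<lambda>s a. s @ a) ys xs = ys @ concat xs"
  by (induction xs arbitrary: ys) simp_all

lemma tree_size_concat: "tree_size (enc_list ea (concat xss)) \<le> tree_size (enc_list (enc_list ea) xss)"
  by (induction xss) (simp_all add: tree_size_enc_list)

lemma tree_size_take: "tree_size (enc_list ea (take i xs)) \<le> tree_size (enc_list ea xs)"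
  by (simp add: tree_size_enc_list sum_list_map_take_le)

lemma pt_concat0: "pt (\<lambda>_. 0) (enc_list (enc_list ea)) (enc_list ea) concat"
proof -
  have "pt (\<lambda>_. 0) (enc_list (enc_list ea)) (enc_list ea) (\<lambda>x. foldl (\<lambda>s a. s @ a) [] x)"
  proof (rule pt_foldl[where B = "\<lambda>x. tree_size (enc_list (enc_list ea) x)" and m' = "\<lambda>_. 0"])
    show "tree_size (enc_list ea (foldl (\<lambda>s a. s @ a) [] (take i x))) \<le> tree_size (enc_list (enc_list ea) x)" for x i
      using tree_size_concat[of ea "take i x"] tree_size_take[of "enc_list ea" i x]
      by (simp add: foldl_append_eq)
  qed (rule pt_intros pb_intros | simp)+
  then show ?thesis by (simp add: foldl_append_eq)
qed

lemmas pt_concat [pt_intros] = pt_lift1[OF pt_concat0]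

lemma pt_project:
  assumes "pt (\<lambda>z. m (fst z)) (enc_pair ex ea) ey (\<lambda>z. g (fst z) (snd z))"
    and "pt m' ex' ex p" "pt m' ex' ea q" "poly_bounded m' ex' (\<lambda>z. m (p z))"
  shows "pt m' ex' ey (\<lambda>z. g (p z) (q z))"
  using pt_comp[OF pt_Pair[OF assms(2,3)] assms(1)] assms(4) by simp

lemma pt_map [pt_intros]:
  assumes g: "pt (\<lambda>z. m (fst z)) (enc_pair ex ea) eb (\<lambda>z. g (fst z) (snd z))"
    and xs: "pt m ex (enc_list ea) xs"
  shows "pt m ex (enc_list eb) (\<lambda>x. map (g x) (xs x))"
proof -
  let ?R = "\<lambda>x z. fst z = x \<and> snd z \<in> set (xs x)"
  let ?B = "\<lambda>x. m x + tree_size (ex x) + tree_size (enc_list ea (xs x)) + 1"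
  obtain U where U: "poly_bounded m ex U" "\<And>x z. ?R x z \<Longrightarrow> tree_size (eb (g (fst z) (snd z))) \<le> U x"
  proof (rule poly_bounded_uniform[OF pt_size[OF g], of m ex ?B ?R])
    show "poly_bounded m ex ?B" by (intro pb_intros pt_size[OF xs])
    show "tree_size (enc_pair ex ea z) \<le> ?B x" if "?R x z" for x z
      using that tree_size_elem[of "snd z" "xs x" ea] by (simp add: enc_pair_Cell)
  qed auto
  let ?B' = "\<lambda>x. Suc (tree_size (enc_list ea (xs x)) * Suc (U x)) + m x"
  \<comment> \<open>The loop pushes results onto the front and so builds the list backwards; a
    reversal follows.\<close>
  have "pt m ex (enc_list eb) (\<lambda>x. foldl (\<lambda>s a. g x a # s) [] (xs x))"
  proof (rule pt_foldl[where B = ?B' and m' = "\<lambda>z. m (fst z)"])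
    have "pt (\<lambda>z. m (fst z)) (enc_pair ex (enc_pair (enc_list eb) ea)) eb (\<lambda>z. g (fst z) (snd (snd z)))"
      by (rule pt_project[OF g]) (rule pt_intros pb_intros)+
    then show "pt (\<lambda>z. m (fst z)) (enc_pair ex (enc_pair (enc_list eb) ea)) (enc_list eb)
       (\<lambda>z. g (fst z) (snd (snd z)) # fst (snd z))"
      by (rule pt_Cons) (rule pt_intros)+
    show "poly_bounded m ex ?B'"
      by (intro pb_intros pt_size[OF xs] U)
    fix x i
    have "sum_list (map (\<lambda>a. Suc (tree_size (eb (g x a)))) (take i (xs x))) \<le> sum_list (map (\<lambda>a. Suc (tree_size (eb (g x a)))) (xs x))"
      by (rule sum_list_map_take_le)
    also have "\<dots> \<le> sum_list (map (\<lambda>a. Suc (U x)) (xs x))"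
      using U(2)[of "(x, a)" x for a] by (intro sum_list_mono) simp
    also have "\<dots> \<le> tree_size (enc_list ea (xs x)) * Suc (U x)"
      using mult_right_mono[OF length_le_tree_size[of "xs x" ea], of "Suc (U x)"]
      by (simp add: sum_list_triv)
    finally show "tree_size (enc_list eb (foldl (\<lambda>s a. g x a # s) [] (take i (xs x)))) \<le> ?B' x"
      by (simp add: foldl_Cons_eq tree_size_enc_list comp_def rev_map[symmetric])
  qed (rule pt_intros xs | simp)+
  then have "pt m ex (enc_list eb) (\<lambda>x. rev (foldl (\<lambda>s a. g x a # s) [] (xs x)))"
    by (rule pt_rev)
  then show ?thesis by (simp add: foldl_Cons_eq)
qed

lemma pt_filter [pt_intros]:
  assumes g: "pt (\<lambda>z. m (fst z)) (enc_pair ex ea) enc_bool (\<lambda>z. g (fst z) (snd z))"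
    and xs: "pt m ex (enc_list ea) xs"
  shows "pt m ex (enc_list ea) (\<lambda>x. filter (g x) (xs x))"
proof -
  have eq: "filter p ys = concat (map (\<lambda>a. if p a then [a] else []) ys)" for p and ys :: "'b list"
    by (induction ys) simp_all
  show ?thesis
    unfolding eq by (rule pt_intros g xs)+
qed

lemma pt_Nil [pt_intros]:
  assumes "pt m ex (enc_list ea) f"
  shows "pt m ex enc_bool (\<lambda>x. f x = [])"
proof (rule pt_Cond[OF assms pt_const pt_const])
  show "enc_list ea (f x) \<noteq> Atom \<Longrightarrow> enc_bool (f x = []) = enc_bool False" for x by (cases "f x") auto
  show "enc_list ea (f x) = Atom \<Longrightarrow> enc_bool (f x = []) = enc_bool True" for x by (cases "f x") auto
qed

lemma pt_Bex [pt_intros]: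
  assumes g: "pt (\<lambda>z. m (fst z)) (enc_pair ex ea) enc_bool (\<lambda>z. g (fst z) (snd z))"
    and xs: "pt m ex (enc_list ea) xs"
  shows "pt m ex enc_bool (\<lambda>x. \<exists>a\<in>set (xs x). g x a)"
proof -
  have "pt m ex enc_bool (\<lambda>x. \<not> filter (g x) (xs x) = [])"
    by (rule pt_not pt_Nil pt_filter g xs)+
  then show ?thesis by (simp add: filter_empty_conv)
qed

lemma pt_Ball [pt_intros]:
  assumes g: "pt (\<lambda>z. m (fst z)) (enc_pair ex ea) enc_bool (\<lambda>z. g (fst z) (snd z))"
    and xs: "pt m ex (enc_list ea) xs"
  shows "pt m ex enc_bool (\<lambda>x. \<forall>a\<in>set (xs x). g x a)"
proof -
  have "pt m ex enc_bool (\<lambda>x. \<not> (\<exists>a\<in>set (xs x). \<not> g x a))"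
    by (rule pt_not pt_Bex g xs)+
  then show ?thesis by simp
qed

lemma pt_mem0:
  assumes "inj ea"
  shows "pt (\<lambda>_. 0) (enc_pair ea (enc_list ea)) enc_bool (\<lambda>z. fst z \<in> set (snd z))"
proof -
  have "pt (\<lambda>_. 0) (enc_pair ea (enc_list ea)) enc_bool (\<lambda>z. \<exists>a\<in>set (snd z). a = fst z)"
    by (rule pt_intros assms)+
  then show ?thesis by simp
qed

lemmas pt_mem [pt_intros] = pt_lift2[OF pt_mem0, rotated 1]

lemma pt_foldl_small:
  assumes s: "pt m ex es s" and xs: "pt m ex (enc_list ea) xs"
    and h: "pt (\<lambda>z. m (fst z)) (enc_pair ex (enc_pair es ea)) es (\<lambda>z. h (fst z) (fst (snd z)) (snd (snd z)))"
    and small: "\<And>s. tree_size (es s) \<le> c"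
  shows "pt m ex es (\<lambda>x. foldl (h x) (s x) (xs x))"
  by (rule pt_foldl[OF s xs h, where B = "\<lambda>x. m x + c"])
    (auto intro!: pb_intros intro: small trans_le_add2)

lemma subseqs_foldl: "subseqs xs = foldl (\<lambda>s a. map (\<lambda>y. a # y) s @ s) [[]] (rev xs)"
  by (induction xs) (simp_all add: Let_def)

lemma tree_size_subseqs:
  "tree_size (enc_list (enc_list ea) (subseqs xs)) \<le> 2 ^ length xs * Suc (tree_size (enc_list ea xs)) + 1"
proof -
  have "tree_size (enc_list ea ys) \<le> tree_size (enc_list ea xs)" if "ys \<in> set (subseqs xs)" for ys
    using that
  proof (induction xs arbitrary: ys)
    case (Cons x xs)
    then show ?case by (fastforce simp: Let_def)
  qed simp
  then have "sum_list (map (\<lambda>ys. Suc (tree_size (enc_list ea ys))) (subseqs xs))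
      \<le> sum_list (map (\<lambda>_. Suc (tree_size (enc_list ea xs))) (subseqs xs))"
    by (intro sum_list_mono) simp
  then show ?thesis
    by (simp add: tree_size_enc_list sum_list_triv length_subseqs)
qed

text \<open>The one list construction with exponentially long output. Its length must be covered by
  the budget, and here the factor 2^(k + t^-) enters the running time.\<close>

lemma pt_subseqs:
  assumes xs: "pt m ex (enc_list ea) xs" and b: "poly_bounded m ex (\<lambda>x. 2 ^ length (xs x))"
  shows "pt m ex (enc_list (enc_list ea)) (\<lambda>x. subseqs (xs x))"
proof -
  let ?B = "\<lambda>x. 2 ^ length (xs x) * Suc (tree_size (enc_list ea (xs x))) + 1"
  have "pt m ex (enc_list (enc_list ea)) (\<lambda>x. foldl (\<lambda>s a. map (\<lambda>y. a # y) s @ s) [[]] (rev (xs x)))"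
  proof (rule pt_foldl[where B = ?B and m' = "\<lambda>_. 0"])
    show "poly_bounded m ex ?B" by (intro pb_intros b pt_size[OF xs])
    fix x i
    let ?ys = "rev (take i (rev (xs x)))"
    have "tree_size (enc_list (enc_list ea) (subseqs ?ys)) \<le> 2 ^ length ?ys * Suc (tree_size (enc_list ea ?ys)) + 1"
      by (rule tree_size_subseqs)
    also have "\<dots> \<le> ?B x"
      using sum_list_map_take_le[of "\<lambda>x. Suc (tree_size (ea x))" i "rev (xs x)"]
      by (intro add_mono mult_mono power_increasing) (simp_all add: tree_size_enc_list rev_map[symmetric])
    finally show "tree_size (enc_list (enc_list ea) (foldl (\<lambda>s a. map (\<lambda>y. a # y) s @ s) [[]] (take i (rev (xs x))))) \<le> ?B x"
      by (simp add: subseqs_foldl)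
  qed (rule pt_intros xs | simp)+
  then show ?thesis by (simp add: subseqs_foldl)
qed

subsection \<open>Arithmetic\<close>

fun bits :: "nat \<Rightarrow> bool list" where
  "bits n = (if n = 0 then [] else odd n # bits (n div 2))"

declare bits.simps [simp del]

lemma bits_0 [simp]: "bits 0 = []"
  by (simp add: bits.simps)

text \<open>A number and its list of bits are the same tree, so arithmetic can be programmed as list
  processing without any conversion.\<close>

lemma enc_list_bits: "enc_list enc_bool (bits n) = enc_nat n"
  by (induction n rule: bits.induct) (subst bits.simps, subst enc_nat.simps, simp)

lemma length_bits_le_iff: "length (bits n) \<le> j \<longleftrightarrow> n < 2 ^ j"
proof (induction n arbitrary: j rule: bits.induct)
  case (1 n)
  show ?case
  proof (cases "n = 0")
    case False
    show ?thesis
    proof (cases j)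
      case (Suc i)
      have "n div 2 < 2 ^ i \<longleftrightarrow> n < 2 ^ Suc i" by (auto simp: div_less_iff_less_mult mult.commute)
      then show ?thesis
        using False 1(1)[of i] Suc by (simp add: bits.simps[of n])
    qed (use False in \<open>simp add: bits.simps[of n]\<close>)
  qed simp
qed

lemma less_power_bits: "n < 2 ^ length (bits n)"
  using length_bits_le_iff by blast

lemma length_bits_mono: "m \<le> n \<Longrightarrow> length (bits m) \<le> length (bits n)"
  using length_bits_le_iff less_power_bits le_less_trans by blast

lemma tree_size_enc_nat_le: "tree_size (enc_nat n) \<le> 4 * length (bits n) + 1"
proof -
  have "tree_size (enc_list enc_bool bs) \<le> 4 * length bs + 1" for bs
  proof (induction bs)
    case (Cons b bs)
    then show ?case by (cases b) simp_all
  qed simp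
  then show ?thesis by (metis enc_list_bits)
qed

lemma length_bits_le: "length (bits n) \<le> tree_size (enc_nat n)"
  using length_le_tree_size[of "bits n" enc_bool] by (simp add: enc_list_bits)

lemma tree_size_enc_nat_pow2: "n < 2 ^ j \<Longrightarrow> tree_size (enc_nat n) \<le> 4 * j + 1"
  using tree_size_enc_nat_le[of n] length_bits_le_iff[of n j] by linarith

lemma pt_bits [pt_intros]: "pt m ex enc_nat f \<Longrightarrow> pt m ex (enc_list enc_bool) (\<lambda>x. bits (f x))"
  by (erule pt_recode) (simp add: enc_list_bits)

definition bit_cons :: "bool \<Rightarrow> nat \<Rightarrow> nat" where
  "bit_cons b n = of_bool b + 2 * n"

lemma pt_bit_cons [pt_intros]:
  assumes "pt m ex enc_bool b" "pt m ex enc_nat n"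
  shows "pt m ex enc_nat (\<lambda>x. bit_cons (b x) (n x))"
proof -
  \<comment> \<open>A zero bit in front of the number 0 must be dropped, since numerals carry no
    leading zeros.\<close>
  have "pt m ex (enc_list enc_bool) (\<lambda>x. if bits (n x) = [] \<and> \<not> b x then [] else b x # bits (n x))"
    by (rule pt_intros assms)+
  then show ?thesis
  proof (rule pt_recode)
    show "enc_list enc_bool (if bits (n x) = [] \<and> \<not> b x then [] else b x # bits (n x)) =
        enc_nat (bit_cons (b x) (n x))" for x
      unfolding enc_list_bits[symmetric]
      by (cases "b x"; cases "n x = 0") (simp_all add: bit_cons_def bits.simps)
  qed
qed

lemma pt_half [pt_intros]:
  assumes "pt m ex enc_nat n"
  shows "pt m ex enc_nat (\<lambda>x. n x div 2)"
proof (rule pt_recode)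
  show "pt m ex (enc_list enc_bool) (\<lambda>x. tl (bits (n x)))"
    by (rule pt_intros assms)+
  show "enc_list enc_bool (tl (bits (n x))) = enc_nat (n x div 2)" for x
    unfolding enc_list_bits[symmetric] by (cases "n x = 0") (simp_all add: bits.simps[of "n x"])
qed

lemma pt_odd [pt_intros]:
  assumes "pt m ex enc_nat n"
  shows "pt m ex enc_bool (\<lambda>x. odd (n x))"
proof (rule pt_cong)
  show "pt m ex enc_bool (\<lambda>x. case bits (n x) of [] \<Rightarrow> False | a # as \<Rightarrow> a)"
    by (rule pt_intros assms)+
  show "(case bits (n x) of [] \<Rightarrow> False | a # as \<Rightarrow> a) = odd (n x)" for x
    by (cases "n x = 0") (simp_all add: bits.simps[of "n x"])
qed

text \<open>Reads the most significant bit first, opposite to \<open>bits\<close>; this is the order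
  in which a loop that pushes low bits first leaves its output.\<close>

definition of_bits :: "bool list \<Rightarrow> nat" where
  "of_bits bs = foldl (\<lambda>n b. bit_cons b n) 0 bs"

lemma of_bits_less: "of_bits bs < 2 ^ length bs"
proof (induction bs rule: rev_induct)
  case (snoc b bs)
  then show ?case by (cases b) (simp_all add: of_bits_def bit_cons_def)
qed (simp add: of_bits_def)

lemma of_bits_Cons: "of_bits (b # bs) = of_bool b * 2 ^ length bs + of_bits bs"
proof (induction bs rule: rev_induct)
  case (snoc c bs)
  then show ?case by (simp add: of_bits_def bit_cons_def algebra_simps)
qed (simp add: of_bits_def bit_cons_def)

lemma pt_of_bits0: "pt (\<lambda>_. 0) (enc_list enc_bool) enc_nat of_bits"
  unfolding of_bits_def
proof (rule pt_foldl[where B = "\<lambda>x. 4 * tree_size (enc_list enc_bool x) + 1" and m' = "\<lambda>_. 0"])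
  fix x :: "bool list" and i
  have "tree_size (enc_nat (of_bits (take i x))) \<le> 4 * length (take i x) + 1"
    using of_bits_less tree_size_enc_nat_pow2 by blast
  also have "\<dots> \<le> 4 * tree_size (enc_list enc_bool x) + 1"
    using length_le_tree_size[of x enc_bool] by simp
  finally show "tree_size (enc_nat (foldl (\<lambda>n b. bit_cons b n) 0 (take i x))) \<le> 4 * tree_size (enc_list enc_bool x) + 1"
    by (simp add: of_bits_def)
qed (rule pt_intros pb_intros | simp)+

lemmas pt_of_bits [pt_intros] = pt_lift1[OF pt_of_bits0]

text \<open>The state holds the remaining summands, the carry, and the output, most significant bit first.\<close>

definition add_step :: "nat \<times> nat \<times> bool \<times> bool list \<Rightarrow> bool \<Rightarrow> nat \<times> nat \<times> bool \<times> bool list" where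
  "add_step s (_ :: bool) =
     (fst s div 2, fst (snd s) div 2,
      (if fst (snd (snd s)) then odd (fst s) \<or> odd (fst (snd s)) else odd (fst s) \<and> odd (fst (snd s))),
      (odd (fst s) = (odd (fst (snd s)) = fst (snd (snd s)))) # snd (snd (snd s)))"

text \<open>The invariant of ripple-carry addition: the output so far holds the low bits, and the
  unread rests plus the carry account for the remainder.\<close>

lemma foldl_add_step:
  "foldl add_step (a, b, False, []) xs = (a', b', c, out) \<Longrightarrow>
     length out = length xs \<and> a' = a div 2 ^ length xs \<and> b' = b div 2 ^ length xs \<and>
     a + b = of_bits out + 2 ^ length xs * (a' + b' + of_bool c)"
proof (induction xs arbitrary: a' b' c out rule: rev_induct)
  case Nil
  then show ?case by (simp add: of_bits_def)
next
  case (snoc x xs)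
  obtain a1 b1 c1 out1 where 1: "foldl add_step (a, b, False, []) xs = (a1, b1, c1, out1)"
    using prod_cases4 by blast
  note IH = snoc.IH[OF 1]
  have "add_step (a1, b1, c1, out1) x = (a', b', c, out)"
    using snoc.prems 1 by simp
  then have eq: "a' = a1 div 2" "b' = b1 div 2"
    "c = (if c1 then odd a1 \<or> odd b1 else odd a1 \<and> odd b1)" "out = (odd a1 = (odd b1 = c1)) # out1"
    by (auto simp: add_step_def)
  have "a1 = of_bool (odd a1) + 2 * a'" "b1 = of_bool (odd b1) + 2 * b'"
    unfolding eq by simp_all
  then have *: "a1 + b1 + of_bool c1 = of_bool (odd a1 = (odd b1 = c1)) + 2 * (a' + b' + of_bool c)"
    unfolding eq(3) by (cases "odd a1"; cases "odd b1"; cases c1) simp_all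
  have "a + b = of_bits out1 + 2 ^ length xs * (a1 + b1 + of_bool c1)"
    using IH by simp
  also have "\<dots> = of_bits out + 2 ^ length (xs @ [x]) * (a' + b' + of_bool c)"
    unfolding * eq(4) of_bits_Cons using IH by (simp add: algebra_simps)
  finally show ?case
    using IH eq by (simp add: div_mult2_eq mult.commute[of 2])
qed

text \<open>The list folded over serves as a clock. With one tick more than both bit lengths
  together, \<open>a + b\<close> is below 2 to the number of ticks, so both rests and the carry end
  at 0.\<close>

lemma add_eq_of_bits:
  "a + b = of_bits (snd (snd (snd (foldl add_step (a, b, False, []) (bits a @ bits b @ [False])))))"
proof -
  let ?xs = "bits a @ bits b @ [False]"
  obtain a' b' c out where 1: "foldl add_step (a, b, False, []) ?xs = (a', b', c, out)"
    using prod_cases4 by blast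
  note * = foldl_add_step[OF 1]
  have "a < 2 ^ length (bits a)" "b < 2 ^ length (bits b)"
    by (rule less_power_bits)+
  moreover have "(2 :: nat) ^ length (bits a) \<le> 2 ^ (length (bits a) + length (bits b))"
    "(2 :: nat) ^ length (bits b) \<le> 2 ^ (length (bits a) + length (bits b))"
    by (intro power_increasing; simp)+
  ultimately have "a + b < 2 ^ (length (bits a) + length (bits b)) + 2 ^ (length (bits a) + length (bits b))"
    by linarith
  then have less: "a + b < 2 ^ length ?xs"
    by simp
  have "a' + b' + of_bool c = 0"
  proof (rule ccontr)
    assume "a' + b' + of_bool c \<noteq> 0"
    then have "1 \<le> a' + b' + of_bool c" by linarith
    then have "2 ^ length ?xs * 1 \<le> 2 ^ length ?xs * (a' + b' + of_bool c)"
      by (rule mult_left_mono) simp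
    with less * show False by linarith
  qed
  with * have "a + b = of_bits out" by (metis add_0_right mult_0_right)
  then show ?thesis unfolding 1 by simp
qed

lemma pt_add0: "pt (\<lambda>_. 0) (enc_pair enc_nat enc_nat) enc_nat (\<lambda>z. fst z + snd z)"
proof -
  let ?e = "enc_pair enc_nat enc_nat"
  let ?es = "enc_pair enc_nat (enc_pair enc_nat (enc_pair enc_bool (enc_list enc_bool)))"
  have "pt (\<lambda>_. 0) ?e ?es (\<lambda>z. foldl add_step (fst z, snd z, False, []) (bits (fst z) @ bits (snd z) @ [False]))"
  proof (rule pt_foldl[where B = "\<lambda>z. 16 * tree_size (?e z) + 20" and m' = "\<lambda>_. 0"])
    fix z :: "nat \<times> nat" and i
    let ?xs = "take i (bits (fst z) @ bits (snd z) @ [False])"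
    obtain a' b' c out where 1: "foldl add_step (fst z, snd z, False, []) ?xs = (a', b', c, out)"
      using prod_cases4 by blast
    note * = foldl_add_step[OF 1]
    have "tree_size (enc_list enc_bool bs) \<le> 4 * length bs + 1" for bs
    proof (induction bs)
      case (Cons b bs)
      then show ?case by (cases b) simp_all
    qed simp
    from this[of out] have "tree_size (enc_list enc_bool out) \<le> 4 * (length (bits (fst z)) + length (bits (snd z)) + 1) + 1"
      using * by simp
    moreover have "tree_size (enc_nat a') \<le> 4 * length (bits (fst z)) + 1"
      using tree_size_enc_nat_le[of a'] length_bits_mono[of a' "fst z"] * by simp
    moreover have "tree_size (enc_nat b') \<le> 4 * length (bits (snd z)) + 1"
      using tree_size_enc_nat_le[of b'] length_bits_mono[of b' "snd z"] * by simp
    moreover have "tree_size (enc_bool c) \<le> 3" by (cases c) simp_all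
    ultimately show "tree_size (?es (foldl add_step (fst z, snd z, False, []) ?xs)) \<le> 16 * tree_size (?e z) + 20"
      unfolding 1 using length_bits_le[of "fst z"] length_bits_le[of "snd z"]
      by (simp add: enc_pair_Cell)
  qed (unfold add_step_def, (rule pt_intros pb_intros | simp)+)
  note 1 = this
  have "pt (\<lambda>_. 0) ?e enc_nat (\<lambda>z. of_bits (snd (snd (snd
      (foldl add_step (fst z, snd z, False, []) (bits (fst z) @ bits (snd z) @ [False]))))))"
    by (rule pt_of_bits pt_snd 1)+
  then show ?thesis unfolding add_eq_of_bits[symmetric] .
qed

lemmas pt_add [pt_intros] = pt_lift2[OF pt_add0]

lemma of_bits_rev_bits: "of_bits (rev (bits n)) = n"
proof (induction n rule: bits.induct)
  case (1 n)
  show ?case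
  proof (cases "n = 0")
    case False
    then have "of_bits (rev (bits n)) = bit_cons (odd n) (of_bits (rev (bits (n div 2))))"
      by (simp add: bits.simps[of n] of_bits_def)
    then show ?thesis using 1 False by (simp add: bit_cons_def)
  qed (simp add: of_bits_def)
qed

text \<open>Shift-and-add multiplication, that is, Horner's rule on the bits of the first
  factor.\<close>

lemma foldl_mult_eq:
  "foldl (\<lambda>s c. if c then bit_cons False s + b else bit_cons False s) 0 bs = of_bits bs * b"
proof (induction bs rule: rev_induct)
  case (snoc c bs)
  then show ?case by (cases c) (simp_all add: of_bits_def bit_cons_def)
qed (simp add: of_bits_def)

lemma pt_mult0: "pt (\<lambda>_. 0) (enc_pair enc_nat enc_nat) enc_nat (\<lambda>z. fst z * snd z)"
proof -
  let ?e = "enc_pair enc_nat enc_nat"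
  have "pt (\<lambda>_. 0) ?e enc_nat
    (\<lambda>z. foldl (\<lambda>s c. if c then bit_cons False s + snd z else bit_cons False s) 0 (rev (bits (fst z))))"
  proof (rule pt_foldl[where B = "\<lambda>z. 4 * tree_size (?e z) + 1" and m' = "\<lambda>_. 0"])
    fix z :: "nat \<times> nat" and i
    let ?bs = "take i (rev (bits (fst z)))"
    have "of_bits ?bs * snd z < 2 ^ length ?bs * 2 ^ length (bits (snd z))"
      by (intro mult_strict_mono of_bits_less less_power_bits) simp_all
    also have "\<dots> \<le> 2 ^ (length (bits (fst z)) + length (bits (snd z)))"
      unfolding power_add[symmetric] by (intro power_increasing) simp_all
    finally have "tree_size (enc_nat (of_bits ?bs * snd z)) \<le> 4 * (length (bits (fst z)) + length (bits (snd z))) + 1"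
      by (rule tree_size_enc_nat_pow2)
    then show "tree_size (enc_nat (foldl (\<lambda>s c. if c then bit_cons False s + snd z else bit_cons False s) 0 ?bs))
        \<le> 4 * tree_size (?e z) + 1"
      unfolding foldl_mult_eq using length_bits_le[of "fst z"] length_bits_le[of "snd z"]
      by (simp add: enc_pair_Cell)
  qed (rule pt_intros pb_intros | simp)+
  then show ?thesis by (simp add: foldl_mult_eq of_bits_rev_bits)
qed

lemmas pt_mult [pt_intros] = pt_lift2[OF pt_mult0]

text \<open>Exponents are kept in unary: a power has about as many bits as the exponent times the
  length of the base, which is not polynomial in a binary exponent.\<close>

primrec enc_unary :: "nat \<Rightarrow> tree" where
  "enc_unary 0 = Atom"
| "enc_unary (Suc n) = Cell Atom (enc_unary n)"

lemma enc_unary_list: "enc_list (\<lambda>_. Atom) xs = enc_unary (length xs)"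
  by (induction xs) simp_all

lemma inj_enc_unary [pt_intros]: "inj enc_unary"
proof (rule injI)
  show "enc_unary m = enc_unary n \<Longrightarrow> m = n" for m n
  proof (induction m arbitrary: n)
    case 0
    then show ?case by (cases n) auto
  next
    case (Suc m)
    then show ?case by (cases n) auto
  qed
qed

lemma tree_size_enc_unary: "tree_size (enc_unary n) = 2 * n + 1"
  by (induction n) simp_all

lemma pt_power0: "pt (\<lambda>_. 0) (enc_pair enc_nat enc_unary) enc_nat (\<lambda>z. fst z ^ snd z)"
proof -
  let ?e = "enc_pair enc_nat enc_unary"
  have eq: "foldl (\<lambda>p _. p * n) 1 us = n ^ length us" for n :: nat and us :: "unit list"
    by (induction us rule: rev_induct) simp_all
  have "pt (\<lambda>_. 0) ?e enc_nat (\<lambda>z. foldl (\<lambda>p _. p * fst z) 1 (replicate (snd z) ()))"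
  proof (rule pt_foldl[where B = "\<lambda>z. 4 * (tree_size (?e z) * tree_size (?e z) + 1) + 1" and m' = "\<lambda>_. 0"])
    show "pt (\<lambda>_. 0) ?e (enc_list (\<lambda>_. Atom)) (\<lambda>z. replicate (snd z) ())"
    proof (rule pt_recode)
      show "pt (\<lambda>_. 0) ?e enc_unary snd" by (rule pt_intros)+
    qed (simp add: enc_unary_list)
    fix z :: "nat \<times> nat" and i
    assume i: "i \<le> length (replicate (snd z) ())"
    have "fst z ^ i \<le> (2 ^ length (bits (fst z))) ^ i"
      by (intro power_mono less_imp_le[OF less_power_bits]) simp
    also have "\<dots> < 2 ^ (length (bits (fst z)) * i + 1)"
      by (simp add: power_mult)
    finally have "tree_size (enc_nat (fst z ^ i)) \<le> 4 * (length (bits (fst z)) * i + 1) + 1"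
      by (rule tree_size_enc_nat_pow2)
    also have "length (bits (fst z)) * i \<le> tree_size (?e z) * tree_size (?e z)"
      using length_bits_le[of "fst z"] i
      by (intro mult_mono) (simp_all add: enc_pair_Cell tree_size_enc_unary)
    finally show "tree_size (enc_nat (foldl (\<lambda>p _. p * fst z) 1 (take i (replicate (snd z) ()))))
        \<le> 4 * (tree_size (?e z) * tree_size (?e z) + 1) + 1"
      using i unfolding eq by simp
  qed (rule pt_intros pb_intros | simp)+
  then show ?thesis unfolding eq by simp
qed

lemmas pt_power [pt_intros] = pt_lift2[OF pt_power0]

lemma sum_list_less_power: "sum_list xs < 2 ^ tree_size (enc_list enc_nat xs)"
proof (induction xs)
  case (Cons x xs)
  let ?a = "tree_size (enc_nat x)" and ?b = "tree_size (enc_list enc_nat xs)"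
  have "x < 2 ^ ?a"
    using length_bits_le length_bits_le_iff by blast
  moreover have "(2 :: nat) ^ ?a \<le> 2 ^ (?a + ?b)" "(2 :: nat) ^ ?b \<le> 2 ^ (?a + ?b)"
    by (intro power_increasing; simp)+
  ultimately have "x + sum_list xs < 2 ^ (?a + ?b) + 2 ^ (?a + ?b)"
    using Cons.IH by linarith
  then show ?case by simp
qed simp

lemma pt_sum_list0: "pt (\<lambda>_. 0) (enc_list enc_nat) enc_nat sum_list"
proof -
  have eq: "foldl (+) 0 xs = sum_list xs" for xs :: "nat list"
    by (induction xs rule: rev_induct) simp_all
  have "pt (\<lambda>_. 0) (enc_list enc_nat) enc_nat (\<lambda>x. foldl (\<lambda>a b. a + b) 0 x)"
  proof (rule pt_foldl[where B = "\<lambda>z. 4 * tree_size (enc_list enc_nat z) + 1" and m' = "\<lambda>_. 0"])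
    fix xs :: "nat list" and i
    have "sum_list (take i xs) < 2 ^ tree_size (enc_list enc_nat xs)"
      using sum_list_less_power[of xs] sum_list_take_le[of i xs] by simp
    then show "tree_size (enc_nat (foldl (\<lambda>a b. a + b) 0 (take i xs))) \<le> 4 * tree_size (enc_list enc_nat xs) + 1"
      unfolding eq by (rule tree_size_enc_nat_pow2)
  qed (rule pt_intros pb_intros | simp)+
  then show ?thesis by (simp add: eq)
qed

lemmas pt_sum_list [pt_intros] = pt_lift1[OF pt_sum_list0]

lemma pt_length0: "pt (\<lambda>_. 0) (enc_list ea) enc_nat length"
proof -
  have eq: "foldl (\<lambda>n _. n + 1) 0 xs = length xs" for xs :: "'a list"
    by (induction xs rule: rev_induct) simp_all
  have "pt (\<lambda>_. 0) (enc_list ea) enc_nat (\<lambda>x. foldl (\<lambda>n _. n + 1) 0 x)"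
  proof (rule pt_foldl[where B = "\<lambda>z. 4 * tree_size (enc_list ea z) + 1" and m' = "\<lambda>_. 0"])
    fix xs :: "'a list" and i
    have "tree_size (enc_nat (length (take i xs))) \<le> 4 * length (take i xs) + 1"
      using tree_size_enc_nat_pow2 less_exp by blast
    then show "tree_size (enc_nat (foldl (\<lambda>n _. n + 1) 0 (take i xs))) \<le> 4 * tree_size (enc_list ea xs) + 1"
      unfolding eq using length_le_tree_size[of xs ea] by simp
  qed (rule pt_intros pb_intros | simp)+
  then show ?thesis unfolding eq .
qed

lemmas pt_length = pt_lift1[OF pt_length0]

lemma pt_length_unary:
  assumes "pt m ex (enc_list ea) f"
  shows "pt m ex enc_unary (\<lambda>x. length (f x))"
proof (rule pt_recode)
  show "pt m ex (enc_list (\<lambda>_. Atom)) (\<lambda>x. map (\<lambda>_. ()) (f x))"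
    by (rule pt_intros assms)+
qed (simp add: enc_unary_list)

text \<open>The count is in binary and may be far larger than the list, so the loop runs over the
  list and compares a counter with it.\<close>

lemma pt_take0: "pt (\<lambda>_. 0) (enc_pair enc_nat (enc_list ea)) (enc_list ea) (\<lambda>z. take (fst z) (snd z))"
proof -
  let ?e = "enc_pair enc_nat (enc_list ea)"
  let ?h = "\<lambda>k s a. if fst s = k then s else (fst s + 1, snd s @ [a])"
  have eq: "foldl (?h k) (0, []) xs = (min k (length xs), take k xs)" for k and xs :: "'a list"
    by (induction xs rule: rev_induct) (auto simp: min_def)
  have 1: "pt (\<lambda>_. 0) ?e ?e (\<lambda>z. foldl (\<lambda>s a. if fst s = fst z then s else (fst s + 1, snd s @ [a])) (0, []) (snd z))"
  proof (rule pt_foldl[where B = "\<lambda>z. 5 * tree_size (?e z) + 2" and m' = "\<lambda>_. 0"])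
    fix z :: "nat \<times> 'a list" and i
    have "tree_size (enc_nat (min (fst z) (length (take i (snd z))))) \<le> 4 * min (fst z) (length (take i (snd z))) + 1"
      using tree_size_enc_nat_pow2 less_exp by blast
    also have "min (fst z) (length (take i (snd z))) \<le> tree_size (enc_list ea (snd z))"
      using length_le_tree_size[of "snd z" ea] by simp
    finally show "tree_size (?e (foldl (?h (fst z)) (0, []) (take i (snd z)))) \<le> 5 * tree_size (?e z) + 2"
      unfolding eq using tree_size_take[of ea "min (fst z) i" "snd z"]
      by (simp add: enc_pair_Cell min.commute)
  qed (rule pt_intros pb_intros | simp)+
  have "pt (\<lambda>_. 0) ?e (enc_list ea) (\<lambda>z. snd (foldl (?h (fst z)) (0, []) (snd z)))"
    by (rule pt_snd[OF 1])
  then show ?thesis unfolding eq by simp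
qed

lemmas pt_take [pt_intros] = pt_lift2[OF pt_take0]

section \<open>Counting weighted walks\<close>

definition lookup :: "('q \<times> nat) list \<Rightarrow> 'q \<Rightarrow> nat" where
  "lookup T q = (case filter (\<lambda>e. fst e = q) T of [] \<Rightarrow> 0 | e # es \<Rightarrow> snd e)"

text \<open>Multiplication of the vector \<open>T\<close> by a weighted adjacency matrix, given by
  lists of weighted successors.\<close>

definition walk_step :: "('q \<times> (nat \<times> 'q) list) list \<Rightarrow> ('q \<times> nat) list \<Rightarrow> ('q \<times> nat) list" where
  "walk_step A T = map (\<lambda>e. (fst e, sum_list (map (\<lambda>s. fst s * lookup T (snd s)) (snd e)))) A"

text \<open>The power of the matrix is the length of \<open>c\<close>, a list that plays the role of
  a unary counter.\<close>

definition walk_count :: "('q \<times> (nat \<times> 'q) list) list \<Rightarrow> ('q \<times> nat) list \<Rightarrow> 'c list \<Rightarrow> ('q \<times> nat) list" where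
  "walk_count A T c = foldl (\<lambda>T _. walk_step A T) T c"

lemma pt_lookup0:
  assumes "inj enq"
  shows "pt (\<lambda>_. 0) (enc_pair (enc_list (enc_pair enq enc_nat)) enq) enc_nat (\<lambda>z. lookup (fst z) (snd z))"
  unfolding lookup_def by (rule pt_intros assms)+

lemma pt_walk_step0:
  assumes "inj enq"
  shows "pt (\<lambda>_. 0) (enc_pair (enc_list (enc_pair enq (enc_list (enc_pair enc_nat enq))))
    (enc_list (enc_pair enq enc_nat))) (enc_list (enc_pair enq enc_nat)) (\<lambda>z. walk_step (fst z) (snd z))"
  unfolding walk_step_def by (rule pt_intros pt_lift2[OF pt_lookup0[OF assms]])+

lemma lookup_le: "(\<And>e. e \<in> set T \<Longrightarrow> snd e < M) \<Longrightarrow> 0 < M \<Longrightarrow> lookup T q < M"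
  unfolding lookup_def
  by (cases "filter (\<lambda>e. fst e = q) T") (simp, metis filter_eq_ConsD list.simps(5) in_set_conv_decomp)

lemma walk_step_bound:
  assumes "\<And>e. e \<in> set T \<Longrightarrow> snd e < M" "0 < M" "e \<in> set (walk_step A T)"
    "tree_size (enc_list (enc_pair enq (enc_list (enc_pair enc_nat enq))) A) \<le> N"
  shows "snd e < 2 ^ N * M" and "tree_size (enq (fst e)) \<le> N"
proof -
  obtain a where a: "a \<in> set A" "fst e = fst a"
    "snd e = sum_list (map (\<lambda>s. fst s * lookup T (snd s)) (snd a))"
    using assms(3) by (auto simp: walk_step_def)
  have size: "tree_size (enc_pair enq (enc_list (enc_pair enc_nat enq)) a) \<le> N"
    using tree_size_elem[OF a(1), of "enc_pair enq (enc_list (enc_pair enc_nat enq))"] assms(4) by linarith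
  then show "tree_size (enq (fst e)) \<le> N" by (simp add: enc_pair_Cell a(2))
  have "snd e \<le> sum_list (map (\<lambda>s. fst s * M) (snd a))"
    unfolding a(3) by (intro sum_list_mono mult_left_mono less_imp_le[OF lookup_le] assms) simp_all
  also have "\<dots> = sum_list (map fst (snd a)) * M"
    by (simp add: sum_list_mult_const comp_def)
  also have "\<dots> < 2 ^ tree_size (enc_list enc_nat (map fst (snd a))) * M"
    using assms(2) by (intro mult_strict_right_mono sum_list_less_power)
  also have "tree_size (enc_list enc_nat (map fst (snd a))) \<le> tree_size (enc_list (enc_pair enc_nat enq) (snd a))"
    unfolding tree_size_enc_list map_map comp_def Suc_le_mono
    by (intro sum_list_mono) (simp add: enc_pair_Cell)
  also have "\<dots> \<le> N" using size by (simp add: enc_pair_Cell)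
  finally show "snd e < 2 ^ N * M" by (simp add: power_increasing mult_right_mono)
qed

text \<open>The weights in a row sum to less than 2^N, so each step adds at most N bits.
  Exponentially many walks are thus counted with polynomially many bits.\<close>

lemma walk_count_bound:
  assumes "tree_size (enc_list (enc_pair enq (enc_list (enc_pair enc_nat enq))) A) \<le> N"
    "\<And>e. e \<in> set T \<Longrightarrow> snd e < 2 ^ N" "e \<in> set (walk_count A T c)"
  shows "snd e < 2 ^ (N * Suc (length c))"
  using assms(3)
proof (induction c arbitrary: e rule: rev_induct)
  case Nil
  then show ?case using assms(2) by (simp add: walk_count_def)
next
  case (snoc x c)
  have "snd e < 2 ^ N * 2 ^ (N * Suc (length c))"
    by (rule walk_step_bound(1)[OF snoc.IH _ _ assms(1)]) (use snoc.prems in \<open>simp_all add: walk_count_def\<close>)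
  then show ?case by (simp add: power_add algebra_simps)
qed

lemma pt_walk_count0:
  assumes "inj enq"
  shows "pt (\<lambda>_. 0) (enc_pair (enc_list (enc_pair enq (enc_list (enc_pair enc_nat enq))))
    (enc_pair (enc_list (enc_pair enq enc_nat)) (enc_list ec))) (enc_list (enc_pair enq enc_nat))
    (\<lambda>z. walk_count (fst z) (fst (snd z)) (snd (snd z)))"
proof -
  let ?eA = "enc_list (enc_pair enq (enc_list (enc_pair enc_nat enq)))" and ?eT = "enc_list (enc_pair enq enc_nat)"
  let ?e = "enc_pair ?eA (enc_pair ?eT (enc_list ec))"
  let ?N = "\<lambda>z. tree_size (?e z)"
  \<comment> \<open>At most N entries, each with a state of size at most N and a number of at most N
    * (N + 1) bits, at no more than four nodes per bit. The last summand covers round 0, where the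
    table is the given one.\<close>
  let ?B = "\<lambda>z. ?N z * (?N z + 4 * (?N z * Suc (?N z)) + 4) + 1 + ?N z"
  show ?thesis
    unfolding walk_count_def
  proof (rule pt_foldl[where B = ?B and m' = "\<lambda>_. 0"])
    fix z :: "('a \<times> (nat \<times> 'a) list) list \<times> ('a \<times> nat) list \<times> 'b list" and i
    obtain A T c where z: "z = (A, T, c)" by (cases z)
    assume i: "i \<le> length (snd (snd z))"
    have N: "tree_size (?eA A) \<le> ?N z" "tree_size (?eT T) \<le> ?N z" "length c \<le> ?N z"
      using length_le_tree_size[of c ec] by (auto simp: z)
    have len: "length A \<le> ?N z"
      using length_le_tree_size[of A "enc_pair enq (enc_list (enc_pair enc_nat enq))"] N(1) by linarith
    have "tree_size (?eT (walk_count A T (take i c))) \<le> ?B z"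
    proof (cases i)
      case 0
      then show ?thesis using N(2) by (simp add: walk_count_def)
    next
      case (Suc j)
      let ?T = "walk_count A T (take j c)"
      have i_eq: "walk_count A T (take i c) = walk_step A ?T"
        using i by (simp add: Suc z take_Suc_conv_app_nth walk_count_def)
      have T: "snd e < 2 ^ ?N z" if "e \<in> set T" for e
      proof -
        have "tree_size (enc_nat (snd e)) \<le> ?N z"
          using tree_size_elem[OF that, of "enc_pair enq enc_nat"] N(2) by (simp add: enc_pair_Cell)
        then have "length (bits (snd e)) \<le> ?N z" using length_bits_le le_trans by blast
        then show ?thesis by (simp add: length_bits_le_iff)
      qed
      have *: "Suc (tree_size (enc_pair enq enc_nat e)) \<le> ?N z + 4 * (?N z * Suc (?N z)) + 4"
        if e: "e \<in> set (walk_count A T (take i c))" for e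
      proof -
        have "snd e < 2 ^ (?N z * Suc (length (take i c)))"
          by (rule walk_count_bound[OF N(1) T e])
        also have "(2 :: nat) ^ (?N z * Suc (length (take i c))) \<le> 2 ^ (?N z * Suc (?N z))"
          using i N(3) by (intro power_increasing mult_left_mono) (simp_all add: z)
        finally have "tree_size (enc_nat (snd e)) \<le> 4 * (?N z * Suc (?N z)) + 1"
          by (rule tree_size_enc_nat_pow2)
        moreover have "tree_size (enq (fst e)) \<le> ?N z"
          using walk_step_bound(2)[OF walk_count_bound[OF N(1) T] _ e[unfolded i_eq] N(1)] by simp
        ultimately show ?thesis by (simp add: enc_pair_Cell)
      qed
      have "sum_list (map (\<lambda>e. Suc (tree_size (enc_pair enq enc_nat e))) (walk_count A T (take i c)))
         \<le> sum_list (map (\<lambda>e. ?N z + 4 * (?N z * Suc (?N z)) + 4) (walk_count A T (take i c)))"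
        by (intro sum_list_mono *)
      also have "\<dots> = length A * (?N z + 4 * (?N z * Suc (?N z)) + 4)"
        unfolding sum_list_triv i_eq by (simp add: walk_step_def)
      also have "\<dots> \<le> ?N z * (?N z + 4 * (?N z * Suc (?N z)) + 4)"
        using len by (rule mult_right_mono) simp
      finally show ?thesis by (simp add: tree_size_enc_list[of _ "walk_count A T (take i c)"])
    qed
    then show "tree_size (?eT (foldl (\<lambda>T _. walk_step (fst z) T) (fst (snd z)) (take i (snd (snd z))))) \<le> ?B z"
      by (simp add: z walk_count_def)
  qed (rule pt_intros pb_intros pt_lift2[OF pt_walk_step0[OF assms]] | simp)+
qed

section \<open>The algorithm\<close>

abbreviation enc_edge :: "nat \<times> nat \<Rightarrow> tree" where
  "enc_edge \<equiv> enc_pair enc_nat enc_nat"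

definition adj :: "(nat \<times> nat) list \<Rightarrow> nat \<Rightarrow> nat \<Rightarrow> bool" where
  "adj es u v \<longleftrightarrow> (u, v) \<in> set es \<or> (v, u) \<in> set es"

text \<open>For an element of the list this is the parity of its first position, the sign of its
  column in a Laplace expansion; the first component of the accumulator records that
  \<open>a\<close> has been met.\<close>

definition index_parity :: "'a \<Rightarrow> 'a list \<Rightarrow> bool" where
  "index_parity a xs = snd (foldl (\<lambda>s b. if fst s \<or> b = a then (True, snd s) else (False, \<not> snd s))
     (False, False) xs)"

definition exponents :: "'a list \<Rightarrow> nat list" where
  "exponents c = foldl (\<lambda>l _. length l # l) [] c"

text \<open>
  A state \<open>(v, S, T, H, s)\<close> consists of the current vertex, the exponents that are still
  unused in the two copies of the determinant, the negative samples that contain all edges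
  traversed so far, and the sign collected so far.
\<close>

type_synonym state = "nat \<times> nat list \<times> nat list \<times> (nat \<times> nat) list list \<times> bool"

text \<open>A move to \<open>u\<close> selects one term from the Laplace expansion of each
  determinant, with exponents \<open>a\<close> and \<open>b\<close>. The weights are natural
  numbers, so the product of the two signs goes into the Boolean, where \<open>True\<close> stands
  for a change of sign.\<close>

definition moves :: "nat list \<Rightarrow> (nat \<times> nat) list \<Rightarrow> state \<Rightarrow> (nat \<times> state) list" where
  "moves vs es q = concat (map (\<lambda>u. concat (map (\<lambda>a. map (\<lambda>b.
       (u ^ a * u ^ b,
        (u, filter (\<lambda>c. c \<noteq> a) (fst (snd q)), filter (\<lambda>c. c \<noteq> b) (fst (snd (snd q))),
         filter (\<lambda>N. adj N (fst q) u) (fst (snd (snd (snd q)))),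
         snd (snd (snd (snd q))) \<noteq>
           (index_parity a (fst (snd q)) \<noteq> index_parity b (fst (snd (snd q)))))))
       (fst (snd (snd q)))) (fst (snd q))))
     (filter (\<lambda>u. adj es (fst q) u) vs))"

definition states :: "nat list \<Rightarrow> nat list list \<Rightarrow> (nat \<times> nat) list list list \<Rightarrow> state list" where
  "states vs Ss Hs = concat (map (\<lambda>v. concat (map (\<lambda>S. concat (map (\<lambda>T. concat (map (\<lambda>H.
     [(v, S, T, H, False), (v, S, T, H, True)]) Hs)) Ss)) Ss)) vs)"

text \<open>The initial vector marks the accepting states, so the entry at a state sums over the
  walks that start there. Acceptance asks for sign \<open>False\<close>; hence an entry with sign
  \<open>False\<close> collects the positive terms and its twin with sign \<open>True\<close> the
  negative ones.\<close>

definition signed_table ::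
    "state list \<Rightarrow> nat list \<Rightarrow> (nat \<times> nat) list \<Rightarrow> 'c list \<Rightarrow> (state \<times> nat) list" where
  "signed_table K vs es c = walk_count (map (\<lambda>q. (q, moves vs es q)) K)
     (map (\<lambda>q. (q, if fst (snd (snd (snd q))) = [] \<and> \<not> snd (snd (snd (snd q))) then 1 else 0)) K) c"

text \<open>Deleting \<open>v\<close> from the vertex list keeps the walk from returning to its
  start, so the determinant only has to separate the later vertices. Comparing the two totals
  replaces a subtraction.\<close>

definition path_from :: "state list \<Rightarrow> nat list \<Rightarrow> (nat \<times> nat) list \<Rightarrow> (nat \<times> nat) list list \<Rightarrow>
    nat list \<Rightarrow> nat \<Rightarrow> bool" where
  "path_from K vs es Ns c v =
     (let T = signed_table K (filter (\<lambda>u. u \<noteq> v) vs) es c; S = exponents c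
      in lookup T (v, S, S, Ns, False) \<noteq> lookup T (v, S, S, Ns, True))"

definition has_path :: "nat list \<Rightarrow> (nat \<times> nat) list \<Rightarrow> (nat \<times> nat) list list \<Rightarrow> nat list \<Rightarrow> bool" where
  "has_path vs es Ns c =
     (let K = states vs (subseqs (exponents c)) (subseqs Ns)
      in \<exists>v\<in>set vs. path_from K vs es Ns c v)"

definition find_path :: "nat list \<Rightarrow> (nat \<times> nat) list \<Rightarrow> (nat \<times> nat) list list \<Rightarrow> nat list \<Rightarrow>
    (nat \<times> nat) list option" where
  "find_path vs es Ns c =
     (if has_path vs es Ns c
      then Some (foldl (\<lambda>fs e. if has_path vs (filter (\<lambda>f. f \<noteq> e) fs) Ns c
                          then filter (\<lambda>f. f \<noteq> e) fs else fs) es es)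
      else None)"

definition simplify_edges :: "(nat \<times> nat) list \<Rightarrow> (nat \<times> nat) list" where
  "simplify_edges es = foldl (\<lambda>out e. if adj out (fst e) (snd e) then out else out @ [e]) [] es"

definition proper_pairs :: "nat list \<Rightarrow> (nat \<times> nat) list" where
  "proper_pairs vs = concat (map (\<lambda>u. map (\<lambda>v. (u, v)) (filter (\<lambda>v. v \<noteq> u) vs)) vs)"

text \<open>The empty set fails to be a path only if there is no vertex, and a single edge is always
  a path. Two edges fail only if disjoint, which takes four vertices. For larger \<open>k\<close>
  the triangle is put first so that truncation to \<open>k\<close> edges keeps it.\<close>

definition find_non_path :: "nat list \<Rightarrow> nat \<Rightarrow> (nat \<times> nat) list option" where
  "find_non_path vs k =
     (if k = 0 then if vs = [] then Some [] else None
      else if k = 1 then None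
      else case vs of [] \<Rightarrow> None | v # vs' \<Rightarrow> (case vs' of [] \<Rightarrow> None | w # vs'' \<Rightarrow>
        (case vs'' of [] \<Rightarrow> None | x # vs3 \<Rightarrow>
          if k = 2 then (case vs3 of [] \<Rightarrow> None | y # ys \<Rightarrow> Some [(v, w), (x, y)])
          else let es = take k (simplify_edges ([(v, w), (w, x), (x, v)] @ proper_pairs vs))
            in if length es = k then Some es else None)))"

definition positives :: "((nat \<times> nat) list \<times> bool) list \<Rightarrow> (nat \<times> nat) list list" where
  "positives ss = map fst (filter snd ss)"

definition negatives :: "((nat \<times> nat) list \<times> bool) list \<Rightarrow> (nat \<times> nat) list list" where
  "negatives ss = map fst (filter (\<lambda>s. \<not> snd s) ss)"

text \<open>\<open>take k vs\<close> turns the binary number \<open>k\<close> into a list of length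
  \<open>k\<close>, the clock of the search. If there are fewer than \<open>k\<close> vertices, no
  path with \<open>k\<close> edges exists.\<close>

definition solve_with ::
    "nat list \<Rightarrow> ((nat \<times> nat) list \<times> bool) list \<Rightarrow> nat \<Rightarrow> (nat \<times> nat) list \<Rightarrow> (nat \<times> nat) list option" where
  "solve_with vs ss k es =
     (if length (take k vs) = k then find_path vs es (negatives ss) (take k vs) else None)"

definition solve :: "nat list \<Rightarrow> ((nat \<times> nat) list \<times> bool) list \<Rightarrow> nat \<Rightarrow> (nat \<times> nat) list option" where
  "solve vs ss k =
     (case positives ss of
       [] \<Rightarrow> (case solve_with vs ss k (simplify_edges (proper_pairs vs)) of
                 None \<Rightarrow> find_non_path vs k | Some es \<Rightarrow> Some es)
     | P # Ps \<Rightarrow> solve_with vs ss k (filter (\<lambda>e. \<forall>Q\<in>set Ps. adj Q (fst e) (snd e)) P))"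

subsection \<open>Running time\<close>

abbreviation enc_state :: "state \<Rightarrow> tree" where
  "enc_state \<equiv> enc_pair enc_nat (enc_pair (enc_list enc_unary) (enc_pair (enc_list enc_unary)
     (enc_pair (enc_list (enc_list enc_edge)) enc_bool)))"

lemma inj_enc_state [pt_intros]: "inj enc_state"
  by (rule pt_intros)+

lemma pt_adj0: "pt (\<lambda>_. 0) (enc_pair (enc_list enc_edge) (enc_pair enc_nat enc_nat)) enc_bool
    (\<lambda>z. adj (fst z) (fst (snd z)) (snd (snd z)))"
  unfolding adj_def by (rule pt_intros)+

lemmas pt_adj [pt_intros] = pt_lift3[OF pt_adj0]

lemma pt_index_parity0:
  assumes "inj ea"
  shows "pt (\<lambda>_. 0) (enc_pair ea (enc_list ea)) enc_bool (\<lambda>z. index_parity (fst z) (snd z))"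
proof -
  have small: "tree_size (enc_pair enc_bool enc_bool s) \<le> 7" for s
    by (cases "fst s"; cases "snd s") (simp_all add: enc_pair_Cell)
  show ?thesis
    unfolding index_parity_def
    by (rule pt_snd, rule pt_foldl_small[OF _ _ _ small]) (rule pt_intros assms)+
qed

lemmas pt_index_parity = pt_lift2[OF pt_index_parity0[OF inj_enc_unary]]

lemma exponents_eq: "exponents c = rev [0..<length c]"
  by (induction c rule: rev_induct) (simp_all add: exponents_def)

lemma pt_exponents0: "pt (\<lambda>_. 0) (enc_list ea) (enc_list enc_unary) exponents"
  unfolding exponents_def
proof (rule pt_foldl[where B = "\<lambda>c. tree_size (enc_list ea c) * (2 * tree_size (enc_list ea c) + 2) + 1" and m' = "\<lambda>_. 0"])
  fix c :: "'a list" and i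
  let ?N = "tree_size (enc_list ea c)"
  have "foldl (\<lambda>l _. length l # l) [] (take i c) = rev [0..<length (take i c)]"
    using exponents_eq[of "take i c"] by (simp add: exponents_def)
  moreover have "sum_list (map (\<lambda>x. Suc (tree_size (enc_unary x))) (rev [0..<length (take i c)]))
    \<le> sum_list (map (\<lambda>_. 2 * ?N + 2) (rev [0..<length (take i c)]))"
    using length_le_tree_size[of c ea]
    by (intro sum_list_mono) (auto simp: tree_size_enc_unary)
  moreover have "\<dots> \<le> ?N * (2 * ?N + 2)"
    unfolding sum_list_triv using length_le_tree_size[of c ea]
    by (intro mult_right_mono) simp_all
  ultimately show "tree_size (enc_list enc_unary (foldl (\<lambda>l _. length l # l) [] (take i c))) \<le> ?N * (2 * ?N + 2) + 1"
    unfolding tree_size_enc_list by simp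
qed (rule pt_intros pb_intros pt_length_unary | simp)+

lemmas pt_exponents [pt_intros] = pt_lift1[OF pt_exponents0]

lemma pt_moves0: "pt (\<lambda>_. 0) (enc_pair (enc_list enc_nat) (enc_pair (enc_list enc_edge) enc_state))
    (enc_list (enc_pair enc_nat enc_state)) (\<lambda>z. moves (fst z) (fst (snd z)) (snd (snd z)))"
  unfolding moves_def by (rule pt_index_parity pt_intros)+

lemma pt_states0: "pt (\<lambda>_. 0) (enc_pair (enc_list enc_nat) (enc_pair (enc_list (enc_list enc_unary))
    (enc_list (enc_list (enc_list enc_edge))))) (enc_list enc_state) (\<lambda>z. states (fst z) (fst (snd z)) (snd (snd z)))"
  unfolding states_def by (rule pt_intros)+

lemma pt_signed_table0: "pt (\<lambda>_. 0) (enc_pair (enc_list enc_state) (enc_pair (enc_list enc_nat)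
    (enc_pair (enc_list enc_edge) (enc_list ec)))) (enc_list (enc_pair enc_state enc_nat))
    (\<lambda>z. signed_table (fst z) (fst (snd z)) (fst (snd (snd z))) (snd (snd (snd z))))"
  unfolding signed_table_def
  by (rule pt_lift3[OF pt_walk_count0] pt_lift3[OF pt_moves0] pt_intros)+

lemma pt_lift4:
  assumes "pt (\<lambda>_. 0) (enc_pair ea (enc_pair eb (enc_pair ec ed))) ey
      (\<lambda>z. g (fst z) (fst (snd z)) (fst (snd (snd z))) (snd (snd (snd z))))"
    "pt m ex ea f1" "pt m ex eb f2" "pt m ex ec f3" "pt m ex ed f4"
  shows "pt m ex ey (\<lambda>x. g (f1 x) (f2 x) (f3 x) (f4 x))"
  using pt_lift1[OF assms(1) pt_Pair[OF assms(2) pt_Pair[OF assms(3) pt_Pair[OF assms(4,5)]]]] by simp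

abbreviation enc_query ::
    "nat list \<times> (nat \<times> nat) list \<times> (nat \<times> nat) list list \<times> nat list \<Rightarrow> tree" where
  "enc_query \<equiv> enc_pair (enc_list enc_nat) (enc_pair (enc_list enc_edge)
     (enc_pair (enc_list (enc_list enc_edge)) (enc_list enc_nat)))"

lemma pt_path_from0: "pt (\<lambda>_. 0) (enc_pair (enc_list enc_state) (enc_pair enc_query enc_nat)) enc_bool
    (\<lambda>z. path_from (fst z) (fst (fst (snd z))) (fst (snd (fst (snd z)))) (fst (snd (snd (fst (snd z)))))
       (snd (snd (snd (fst (snd z))))) (snd (snd z)))"
  unfolding path_from_def
  by (rule pt_lift4[OF pt_signed_table0] pt_lift2[OF pt_lookup0] pt_intros)+

text \<open>Large enough for the subsets of the exponents and for the subsets of the negative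
  samples; the number of states is polynomial in it and the input.\<close>

definition query_budget :: "nat list \<times> (nat \<times> nat) list \<times> (nat \<times> nat) list list \<times> nat list \<Rightarrow> nat" where
  "query_budget z = 2 ^ (length (snd (snd (snd z))) + length (fst (snd (snd z))))"

lemma pt_has_path0: "pt query_budget enc_query enc_bool
    (\<lambda>z. has_path (fst z) (fst (snd z)) (fst (snd (snd z))) (snd (snd (snd z))))"
proof -
  have 1: "poly_bounded query_budget enc_query (\<lambda>z. 2 ^ length (exponents (snd (snd (snd z)))))"
    "poly_bounded query_budget enc_query (\<lambda>z. 2 ^ length (fst (snd (snd z))))"
    by (rule poly_bounded_mono[OF poly_bounded_budget];
        simp add: query_budget_def exponents_eq power_increasing)+
  have 2: "pt m ex (enc_list enc_state) K \<Longrightarrow> pt m ex enc_query q \<Longrightarrow> pt m ex enc_nat v \<Longrightarrow>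
      pt m ex enc_bool (\<lambda>x. path_from (K x) (fst (q x)) (fst (snd (q x))) (fst (snd (snd (q x))))
        (snd (snd (snd (q x)))) (v x))" for m and ex :: "'x \<Rightarrow> tree" and K q v
    using pt_lift1[OF pt_path_from0, of m ex "\<lambda>x. (K x, q x, v x)"] by (simp add: pt_Pair)
  show ?thesis
    unfolding has_path_def
    by (rule 2 pt_lift3[OF pt_states0] pt_subseqs 1 pt_intros)+
qed

lemma foldl_size_le:
  fixes sz :: "'s \<Rightarrow> nat"
  assumes "\<And>s a. sz (h s a) \<le> sz s"
  shows "sz (foldl h s xs) \<le> sz s"
  by (induction xs arbitrary: s) (auto intro: le_trans[OF _ assms])

lemma tree_size_filter_le: "tree_size (enc_list ea (filter p xs)) \<le> tree_size (enc_list ea xs)"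
  by (induction xs) auto

lemma pt_find_path0: "pt query_budget enc_query (enc_option (enc_list enc_edge))
    (\<lambda>z. find_path (fst z) (fst (snd z)) (fst (snd (snd z))) (snd (snd (snd z))))"
proof -
  let ?h = "\<lambda>z fs e. if has_path (fst z) (filter (\<lambda>f. f \<noteq> e) fs) (fst (snd (snd z))) (snd (snd (snd z)))
     then filter (\<lambda>f. f \<noteq> e) fs else fs"
  have "pt query_budget enc_query (enc_list enc_edge) (\<lambda>z. foldl (?h z) (fst (snd z)) (fst (snd z)))"
  proof (rule pt_foldl[where B = "\<lambda>z. query_budget z + tree_size (enc_list enc_edge (fst (snd z)))" and m' = "\<lambda>z. query_budget (fst z)"])
    let ?e = "enc_pair enc_query (enc_pair (enc_list enc_edge) enc_edge)"
    \<comment> \<open>Deleting an edge changes only the edge list, on which the budget does not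
      depend, so every call of \<open>has_path\<close> in the loop runs under the original
      budget.\<close>
    let ?q = "\<lambda>z. (fst (fst z), filter (\<lambda>f. f \<noteq> snd (snd z)) (fst (snd z)), fst (snd (snd (fst z))), snd (snd (snd (fst z))))"
    have "pt (\<lambda>z. query_budget (fst z)) ?e enc_query ?q"
      by (rule pt_intros)+
    from pt_comp[OF this pt_has_path0]
    have 1: "pt (\<lambda>z. query_budget (fst z)) ?e enc_bool
       (\<lambda>z. has_path (fst (fst z)) (filter (\<lambda>f. f \<noteq> snd (snd z)) (fst (snd z))) (fst (snd (snd (fst z)))) (snd (snd (snd (fst z)))))"
      using poly_bounded_budget[of "\<lambda>z. query_budget (fst z)" ?e] by (simp add: query_budget_def)
    show "pt (\<lambda>z. query_budget (fst z)) ?e (enc_list enc_edge) (\<lambda>z. ?h (fst z) (fst (snd z)) (snd (snd z)))"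
      by (rule 1 pt_intros)+
    show "tree_size (enc_list enc_edge (foldl (?h z) (fst (snd z)) (take i (fst (snd z)))))
        \<le> query_budget z + tree_size (enc_list enc_edge (fst (snd z)))" for z i
      by (rule trans_le_add2, rule foldl_size_le) (simp add: tree_size_filter_le)
    show "poly_bounded query_budget enc_query (\<lambda>z. query_budget z + tree_size (enc_list enc_edge (fst (snd z))))"
      by (intro pb_intros pt_size) (rule pt_intros)+
  qed (rule pt_intros | simp)+
  then show ?thesis
    unfolding find_path_def by (intro pt_If pt_has_path0 pt_Some pt_const)
qed

lemma pt_simplify_edges0: "pt (\<lambda>_. 0) (enc_list enc_edge) (enc_list enc_edge) simplify_edges"
  unfolding simplify_edges_def
proof (rule pt_foldl[where B = "\<lambda>x. tree_size (enc_list enc_edge x)" and m' = "\<lambda>_. 0"])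
  fix x :: "(nat \<times> nat) list" and i
  have "tree_size (enc_list enc_edge (simplify_edges ys)) \<le> tree_size (enc_list enc_edge ys)" for ys
    unfolding simplify_edges_def
    by (induction ys rule: rev_induct) (auto simp: tree_size_enc_list)
  from this[of "take i x"] tree_size_take[of enc_edge i x]
  show "tree_size (enc_list enc_edge (foldl (\<lambda>out e. if adj out (fst e) (snd e) then out else out @ [e]) [] (take i x)))
      \<le> tree_size (enc_list enc_edge x)"
    unfolding simplify_edges_def by linarith
qed (rule pt_intros pb_intros | simp)+

lemmas pt_simplify_edges [pt_intros] = pt_lift1[OF pt_simplify_edges0]

lemma pt_proper_pairs0: "pt (\<lambda>_. 0) (enc_list enc_nat) (enc_list enc_edge) proper_pairs"
  unfolding proper_pairs_def by (rule pt_intros)+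

lemmas pt_proper_pairs [pt_intros] = pt_lift1[OF pt_proper_pairs0]

lemma pt_find_non_path0: "pt (\<lambda>_. 0) (enc_pair (enc_list enc_nat) enc_nat) (enc_option (enc_list enc_edge))
    (\<lambda>z. find_non_path (fst z) (snd z))"
  unfolding find_non_path_def by (rule pt_intros pt_length)+

abbreviation enc_triple :: "nat list \<times> ((nat \<times> nat) list \<times> bool) list \<times> nat \<Rightarrow> tree" where
  "enc_triple \<equiv> enc_pair (enc_list enc_nat) (enc_pair (enc_list (enc_pair (enc_list enc_edge) enc_bool)) enc_nat)"

definition triple_budget :: "nat list \<times> ((nat \<times> nat) list \<times> bool) list \<times> nat \<Rightarrow> nat" where
  "triple_budget z = 2 ^ (snd (snd z) + length (negatives (fst (snd z))))"

lemma pt_solve0: "pt triple_budget enc_triple (enc_option (enc_list enc_edge))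
    (\<lambda>z. solve (fst z) (fst (snd z)) (snd (snd z)))"
proof -
  have neg: "pt m ex (enc_list (enc_pair (enc_list enc_edge) enc_bool)) f \<Longrightarrow>
      pt m ex (enc_list (enc_list enc_edge)) (\<lambda>x. negatives (f x))" for m and ex :: "'x \<Rightarrow> tree" and f
    unfolding negatives_def by (rule pt_intros | assumption)+
  have pos: "pt triple_budget enc_triple (enc_list (enc_list enc_edge)) (\<lambda>z. positives (fst (snd z)))"
    unfolding positives_def by (rule pt_intros)+
  have sw: "pt m ex (enc_option (enc_list enc_edge))
      (\<lambda>z. solve_with (fst (f z)) (fst (snd (f z))) (snd (snd (f z))) (g z))"
    if f: "pt m ex enc_triple f" and g: "pt m ex (enc_list enc_edge) g"
      and b: "poly_bounded m ex (\<lambda>x. triple_budget (f x))"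
    for m and ex :: "'x \<Rightarrow> tree" and f g
  proof -
    let ?q = "\<lambda>z. (fst (f z), g z, negatives (fst (snd (f z))), take (snd (snd (f z))) (fst (f z)))"
    have q: "pt m ex enc_query ?q"
      by (rule pt_intros neg f g)+
    have "poly_bounded m ex (\<lambda>z. query_budget (?q z))"
      by (rule poly_bounded_mono[OF b]) (simp add: query_budget_def triple_budget_def power_increasing)
    from pt_comp[OF q pt_find_path0 this] have
      1: "pt m ex (enc_option (enc_list enc_edge)) (\<lambda>z. find_path (fst (f z)) (g z) (negatives (fst (snd (f z))))
         (take (snd (snd (f z))) (fst (f z))))"
      by simp
    show ?thesis
      unfolding solve_with_def by (rule 1 pt_length pt_intros f)+
  qed
  show ?thesis
    unfolding solve_def
    by (rule pos sw pt_lift2[OF pt_find_non_path0] poly_bounded_budget pt_intros)+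
qed

section \<open>Alternants\<close>

text \<open>Laplace expansion along the first row of the generalized Vandermonde matrix with entries
  w^s. Expanding by rows matches the walk, which meets its vertices one at a time and then picks an
  exponent.\<close>

fun alternant :: "nat list \<Rightarrow> nat list \<Rightarrow> int" where
  "alternant S [] = 1"
| "alternant S (w # ws) =
     (\<Sum>i<length S. (- 1) ^ i * int w ^ (S ! i) * alternant (take i S @ drop (Suc i) S) ws)"

definition alternant_mat :: "nat list \<Rightarrow> nat list \<Rightarrow> int mat" where
  "alternant_mat S ws = mat (length ws) (length ws) (\<lambda>(i, j). int (ws ! i) ^ (S ! j))"

lemma alternant_eq_det: "length S = length ws \<Longrightarrow> alternant S ws = det (alternant_mat S ws)"
proof (induction ws arbitrary: S)
  case Nil
  then show ?case by (simp add: alternant_mat_def)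
next
  case (Cons w ws)
  let ?A = "alternant_mat S (w # ws)"
  have "det ?A = (\<Sum>j<length (w # ws). ?A $$ (0, j) * cofactor ?A 0 j)"
    by (rule laplace_expansion_row) (simp_all add: alternant_mat_def)
  also have "\<dots> = alternant S (w # ws)"
    unfolding alternant.simps Cons.prems
  proof (rule sum.cong[OF refl])
    fix j
    assume "j \<in> {..<length (w # ws)}"
    then have j: "j < Suc (length ws)" by simp
    have "mat_delete ?A 0 j = alternant_mat (take j S @ drop (Suc j) S) ws"
      using j Cons.prems
      by (intro eq_matI) (auto simp: mat_delete_def alternant_mat_def nth_append min_def)
    then have "cofactor ?A 0 j = (- 1) ^ j * alternant (take j S @ drop (Suc j) S) ws"
      using j Cons.prems by (simp add: cofactor_def Cons.IH)
    moreover have "?A $$ (0, j) = int w ^ (S ! j)"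
      using j by (simp add: alternant_mat_def)
    ultimately show "?A $$ (0, j) * cofactor ?A 0 j =
        (- 1) ^ j * int w ^ (S ! j) * alternant (take j S @ drop (Suc j) S) ws"
      by simp
  qed
  finally show ?case by simp
qed

text \<open>A repeated vertex gives equal rows. Conversely, no product formula is used: a vector in
  the kernel is the coefficient list of a nonzero polynomial of degree below n that vanishes at
  every entry of \<open>ws\<close>, which n distinct entries forbid.\<close>

lemma alternant_eq_0_iff: "alternant (rev [0..<length ws]) ws = 0 \<longleftrightarrow> \<not> distinct ws"
proof -
  let ?n = "length ws" and ?S = "rev [0..<length ws]"
  let ?A = "alternant_mat ?S ws"
  have A: "?A \<in> carrier_mat ?n ?n" by (simp add: alternant_mat_def)
  have det: "alternant ?S ws = det ?A" by (rule alternant_eq_det) simp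
  show ?thesis
  proof
    assume "\<not> distinct ws"
    then obtain i j where ij: "i < ?n" "j < ?n" "i \<noteq> j" "ws ! i = ws ! j"
      by (auto simp: distinct_conv_nth)
    have "row ?A i = row ?A j"
      using ij by (intro eq_vecI) (simp_all add: alternant_mat_def)
    then show "alternant ?S ws = 0"
      unfolding det using ij by (intro det_identical_rows[OF A, of i j])
  next
    assume "alternant ?S ws = 0"
    then obtain c where c: "c \<in> carrier_vec ?n" "c \<noteq> 0\<^sub>v ?n" "?A *\<^sub>v c = 0\<^sub>v ?n"
      unfolding det det_0_iff_vec_prod_zero[OF A] by blast
    \<comment> \<open>The exponents are listed in decreasing order, so column \<open>j\<close>
      belongs to degree n - 1 - j.\<close>
    define p where "p = (\<Sum>j<?n. monom (c $ j) (?n - Suc j))"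
    have root: "poly p (int w) = 0" if "w \<in> set ws" for w
    proof -
      obtain i where i: "i < ?n" "w = ws ! i" using \<open>w \<in> set ws\<close> by (auto simp: in_set_conv_nth)
      have "0 = (?A *\<^sub>v c) $ i" using c(3) i by simp
      also have "\<dots> = (\<Sum>j<?n. int w ^ (?n - Suc j) * c $ j)"
        using i c(1) by (auto simp: alternant_mat_def scalar_prod_def rev_nth lessThan_atLeast0 intro!: sum.cong)
      also have "\<dots> = poly p (int w)"
        by (simp add: p_def poly_sum poly_monom mult.commute)
      finally show ?thesis by simp
    qed
    \<comment> \<open>Besides \<open>p \<noteq> 0\<close> this index yields n > 0, without which the
      final comparison of n with n - 1 would be no contradiction.\<close>
    obtain j where j: "j < ?n" "c $ j \<noteq> 0"
      using c(1,2) by (metis carrier_vecD eq_vecI index_zero_vec(1) index_zero_vec(2))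
    have "coeff p (?n - Suc j) = (\<Sum>i<?n. if i = j then c $ i else 0)"
      unfolding p_def coeff_sum using j by (intro sum.cong) auto
    also have "\<dots> = c $ j" using j by simp
    finally have p: "p \<noteq> 0" using j by auto
    show "\<not> distinct ws"
    proof
      assume "distinct ws"
      then have "?n = card (int ` set ws)"
        by (simp add: card_image distinct_card)
      also have "\<dots> \<le> card {x. poly p x = 0}"
        by (intro card_mono poly_roots_finite p) (use root in auto)
      also have "\<dots> \<le> degree p"
        by (rule card_poly_roots_bound[OF p])
      also have "degree p \<le> ?n - 1"
        unfolding p_def by (intro degree_sum_le) (auto intro: order.trans[OF degree_monom_le])
      finally show False using j by simp
    qed
  qed
qed

section \<open>Correctness of the algorithm\<close>

fun signed_count :: "nat list \<Rightarrow> (nat \<times> nat) list \<Rightarrow> nat \<Rightarrow> state \<Rightarrow> nat" where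
  "signed_count vs es 0 q = (if fst (snd (snd (snd q))) = [] \<and> \<not> snd (snd (snd (snd q))) then 1 else 0)"
| "signed_count vs es (Suc n) q = (\<Sum>s\<leftarrow>moves vs es q. fst s * signed_count vs es n (snd s))"

lemma lookup_map: "q \<in> set K \<Longrightarrow> lookup (map (\<lambda>q. (q, F q)) K) q = F q"
  by (induction K) (auto simp: lookup_def)

text \<open>\<open>lookup\<close> returns 0 for a missing state, so the table agrees with the
  recursion only if no move leaves \<open>K\<close>.\<close>

lemma signed_table_eq:
  assumes closed: "\<And>q s. q \<in> set K \<Longrightarrow> s \<in> set (moves vs es q) \<Longrightarrow> snd s \<in> set K"
  shows "signed_table K vs es c = map (\<lambda>q. (q, signed_count vs es (length c) q)) K"
proof (induction c rule: rev_induct)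
  case Nil
  then show ?case by (simp add: signed_table_def walk_count_def)
next
  case (snoc x c)
  let ?A = "map (\<lambda>q. (q, moves vs es q)) K"
  have "signed_table K vs es (c @ [x]) = walk_step ?A (signed_table K vs es c)"
    by (simp add: signed_table_def walk_count_def)
  also have "\<dots> = map (\<lambda>q. (q, signed_count vs es (length (c @ [x])) q)) K"
  proof -
    have "(\<Sum>s\<leftarrow>moves vs es q. fst s * lookup (map (\<lambda>q. (q, signed_count vs es (length c) q)) K) (snd s)) =
        signed_count vs es (length (c @ [x])) q" if "q \<in> set K" for q
      using lookup_map[OF closed[OF that]]
      by (auto intro!: arg_cong[where f = sum_list] map_cong)
    then show ?thesis
      unfolding snoc.IH walk_step_def by simp
  qed
  finally show ?case .
qed

lemma filter_in_subseqs: "xs \<in> set (subseqs ys) \<Longrightarrow> filter p xs \<in> set (subseqs ys)"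
  by (induction ys arbitrary: xs) (auto simp: Let_def)

lemma in_set_states:
  "(v, S, T, H, s) \<in> set (states vs Ss Hs) \<longleftrightarrow> v \<in> set vs \<and> S \<in> set Ss \<and> T \<in> set Ss \<and> H \<in> set Hs"
  by (cases s) (auto simp: states_def)

text \<open>Exponents and samples are discarded by filters, which stay within
  \<open>subseqs\<close>; lists in the original order therefore serve as names of subsets.\<close>

lemma states_closed:
  assumes "set us \<subseteq> set vs" "q \<in> set (states vs (subseqs S) (subseqs Ns))" "s \<in> set (moves us es q)"
  shows "snd s \<in> set (states vs (subseqs S) (subseqs Ns))"
  using assms by (cases q) (auto simp: moves_def in_set_states filter_in_subseqs)

lemma index_parity_Cons:
  "index_parity a (b # xs) = (if b = a then False else \<not> index_parity a xs)"
proof -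
  let ?h = "\<lambda>s b. if fst s \<or> b = a then (True, snd s) else (False, \<not> snd s)"
  have 1: "foldl ?h (True, s) ys = (True, s)" for s ys
    by (induction ys) simp_all
  have 2: "snd (foldl ?h (False, \<not> s) ys) = (\<not> snd (foldl ?h (False, s) ys))" for s ys
    by (induction ys arbitrary: s) (auto simp: 1)
  show ?thesis
    unfolding index_parity_def using 1[of False xs] 2[of False xs] by auto
qed

lemma index_parity_nth: "distinct xs \<Longrightarrow> i < length xs \<Longrightarrow> index_parity (xs ! i) xs = odd i"
proof (induction xs arbitrary: i)
  case (Cons a xs)
  then show ?case by (cases i) (auto simp: index_parity_Cons)
qed simp

text \<open>Links \<open>moves\<close>, which removes an exponent by value, to
  \<open>alternant\<close>, which removes a column by position.\<close>

lemma filter_neq_nth: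
  "distinct xs \<Longrightarrow> i < length xs \<Longrightarrow> filter (\<lambda>c. c \<noteq> xs ! i) xs = take i xs @ drop (Suc i) xs"
proof (induction xs arbitrary: i)
  case (Cons a xs)
  show ?case
  proof (cases i)
    case 0
    have "filter (\<lambda>c. c \<noteq> a) xs = xs"
      using Cons.prems by (intro filter_True) auto
    then show ?thesis using 0 by simp
  next
    case (Suc j)
    then show ?thesis using Cons by (auto simp: nth_eq_iff_index_eq)
  qed
qed simp

lemma sum_list_concat_map:
  "sum_list (map f (concat (map g xs))) = (\<Sum>x\<leftarrow>xs. sum_list (map f (g x)))"
  by (induction xs) simp_all

section \<open>Signed counts as sums of products of alternants\<close>

definition signed_difference ::
    "nat list \<Rightarrow> (nat \<times> nat) list \<Rightarrow> nat \<Rightarrow> nat \<Rightarrow> nat list \<Rightarrow> nat list \<Rightarrow> (nat \<times> nat) list list \<Rightarrow> int" where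
  "signed_difference vs es n v S T H =
     int (signed_count vs es n (v, S, T, H, False)) - int (signed_count vs es n (v, S, T, H, True))"

lemma int_sum_list: "int (sum_list xs) = sum_list (map int xs)"
  by (induction xs) simp_all

lemma sum_list_diff_int: "(\<Sum>x\<leftarrow>xs. f x) - (\<Sum>x\<leftarrow>xs. g x) = (\<Sum>x\<leftarrow>xs. f x - (g x :: int))"
  by (induction xs) simp_all

text \<open>If exactly one of the two positions is odd, the move flips the sign bit, which exchanges
  the two counts and negates their difference. This produces the factors (-1)^i and (-1)^j.\<close>

lemma signed_difference_Suc:
  assumes "distinct S" "distinct T"
  shows "signed_difference vs es (Suc n) v S T H =
    (\<Sum>u\<leftarrow>filter (adj es v) vs. \<Sum>i<length S. \<Sum>j<length T.
       ((- 1) ^ i * int u ^ (S ! i)) * ((- 1) ^ j * int u ^ (T ! j)) *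
       signed_difference vs es n u (take i S @ drop (Suc i) S) (take j T @ drop (Suc j) T)
         (filter (\<lambda>N. adj N v u) H))"
proof -
  let ?c = "\<lambda>u a b s. signed_count vs es n (u, filter (\<lambda>c. c \<noteq> a) S, filter (\<lambda>c. c \<noteq> b) T,
     filter (\<lambda>N. adj N v u) H, s \<noteq> (index_parity a S \<noteq> index_parity b T))"
  have c: "int (signed_count vs es (Suc n) (v, S, T, H, s)) =
     (\<Sum>u\<leftarrow>filter (adj es v) vs. \<Sum>a\<leftarrow>S. \<Sum>b\<leftarrow>T. int u ^ a * int u ^ b * int (?c u a b s))" for s
    by (simp add: moves_def sum_list_concat_map int_sum_list comp_def)
  have "signed_difference vs es (Suc n) v S T H =
     (\<Sum>u\<leftarrow>filter (adj es v) vs. \<Sum>a\<leftarrow>S. \<Sum>b\<leftarrow>T. int u ^ a * int u ^ b * (int (?c u a b False) - int (?c u a b True)))"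
    unfolding signed_difference_def c sum_list_diff_int right_diff_distrib ..
  also have "\<dots> = (\<Sum>u\<leftarrow>filter (adj es v) vs. \<Sum>i<length S. \<Sum>j<length T.
      int u ^ (S ! i) * int u ^ (T ! j) * (int (?c u (S ! i) (T ! j) False) - int (?c u (S ! i) (T ! j) True)))"
    by (simp add: sum_list_sum_nth lessThan_atLeast0)
  also have "\<dots> = (\<Sum>u\<leftarrow>filter (adj es v) vs. \<Sum>i<length S. \<Sum>j<length T.
       ((- 1) ^ i * int u ^ (S ! i)) * ((- 1) ^ j * int u ^ (T ! j)) *
       signed_difference vs es n u (take i S @ drop (Suc i) S) (take j T @ drop (Suc j) T)
         (filter (\<lambda>N. adj N v u) H))"
  proof (intro arg_cong[where f = sum_list] map_cong sum.cong refl)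
    fix u i j
    assume "i \<in> {..<length S}" "j \<in> {..<length T}"
    then have ij: "i < length S" "j < length T" by simp_all
    show "int u ^ (S ! i) * int u ^ (T ! j) * (int (?c u (S ! i) (T ! j) False) - int (?c u (S ! i) (T ! j) True)) =
       ((- 1) ^ i * int u ^ (S ! i)) * ((- 1) ^ j * int u ^ (T ! j)) *
       signed_difference vs es n u (take i S @ drop (Suc i) S) (take j T @ drop (Suc j) T)
         (filter (\<lambda>N. adj N v u) H)"
      unfolding signed_difference_def filter_neq_nth[OF assms(1) ij(1)] filter_neq_nth[OF assms(2) ij(2)]
        index_parity_nth[OF assms(1) ij(1)] index_parity_nth[OF assms(2) ij(2)]
      by (cases "odd i"; cases "odd j") (simp_all add: algebra_simps)
  qed
  finally show ?thesis .
qed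

text \<open>The start vertex is left out, matching the arguments of the determinant. The base case
  rejects walks that still lie within some negative sample.\<close>

fun walks :: "nat list \<Rightarrow> (nat \<times> nat) list \<Rightarrow> nat \<Rightarrow> nat \<Rightarrow> (nat \<times> nat) list list \<Rightarrow> nat list list" where
  "walks vs es 0 v H = (if H = [] then [[]] else [])"
| "walks vs es (Suc n) v H = concat (map (\<lambda>u. map (\<lambda>ws. u # ws)
     (walks vs es n u (filter (\<lambda>N. adj N v u) H))) (filter (adj es v) vs))"

lemma in_set_walks:
  "ws \<in> set (walks vs es n v H) \<longleftrightarrow> length ws = n \<and> set ws \<subseteq> set vs \<and>
     successively (adj es) (v # ws) \<and> (\<forall>N\<in>set H. \<not> successively (adj N) (v # ws))"
proof (induction n arbitrary: v H ws)
  case 0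
  then show ?case by (cases H) auto
next
  case (Suc n)
  then show ?case by (cases ws) (auto simp: image_iff)
qed

lemma sum_sum_list_swap:
  "(\<Sum>i\<in>A. \<Sum>x\<leftarrow>xs. f i x) = (\<Sum>x\<leftarrow>xs. \<Sum>i\<in>A. (f i x :: int))"
  by (induction xs) (simp_all add: sum.distrib)

text \<open>\<open>S\<close> and \<open>T\<close> must vary independently: both start as the same
  list, but the two expansions remove different columns. The double sum over their terms is the
  product of the two alternants.\<close>

lemma signed_difference_eq:
  assumes "distinct S" "distinct T" "length S = n" "length T = n"
  shows "signed_difference vs es n v S T H = (\<Sum>ws\<leftarrow>walks vs es n v H. alternant S ws * alternant T ws)"
  using assms
proof (induction n arbitrary: v S T H)
  case 0
  then show ?case by (simp add: signed_difference_def)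
next
  case (Suc n)
  have IH: "signed_difference vs es n u (take i S @ drop (Suc i) S) (take j T @ drop (Suc j) T) H' =
      (\<Sum>ws\<leftarrow>walks vs es n u H'. alternant (take i S @ drop (Suc i) S) ws * alternant (take j T @ drop (Suc j) T) ws)"
    if "i < length S" "j < length T" for u i j H'
  proof (rule Suc.IH)
    show "distinct (take i S @ drop (Suc i) S)" "distinct (take j T @ drop (Suc j) T)"
      using that Suc.prems by (metis filter_neq_nth distinct_filter)+
  qed (use that Suc.prems in auto)
  have "signed_difference vs es (Suc n) v S T H =
    (\<Sum>u\<leftarrow>filter (adj es v) vs. \<Sum>i<length S. \<Sum>j<length T. \<Sum>ws\<leftarrow>walks vs es n u (filter (\<lambda>N. adj N v u) H).
       ((- 1) ^ i * int u ^ (S ! i)) * ((- 1) ^ j * int u ^ (T ! j)) *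
       (alternant (take i S @ drop (Suc i) S) ws * alternant (take j T @ drop (Suc j) T) ws))"
    unfolding signed_difference_Suc[OF Suc.prems(1,2)]
    by (intro arg_cong[where f = sum_list] map_cong sum.cong refl)
      (simp add: IH sum_list_const_mult)
  also have "\<dots> = (\<Sum>u\<leftarrow>filter (adj es v) vs. \<Sum>ws\<leftarrow>walks vs es n u (filter (\<lambda>N. adj N v u) H).
      alternant S (u # ws) * alternant T (u # ws))"
    unfolding sum_sum_list_swap alternant.simps sum_product
    by (intro arg_cong[where f = sum_list] map_cong sum.cong refl) (simp add: algebra_simps)
  also have "\<dots> = (\<Sum>ws\<leftarrow>walks vs es (Suc n) v H. alternant S ws * alternant T ws)"
    by (simp add: sum_list_concat_map comp_def)
  finally show ?case .
qed

text \<open>For equal exponent lists the signed count is a sum of squares, so nothing can cancel.\<close>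

lemma signed_difference_nonzero_iff:
  "signed_difference vs es n v (rev [0..<n]) (rev [0..<n]) H \<noteq> 0 \<longleftrightarrow>
     (\<exists>ws\<in>set (walks vs es n v H). distinct ws)"
proof -
  have len: "length ws = n" if "ws \<in> set (walks vs es n v H)" for ws
    using that by (simp add: in_set_walks)
  have "signed_difference vs es n v (rev [0..<n]) (rev [0..<n]) H =
      (\<Sum>ws\<leftarrow>walks vs es n v H. alternant (rev [0..<n]) ws * alternant (rev [0..<n]) ws)"
    by (rule signed_difference_eq) simp_all
  also have "\<dots> = 0 \<longleftrightarrow> (\<forall>ws\<in>set (walks vs es n v H). alternant (rev [0..<n]) ws * alternant (rev [0..<n]) ws = 0)"
    by (subst sum_list_nonneg_eq_0_iff) auto
  also have "\<dots> \<longleftrightarrow> (\<forall>ws\<in>set (walks vs es n v H). \<not> distinct ws)"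
    using len alternant_eq_0_iff by auto
  finally show ?thesis by blast
qed

definition witness_path :: "nat list \<Rightarrow> (nat \<times> nat) list \<Rightarrow> (nat \<times> nat) list list \<Rightarrow> nat \<Rightarrow> nat list \<Rightarrow> bool" where
  "witness_path vs es Ns k p \<longleftrightarrow> length p = Suc k \<and> distinct p \<and> set p \<subseteq> set vs \<and>
     successively (adj es) p \<and> (\<forall>N\<in>set Ns. \<not> successively (adj N) p)"

lemma has_path_iff: "has_path vs es Ns c \<longleftrightarrow> (\<exists>p. witness_path vs es Ns (length c) p)"
proof -
  let ?S = "exponents c" and ?n = "length c"
  let ?K = "states vs (subseqs ?S) (subseqs Ns)"
  have "path_from ?K vs es Ns c v \<longleftrightarrow> (\<exists>ws. witness_path vs es Ns ?n (v # ws))" if v: "v \<in> set vs" for v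
  proof -
    let ?vs = "filter (\<lambda>u. u \<noteq> v) vs"
    have T: "signed_table ?K ?vs es c = map (\<lambda>q. (q, signed_count ?vs es ?n q)) ?K"
      by (rule signed_table_eq) (rule states_closed, auto)
    have K: "(v, ?S, ?S, Ns, s) \<in> set ?K" for s
      using v by (simp add: in_set_states subseqs_refl)
    have "path_from ?K vs es Ns c v \<longleftrightarrow> signed_difference ?vs es ?n v ?S ?S Ns \<noteq> 0"
      unfolding path_from_def Let_def T signed_difference_def lookup_map[OF K] by simp
    also have "\<dots> \<longleftrightarrow> (\<exists>ws\<in>set (walks ?vs es ?n v Ns). distinct ws)"
      unfolding exponents_eq by (rule signed_difference_nonzero_iff)
    also have "\<dots> \<longleftrightarrow> (\<exists>ws. witness_path vs es Ns ?n (v # ws))"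
      unfolding Bex_def in_set_walks witness_path_def using v by auto
    finally show ?thesis .
  qed
  then have "has_path vs es Ns c \<longleftrightarrow> (\<exists>v\<in>set vs. \<exists>ws. witness_path vs es Ns ?n (v # ws))"
    by (simp add: has_path_def Let_def)
  also have "\<dots> \<longleftrightarrow> (\<exists>p. witness_path vs es Ns ?n p)"
  proof
    assume "\<exists>p. witness_path vs es Ns ?n p"
    then obtain p where p: "witness_path vs es Ns ?n p" by blast
    then obtain v ws where "p = v # ws" by (cases p) (auto simp: witness_path_def)
    with p show "\<exists>v\<in>set vs. \<exists>ws. witness_path vs es Ns ?n (v # ws)"
      by (auto simp: witness_path_def)
  qed blast
  finally show ?thesis .
qed

section \<open>Paths as edge sets\<close>

lemma adj_iff_edge_set: "adj es u v \<longleftrightarrow> {u, v} \<in> edge_set es"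
  by (auto simp: adj_def edge_set_def doubleton_eq_iff)

lemma path_edges_subset_iff: "path_edges p \<subseteq> edge_set es \<longleftrightarrow> successively (adj es) p"
  by (auto simp: path_edges_def successively_conv_nth adj_iff_edge_set)

lemma in_path_edges_nth:
  assumes "distinct p" "a < length p" "b < length p" "{p ! a, p ! b} \<in> path_edges p"
  shows "a = Suc b \<or> b = Suc a"
proof -
  obtain i where i: "Suc i < length p" "{p ! a, p ! b} = {p ! i, p ! Suc i}"
    using assms(4) by (auto simp: path_edges_def)
  then show ?thesis
    using assms(1-3) by (auto simp: doubleton_eq_iff nth_eq_iff_index_eq)
qed

lemma card_path_edges:
  assumes "distinct p"
  shows "card (path_edges p) = length p - 1"
proof -
  have "path_edges p = (\<lambda>i. {p ! i, p ! Suc i}) ` {..<length p - 1}"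
    by (auto simp: path_edges_def)
  moreover have "inj_on (\<lambda>i. {p ! i, p ! Suc i}) {..<length p - 1}"
    using assms by (auto simp: inj_on_def doubleton_eq_iff nth_eq_iff_index_eq)
  ultimately show ?thesis by (simp add: card_image)
qed

lemma path_edges_subset_all_edges:
  assumes "distinct p" "set p \<subseteq> V"
  shows "path_edges p \<subseteq> all_edges V"
  using assms by (fastforce simp: path_edges_def all_edges_def nth_eq_iff_index_eq)

section \<open>Extraction of a path\<close>

lemma witness_path_mono:
  assumes "witness_path vs es Ns k p" "set es \<subseteq> set fs"
  shows "witness_path vs fs Ns k p"
proof -
  have "edge_set es \<subseteq> edge_set fs" using assms(2) by (auto simp: edge_set_def)
  then show ?thesis
    using assms(1) by (auto simp: witness_path_def simp flip: path_edges_subset_iff)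
qed

lemma find_path_None: "find_path vs es Ns c = None \<Longrightarrow> \<not> witness_path vs es Ns (length c) p"
  by (auto simp: find_path_def has_path_iff split: if_splits)

text \<open>One pass suffices by monotonicity: an edge that could not be deleted when it was tried
  cannot be deleted from any smaller list either.\<close>

lemma greedy_deletion:
  assumes mono: "\<And>fs gs. Q fs \<Longrightarrow> set fs \<subseteq> set gs \<Longrightarrow> Q gs"
    and "Q es" and "R = foldl (\<lambda>fs e. if Q (filter (\<lambda>f. f \<noteq> e) fs) then filter (\<lambda>f. f \<noteq> e) fs else fs) es xs"
  shows "Q R \<and> set R \<subseteq> set es \<and> (distinct es \<longrightarrow> distinct R) \<and>
    (\<forall>e\<in>set xs \<inter> set R. \<not> Q (filter (\<lambda>f. f \<noteq> e) R))"
  using assms(2,3)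
proof (induction xs arbitrary: es)
  case (Cons x xs)
  let ?h = "\<lambda>fs e. if Q (filter (\<lambda>f. f \<noteq> e) fs) then filter (\<lambda>f. f \<noteq> e) fs else fs"
  have "Q (?h es x)" using Cons.prems by simp
  note IH = Cons.IH[OF this]
  have "R = foldl ?h (?h es x) xs" using Cons.prems by simp
  note IH = IH[OF this]
  have "\<not> Q (filter (\<lambda>f. f \<noteq> x) R)" if "x \<in> set R"
  proof
    assume Q: "Q (filter (\<lambda>f. f \<noteq> x) R)"
    have "x \<in> set (?h es x)" using IH that by blast
    then have "\<not> Q (filter (\<lambda>f. f \<noteq> x) es)" by (auto split: if_splits)
    moreover have "set (filter (\<lambda>f. f \<noteq> x) R) \<subseteq> set (filter (\<lambda>f. f \<noteq> x) es)"
      using IH by (auto split: if_splits)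
    ultimately show False using mono[OF Q] by blast
  qed
  moreover have "set R \<subseteq> set es" "distinct es \<longrightarrow> distinct R"
    using IH by (auto split: if_splits)
  ultimately show ?case using IH by auto
qed simp

lemma find_path_Some:
  assumes "find_path vs es Ns c = Some fs" "distinct es"
  shows "\<exists>p. witness_path vs es Ns (length c) p \<and> edge_set fs = path_edges p \<and>
    distinct (map (\<lambda>(u, v). {u, v}) fs)"
proof -
  let ?Q = "\<lambda>fs. has_path vs fs Ns c"
  have 1: "?Q es" and 2: "fs = foldl (\<lambda>fs e. if ?Q (filter (\<lambda>f. f \<noteq> e) fs) then filter (\<lambda>f. f \<noteq> e) fs else fs) es es"
    using assms(1) by (auto simp: find_path_def split: if_splits)
  have mono: "?Q gs" if "?Q fs" "set fs \<subseteq> set gs" for fs gs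
    using that witness_path_mono unfolding has_path_iff by blast
  have "?Q fs \<and> set fs \<subseteq> set es \<and> (distinct es \<longrightarrow> distinct fs) \<and>
      (\<forall>e\<in>set es \<inter> set fs. \<not> ?Q (filter (\<lambda>f. f \<noteq> e) fs))"
    by (rule greedy_deletion[OF _ 1 2]) (rule mono)
  then have fs: "?Q fs" "set fs \<subseteq> set es" "distinct fs" "\<And>e. e \<in> set fs \<Longrightarrow> \<not> ?Q (filter (\<lambda>f. f \<noteq> e) fs)"
    using assms(2) by blast+
  obtain p where p: "witness_path vs fs Ns (length c) p"
    using fs(1) unfolding has_path_iff by blast
  then have sub: "path_edges p \<subseteq> edge_set fs"
    by (simp add: witness_path_def path_edges_subset_iff)
  have needed: "\<not> path_edges p \<subseteq> edge_set (filter (\<lambda>f. f \<noteq> e) fs)" if "e \<in> set fs" for e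
  proof
    assume "path_edges p \<subseteq> edge_set (filter (\<lambda>f. f \<noteq> e) fs)"
    then have "witness_path vs (filter (\<lambda>f. f \<noteq> e) fs) Ns (length c) p"
      using p by (simp add: witness_path_def path_edges_subset_iff)
    then have "?Q (filter (\<lambda>f. f \<noteq> e) fs)" unfolding has_path_iff by blast
    with fs(4)[OF that] show False by blast
  qed
  have "{u, v} \<in> path_edges p" if uv: "(u, v) \<in> set fs" for u v
  proof -
    obtain d where "d \<in> path_edges p" "d \<notin> edge_set (filter (\<lambda>f. f \<noteq> (u, v)) fs)" "d \<in> edge_set fs"
      using needed[OF uv] sub by blast
    then show ?thesis by (auto simp: edge_set_def)
  qed
  then have "edge_set fs = path_edges p"
    using sub by (auto simp: edge_set_def)
  \<comment> \<open>Two pairs for the same edge would make one of them deletable without changing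
    the edge set.\<close>
  moreover have "inj_on (\<lambda>(u, v). {u, v}) (set fs)"
  proof (rule inj_onI, rule ccontr)
    fix e e'
    assume e: "e \<in> set fs" "e' \<in> set fs" "(\<lambda>(u, v). {u, v}) e = (\<lambda>(u, v). {u, v}) e'" "e \<noteq> e'"
    have "edge_set fs \<subseteq> edge_set (filter (\<lambda>f. f \<noteq> e) fs)"
      unfolding edge_set_def
    proof (rule image_subsetI)
      fix f
      assume f: "f \<in> set fs"
      show "(\<lambda>(u, v). {u, v}) f \<in> (\<lambda>(u, v). {u, v}) ` set (filter (\<lambda>f. f \<noteq> e) fs)"
        using e f by (cases "f = e") (auto intro: rev_image_eqI)
    qed
    with needed[OF e(1)] sub show False by blast
  qed
  then have "distinct (map (\<lambda>(u, v). {u, v}) fs)"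
    using fs(3) by (simp add: distinct_map)
  ultimately show ?thesis
    using witness_path_mono[OF p fs(2)] by blast
qed

text \<open>For the edges of a path on V, forming a path in a sample reduces to containment; the
  cardinality condition becomes one on the number of vertices.\<close>

lemma solution_path_iff:
  assumes "distinct p" "p \<noteq> []" "set p \<subseteq> set (verts I)"
  shows "solution I (path_edges p) \<longleftrightarrow> length p = Suc (len I) \<and>
    (\<forall>Q\<in>set (positives (samples I)). successively (adj Q) p) \<and>
    (\<forall>N\<in>set (negatives (samples I)). \<not> successively (adj N) p)"
proof -
  have "is_path (set (verts I)) (path_edges p)"
    using assms by (auto simp: is_path_def)
  moreover have "card (path_edges p) = len I \<longleftrightarrow> length p = Suc (len I)"
    using assms(2) card_path_edges[OF assms(1)] by (cases p) auto
  ultimately show ?thesis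
    unfolding solution_def consistent_def forms_path_in_def
    using path_edges_subset_all_edges[OF assms(1,3)]
    by (auto simp: positives_def negatives_def path_edges_subset_iff split: prod.splits)
qed

text \<open>\<open>es_iff\<close> asks for agreement on paths only, so it covers the intersection of
  the positive samples as well as the complete graph when there are none.\<close>

lemma solve_with_correct:
  assumes es: "distinct es" and es_iff: "\<forall>p. distinct p \<and> set p \<subseteq> set (verts I) \<longrightarrow>
      (successively (adj es) p \<longleftrightarrow> (\<forall>Q\<in>set (positives (samples I)). successively (adj Q) p))"
  shows "solve_with (verts I) (samples I) (len I) es = None \<Longrightarrow> is_path (set (verts I)) F \<Longrightarrow> \<not> solution I F"
    and "solve_with (verts I) (samples I) (len I) es = Some fs \<Longrightarrow> correct_answer I (Some fs)"
proof -
  let ?vs = "verts I" and ?k = "len I" and ?Ns = "negatives (samples I)"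
  have wit: "witness_path ?vs es ?Ns ?k p \<longleftrightarrow>
      distinct p \<and> p \<noteq> [] \<and> set p \<subseteq> set ?vs \<and> solution I (path_edges p)" for p
    using es_iff[rule_format, of p] solution_path_iff[of p I]
    by (cases "p = []") (auto simp: witness_path_def)
  {
    assume none: "solve_with ?vs (samples I) ?k es = None" and path: "is_path (set ?vs) F"
    show "\<not> solution I F"
    proof
      assume "solution I F"
      with path obtain p where p: "witness_path ?vs es ?Ns ?k p"
        unfolding wit is_path_def by blast
      \<comment> \<open>The witness has k + 1 vertices, so \<open>take ?k ?vs\<close> has full
        length and the search was really performed.\<close>
      then have "Suc ?k \<le> length ?vs"
        using card_mono[of "set ?vs" "set p"] card_length[of ?vs]
        by (auto simp: witness_path_def distinct_card)
      with none p show False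
        using find_path_None[of ?vs es ?Ns "take ?k ?vs" p] by (simp add: solve_with_def)
    qed
  }
  {
    assume "solve_with ?vs (samples I) ?k es = Some fs"
    then have k: "length (take ?k ?vs) = ?k" and f: "find_path ?vs es ?Ns (take ?k ?vs) = Some fs"
      by (auto simp: solve_with_def split: if_splits)
    obtain p where "witness_path ?vs es ?Ns (length (take ?k ?vs)) p" "edge_set fs = path_edges p"
        "distinct (map (\<lambda>(u, v). {u, v}) fs)"
      using find_path_Some[OF f es] by blast
    then show "correct_answer I (Some fs)"
      unfolding k wit using path_edges_subset_all_edges[of p "set ?vs"]
      by (simp add: edge_list_def)
  }
qed

subsection \<open>Instances without positive samples\<close>

lemma edge_set_append: "edge_set (xs @ ys) = edge_set xs \<union> edge_set ys"
  by (auto simp: edge_set_def)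

lemma simplify_edges_snoc: "simplify_edges (es @ [e]) =
   (if adj (simplify_edges es) (fst e) (snd e) then simplify_edges es else simplify_edges es @ [e])"
  by (simp add: simplify_edges_def)

lemma edge_set_simplify: "edge_set (simplify_edges es) = edge_set es"
proof (induction es rule: rev_induct)
  case (snoc e es)
  have "edge_set [e] = {{fst e, snd e}}" by (cases e) (simp add: edge_set_def)
  then show ?case
    using snoc by (auto simp: simplify_edges_snoc edge_set_append adj_iff_edge_set)
qed (simp add: simplify_edges_def)

lemma distinct_simplify: "distinct (map (\<lambda>(u, v). {u, v}) (simplify_edges es))"
proof (induction es rule: rev_induct)
  case (snoc e es)
  then show ?case
    by (cases e) (auto simp: simplify_edges_snoc adj_iff_edge_set edge_set_def)
qed (simp add: simplify_edges_def)

text \<open>Ensures that the triangle at the front survives the removal of duplicates as an initial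
  segment.\<close>

lemma simplify_edges_prefix: "\<exists>r. simplify_edges (xs @ ys) = simplify_edges xs @ r"
proof (induction ys rule: rev_induct)
  case (snoc y ys)
  then show ?case
    unfolding append_assoc[symmetric] simplify_edges_snoc[of "xs @ ys"] by auto
qed simp

lemma edge_set_proper_pairs: "edge_set (proper_pairs vs) = all_edges (set vs)"
  by (fastforce simp: edge_set_def proper_pairs_def all_edges_def card_2_iff image_iff)

lemma finite_all_edges: "finite V \<Longrightarrow> finite (all_edges V)"
  by (rule finite_subset[of _ "Pow V"]) (auto simp: all_edges_def)

lemma card_all_edges: "finite V \<Longrightarrow> card (all_edges V) = card V choose 2"
  unfolding all_edges_def by (rule n_subsets)

text \<open>The edges of a path join consecutive positions, and three positions cannot be pairwise
  consecutive.\<close>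

lemma triangle_not_path:
  assumes "{u, v} \<in> F" "{v, w} \<in> F" "{w, u} \<in> F"
  shows "\<not> is_path V F"
proof
  assume "is_path V F"
  then obtain p where p: "distinct p" "F = path_edges p" by (auto simp: is_path_def)
  have "x \<in> set p" if "{x, y} \<in> F" for x y
    using that p(2) by (fastforce simp: path_edges_def doubleton_eq_iff)
  then obtain a b c where "u = p ! a" "v = p ! b" "w = p ! c" "a < length p" "b < length p" "c < length p"
    using assms by (metis in_set_conv_nth)
  then show False
    using in_path_edges_nth[OF p(1), of a b] in_path_edges_nth[OF p(1), of b c]
      in_path_edges_nth[OF p(1), of c a] assms p(2) by auto
qed

lemma path_edges_simps [simp]:
  "path_edges [u] = {}"
  "path_edges (u # v # p) = insert {u, v} (path_edges (v # p))"
proof -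
  show "path_edges [u] = {}" by (simp add: path_edges_def)
  have "x \<in> path_edges (u # v # p) \<longleftrightarrow> x \<in> insert {u, v} (path_edges (v # p))" for x
  proof
    assume "x \<in> path_edges (u # v # p)"
    then obtain i where "x = {(u # v # p) ! i, (u # v # p) ! Suc i}" "Suc i < length (u # v # p)"
      by (auto simp: path_edges_def)
    then show "x \<in> insert {u, v} (path_edges (v # p))"
      by (cases i) (auto simp: path_edges_def)
  next
    assume "x \<in> insert {u, v} (path_edges (v # p))"
    then show "x \<in> path_edges (u # v # p)"
    proof
      assume "x = {u, v}"
      then show ?thesis by (force simp: path_edges_def)
    next
      assume "x \<in> path_edges (v # p)"
      then obtain i where "x = {(v # p) ! i, (v # p) ! Suc i}" "Suc i < length (v # p)"
        by (auto simp: path_edges_def)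
      then show ?thesis unfolding path_edges_def
        by (intro CollectI exI[of _ "Suc i"]) simp
    qed
  qed
  then show "path_edges (u # v # p) = insert {u, v} (path_edges (v # p))" by blast
qed

lemma is_pathI: "distinct p \<Longrightarrow> p \<noteq> [] \<Longrightarrow> set p \<subseteq> V \<Longrightarrow> path_edges p = F \<Longrightarrow> is_path V F"
  by (auto simp: is_path_def)

text \<open>Two edges force a path on three vertices, whose edges share the middle one.\<close>

lemma disjoint_edges_not_path:
  assumes "distinct [u, v, w, x]"
  shows "\<not> is_path V {{u, v}, {w, x}}"
proof
  assume "is_path V {{u, v}, {w, x}}"
  then obtain p where p: "distinct p" "p \<noteq> []" "{{u, v}, {w, x}} = path_edges p" by (auto simp: is_path_def)
  have "card {{u, v}, {w, x}} = 2" using assms by (auto simp: doubleton_eq_iff)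
  then have "length p = 3" using card_path_edges[OF p(1)] p(3) by simp
  then obtain a b c where "p = [a, b, c]"
    by (auto simp: numeral_3_eq_3 length_Suc_conv)
  then show False using p assms by (auto simp: doubleton_eq_iff insert_eq_iff)
qed

lemma find_non_path_Some:
  assumes "find_non_path vs k = Some es" "distinct vs"
  shows "edge_list (set vs) es \<and> card (edge_set es) = k \<and> \<not> is_path (set vs) (edge_set es)"
proof (cases "k = 0")
  case True
  with assms have "vs = []" "es = []" by (auto simp: find_non_path_def split: if_splits)
  then show ?thesis using True by (simp add: edge_list_def edge_set_def is_path_def)
next
  case k0: False
  have k1: "k \<noteq> 1" using assms k0 by (auto simp: find_non_path_def)
  obtain u v w vs' where vs: "vs = u # v # w # vs'"
    using assms k0 k1 by (auto simp: find_non_path_def split: list.splits)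
  show ?thesis
  proof (cases "k = 2")
    case True
    with assms vs obtain x xs where x: "vs' = x # xs" "es = [(u, v), (w, x)]"
      by (auto simp: find_non_path_def split: list.splits)
    have d: "distinct [u, v, w, x]" using assms(2) vs x by auto
    have "edge_set es = {{u, v}, {w, x}}" by (simp add: x edge_set_def)
    then show ?thesis
      using disjoint_edges_not_path[OF d] d True vs x
      by (auto simp: edge_list_def all_edges_def doubleton_eq_iff)
  next
    case False
    let ?tri = "[(u, v), (v, w), (w, u)]"
    let ?L = "simplify_edges (?tri @ proper_pairs vs)"
    have es: "es = take k ?L" "length es = k"
      using assms vs k0 k1 False by (auto simp: find_non_path_def Let_def split: if_splits)
    have d: "distinct [u, v, w]" using assms(2) vs by auto
    have "simplify_edges ?tri = ?tri"
      using d by (auto simp: simplify_edges_def adj_def)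
    then obtain r where L: "?L = ?tri @ r" using simplify_edges_prefix[of ?tri "proper_pairs vs"] by auto
    have "take k ?tri = ?tri" using k0 k1 False by (intro take_all) simp
    then have "set ?tri \<subseteq> set es" unfolding es(1) L take_append by simp
    then have tri: "{u, v} \<in> edge_set es" "{v, w} \<in> edge_set es" "{w, u} \<in> edge_set es"
      by (auto simp: edge_set_def)
    have dist: "distinct (map (\<lambda>(u, v). {u, v}) es)"
      unfolding es(1) take_map[symmetric] by (intro distinct_take distinct_simplify)
    have "edge_set es \<subseteq> edge_set ?L"
      unfolding edge_set_def es(1) by (intro image_mono set_take_subset)
    also have "\<dots> \<subseteq> all_edges (set vs)"
      unfolding edge_set_simplify edge_set_append edge_set_proper_pairs
      using d vs by (auto simp: edge_set_def all_edges_def)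
    finally have "edge_list (set vs) es" using dist by (simp add: edge_list_def)
    moreover have "card (edge_set es) = k"
      using distinct_card[OF dist] es(2) by (simp add: edge_set_def)
    ultimately show ?thesis
      using triangle_not_path[OF tri] by blast
  qed
qed

text \<open>Each failure excludes non-paths: the empty set is a one-vertex path, one edge is a path,
  two edges on three vertices share an endpoint, and otherwise V has fewer than \<open>k\<close>
  edges in all.\<close>

lemma find_non_path_None:
  assumes none: "find_non_path vs k = None" and vs: "distinct vs"
    and F: "F \<subseteq> all_edges (set vs)" "card F = k"
  shows "is_path (set vs) F"
proof -
  have fin: "finite F" using F(1) finite_subset finite_all_edges by blast
  have le: "k \<le> length vs choose 2"
    using card_mono[OF finite_all_edges F(1)] F(2) by (simp add: card_all_edges distinct_card[OF vs])
  consider "k = 0" | "k = 1" | "k \<ge> 2" "length vs \<le> 2" | "k \<ge> 2" "length vs \<ge> 3"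
    by linarith
  then show ?thesis
  proof cases
    case 1
    with none obtain v vs' where "vs = v # vs'" by (cases vs) (auto simp: find_non_path_def)
    moreover have "F = {}" using 1 F fin by simp
    ultimately show ?thesis by (intro is_pathI[of "[v]"]) simp_all
  next
    case 2
    then obtain e where e: "F = {e}" using F(2) card_1_singletonE by blast
    with F(1) obtain u v where "e = {u, v}" "u \<noteq> v" "{u, v} \<subseteq> set vs"
      by (auto simp: all_edges_def card_2_iff)
    then show ?thesis using e by (intro is_pathI[of "[u, v]"]) simp_all
  next
    case 3
    have "length vs choose 2 \<le> 2 choose 2" using 3(2) by (rule binomial_right_mono)
    then show ?thesis using le 3(1) by simp
  next
    case 4
    then obtain u v w vs' where eq: "vs = u # v # w # vs'"
      by (auto simp: numeral_3_eq_3 Suc_le_length_iff)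
    show ?thesis
    proof (cases "k = 2")
      case True
      with none eq have vs': "vs' = []" by (auto simp: find_non_path_def split: list.splits)
      have d: "u \<noteq> v" "v \<noteq> w" "u \<noteq> w" using vs eq by auto
      have "all_edges (set vs) \<subseteq> {{u, v}, {v, w}, {u, w}}"
      proof
        fix e
        assume "e \<in> all_edges (set vs)"
        then obtain a b where e: "e = {a, b}" "a \<noteq> b" "a \<in> {u, v, w}" "b \<in> {u, v, w}"
          unfolding eq vs' by (auto simp: all_edges_def card_2_iff)
        from e(3,4,2) show "e \<in> {{u, v}, {v, w}, {u, w}}"
          unfolding e(1) by (elim insertE emptyE) (simp_all add: insert_commute)
      qed
      then have sub: "F \<subseteq> {{u, v}, {v, w}, {u, w}}" using F(1) by blast
      obtain a b where ab: "F = {a, b}" "a \<noteq> b" using F(2) True by (auto simp: card_2_iff)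
      have "F = {{u, v}, {v, w}} \<or> F = {{u, v}, {u, w}} \<or> F = {{v, w}, {u, w}}"
      proof -
        have "a \<in> {{u, v}, {v, w}, {u, w}}" "b \<in> {{u, v}, {v, w}, {u, w}}" using sub ab by simp_all
        then show ?thesis
          using ab(2) unfolding ab(1) by (elim insertE emptyE) (simp_all add: insert_commute)
      qed
      moreover have "is_path (set vs) {{u, v}, {v, w}}"
        using d eq by (intro is_pathI[of "[u, v, w]"]) auto
      moreover have "is_path (set vs) {{u, v}, {u, w}}"
        using d eq by (intro is_pathI[of "[v, u, w]"]) (auto simp: insert_commute)
      moreover have "is_path (set vs) {{v, w}, {u, w}}"
        using d eq by (intro is_pathI[of "[v, w, u]"]) (auto simp: insert_commute)
      ultimately show ?thesis by auto
    next
      case False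
      let ?L = "simplify_edges ([(u, v), (v, w), (w, u)] @ proper_pairs vs)"
      \<comment> \<open>The list covers all edges on V, among them the \<open>k\<close> edges of
        \<open>F\<close>, so it cannot be shorter than \<open>k\<close>.\<close>
      have "length (take k ?L) \<noteq> k"
        using none eq 4 False by (auto simp: find_non_path_def Let_def split: if_splits)
      then have "length ?L < k" by simp
      moreover have "all_edges (set vs) \<subseteq> edge_set ?L"
        unfolding edge_set_simplify edge_set_append edge_set_proper_pairs by blast
      then have "k \<le> card (edge_set ?L)"
        using card_mono[OF _ order_trans[OF F(1)], of "edge_set ?L"] F(2) by (simp add: edge_set_def)
      moreover have "card (edge_set ?L) \<le> length ?L"
        unfolding edge_set_def using card_image_le[of "set ?L"] card_length[of ?L] le_trans by blast
      ultimately show ?thesis by simp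
    qed
  qed
qed

lemma solve_correct:
  assumes valid: "valid_inst I"
  shows "correct_answer I (solve (verts I) (samples I) (len I))"
proof (cases "positives (samples I)")
  case Nil
  let ?es = "simplify_edges (proper_pairs (verts I))"
  have vs: "distinct (verts I)" using valid by (simp add: valid_inst_def)
  have neg: "\<not> l" if "(es, l) \<in> set (samples I)" for es l
    using Nil that by (auto simp: positives_def filter_empty_conv)
  have es: "distinct ?es" using distinct_simplify distinct_map by blast
  have "successively (adj ?es) p \<longleftrightarrow> (\<forall>Q\<in>set (positives (samples I)). successively (adj Q) p)"
    if "distinct p" "set p \<subseteq> set (verts I)" for p
    using path_edges_subset_all_edges[OF that]
    by (simp add: Nil flip: path_edges_subset_iff) (simp add: edge_set_simplify edge_set_proper_pairs)
  then have es_iff: "\<forall>p. distinct p \<and> set p \<subseteq> set (verts I) \<longrightarrow>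
      (successively (adj ?es) p \<longleftrightarrow> (\<forall>Q\<in>set (positives (samples I)). successively (adj Q) p))"
    by blast
  note sw = solve_with_correct[OF es es_iff]
  show ?thesis
  proof (cases "solve_with (verts I) (samples I) (len I) ?es")
    case (Some fs)
    then show ?thesis using sw(2) Nil by (simp add: solve_def)
  next
    case None
    \<comment> \<open>All labels are 0 here, and a non-path forms a path in no sample, so only size
      and membership of the edges remain.\<close>
    have non_path: "solution I F \<longleftrightarrow> F \<subseteq> all_edges (set (verts I)) \<and> card F = len I"
      if "\<not> is_path (set (verts I)) F" for F
      using that neg by (auto simp: solution_def consistent_def forms_path_in_def)
    show ?thesis
    proof (cases "find_non_path (verts I) (len I)")
      case None2: None
      have "\<not> solution I F" for F
      proof
        assume F: "solution I F"
        then have "is_path (set (verts I)) F"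
          using find_non_path_None[OF None2 vs, of F] by (auto simp: solution_def consistent_def)
        with sw(1)[OF None] F show False by blast
      qed
      then show ?thesis using None None2 Nil by (simp add: solve_def)
    next
      case (Some fs)
      note fs = find_non_path_Some[OF Some vs]
      then have "solution I (edge_set fs)"
        using non_path[of "edge_set fs"] by (auto simp: edge_list_def)
      then show ?thesis using None Some Nil fs by (simp add: solve_def)
    qed
  qed
next
  case (Cons P Ps)
  let ?es = "filter (\<lambda>e. \<forall>Q\<in>set Ps. adj Q (fst e) (snd e)) P"
  have mem: "(Q, True) \<in> set (samples I)" if "Q \<in> set (P # Ps)" for Q
    using that unfolding Cons[symmetric] by (auto simp: positives_def)
  have "edge_list (set (verts I)) P"
    using valid mem[of P] by (auto simp: valid_inst_def)
  then have es: "distinct ?es" unfolding edge_list_def by (auto simp: distinct_map)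
  have "adj ?es a b \<longleftrightarrow> (\<forall>Q\<in>set (P # Ps). adj Q a b)" for a b
    unfolding adj_def by auto
  then have "successively (adj ?es) p \<longleftrightarrow> (\<forall>Q\<in>set (positives (samples I)). successively (adj Q) p)" for p
    unfolding Cons by (auto simp: successively_conv_nth)
  then have es_iff: "\<forall>p. distinct p \<and> set p \<subseteq> set (verts I) \<longrightarrow>
      (successively (adj ?es) p \<longleftrightarrow> (\<forall>Q\<in>set (positives (samples I)). successively (adj Q) p))"
    by blast
  note sw = solve_with_correct[OF es es_iff]
  show ?thesis
  proof (cases "solve_with (verts I) (samples I) (len I) ?es")
    case (Some fs)
    then show ?thesis using sw(2) Cons by (simp add: solve_def)
  next
    case None
    \<comment> \<open>The positive sample \<open>P\<close> forces every solution to be a path, so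
      \<open>solve_with\<close> covers all candidates.\<close>
    have "is_path (set (verts I)) F" if "solution I F" for F
      using that mem[of P] by (force simp: solution_def consistent_def forms_path_in_def)
    then show ?thesis using sw(1)[OF None] None Cons by (auto simp: solve_def)
  qed
qed

section \<open>Fixed-parameter tractability\<close>

definition zero_bits :: "nat \<Rightarrow> expr \<Rightarrow> expr" where
  "zero_bits d e = (ECell EAtom ^^ d) e"

text \<open>Taking the tail halves a binary number, so the recursion halves instead of decrementing:
  applying the function for \<open>n div 2\<close> twice multiplies the accumulator by 2^(2 * d * (n
  div 2)), and an odd \<open>n\<close> appends \<open>d\<close> further zero bits.\<close>

definition power_body :: "nat \<Rightarrow> expr" where
  "power_body d = Cond (Var 0)
     (LetIn (Call 1 [ETail (Var 0), Call 1 [ETail (Var 0), Var 1]])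
       (Cond (EHead (Var 1)) (zero_bits d (Var 0)) (Var 0)))
     (Var 1)"

text \<open>The premise \<open>a > 0\<close> keeps the result canonical: a zero bit in front of the
  encoding of 0 would be a leading zero.\<close>

lemma eval_zero_bits:
  assumes "eval P \<rho> e (enc_nat a) t" "a > 0"
  shows "eval P \<rho> (zero_bits d e) (enc_nat (2 ^ d * a)) (2 * d + t)"
proof (induction d)
  case 0
  then show ?case using assms by (simp add: zero_bits_def)
next
  case (Suc d)
  have "enc_nat (2 ^ Suc d * a) = Cell Atom (enc_nat (2 ^ d * a))"
    using assms(2) by (subst enc_nat.simps) simp
  then show ?case
    using eval_ECell[OF eval_EAtom Suc] by (simp add: zero_bits_def)
qed

lemma eval_power_body:
  assumes "length P > 1" "P ! 1 = power_body d" "a > 0"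
  shows "\<exists>t. eval P [enc_nat n, enc_nat a] (power_body d) (enc_nat (2 ^ (d * n) * a)) t"
  using assms(3)
proof (induction n arbitrary: a rule: less_induct)
  case (less n)
  let ?\<rho> = "[enc_nat n, enc_nat a]"
  have v: "eval P ?\<rho> (Var 0) (enc_nat n) 1" "eval P ?\<rho> (Var 1) (enc_nat a) 1"
    using eval_Var[of 0 ?\<rho> P] eval_Var[of 1 ?\<rho> P] by simp_all
  show ?case
  proof (cases "n = 0")
    case True
    then have "enc_nat n = Atom" by (simp add: enc_nat.simps)
    then show ?thesis
      unfolding power_body_def using v True by (auto intro!: exI eval_Cond_Atom)
  next
    case False
    let ?m = "n div 2"
    have n: "enc_nat n = Cell (enc_bool (odd n)) (enc_nat ?m)"
      using False by (subst enc_nat.simps) simp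
    have m: "?m < n" using False by simp
    have tl: "eval P ?\<rho> (ETail (Var 0)) (enc_nat ?m) 2"
      using eval_ETail[OF v(1)] by (simp add: n numeral_2_eq_2)
    obtain s where s: "eval P [enc_nat ?m, enc_nat a] (power_body d) (enc_nat (2 ^ (d * ?m) * a)) s"
      using less.IH[OF m less.prems] by blast
    have 1: "eval P ?\<rho> (Call 1 [ETail (Var 0), Var 1]) (enc_nat (2 ^ (d * ?m) * a)) (Suc ((2 + (1 + 0)) + s))"
      by (rule eval_Call[OF evals_Cons[OF tl evals_Cons[OF v(2) evals_Nil]]]) (use assms s in simp_all)
    have pos: "2 ^ (d * ?m) * a > 0" using less.prems by simp
    obtain t where t: "eval P [enc_nat ?m, enc_nat (2 ^ (d * ?m) * a)] (power_body d)
        (enc_nat (2 ^ (d * ?m) * (2 ^ (d * ?m) * a))) t"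
      using less.IH[OF m pos] by blast
    let ?b = "2 ^ (d * ?m) * (2 ^ (d * ?m) * a)"
    obtain r where 2: "eval P ?\<rho> (Call 1 [ETail (Var 0), Call 1 [ETail (Var 0), Var 1]]) (enc_nat ?b) r"
      using eval_Call[OF evals_Cons[OF tl evals_Cons[OF 1 evals_Nil]], of 1] assms t by auto
    let ?\<sigma> = "enc_nat ?b # ?\<rho>"
    have w: "eval P ?\<sigma> (Var 0) (enc_nat ?b) 1" "eval P ?\<sigma> (Var 1) (enc_nat n) 1"
      using eval_Var[of 0 ?\<sigma> P] eval_Var[of 1 ?\<sigma> P] by simp_all
    have hd: "eval P ?\<sigma> (EHead (Var 1)) (enc_bool (odd n)) 2"
      using eval_EHead[OF w(2)] by (simp add: n numeral_2_eq_2)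
    have b: "?b > 0" using less.prems by simp
    have "\<exists>t. eval P ?\<sigma> (Cond (EHead (Var 1)) (zero_bits d (Var 0)) (Var 0)) (enc_nat (2 ^ (d * n) * a)) t"
    proof (cases "odd n")
      case True
      then have "n = Suc (?m + ?m)" by presburger
      then have eq: "2 ^ (d * n) * a = 2 ^ d * ?b"
        by (metis (no_types, lifting) add_mult_distrib2 mult.assoc mult_Suc_right power_add)
      have "eval P ?\<sigma> (EHead (Var 1)) (Cell Atom Atom) 2" using hd True by simp
      then show ?thesis
        unfolding eq by (intro exI) (rule eval_Cond_Cell[OF _ eval_zero_bits[OF w(1) b]])
    next
      case False
      then have "n = ?m + ?m" by presburger
      then have eq: "2 ^ (d * n) * a = ?b"
        by (metis add_mult_distrib2 mult.assoc power_add)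
      have "eval P ?\<sigma> (EHead (Var 1)) Atom 2" using hd False by simp
      then show ?thesis
        unfolding eq by (intro exI) (rule eval_Cond_Atom[OF _ w(1)])
    qed
    then obtain t' where "eval P ?\<sigma> (Cond (EHead (Var 1)) (zero_bits d (Var 0)) (Var 0)) (enc_nat (2 ^ (d * n) * a)) t'"
      by blast
    note 3 = eval_LetIn[OF 2 this]
    have "eval P ?\<rho> (Var 0) (Cell (enc_bool (odd n)) (enc_nat ?m)) 1"
      using v(1) by (simp only: n[symmetric])
    from eval_Cond_Cell[OF this 3] show ?thesis
      unfolding power_body_def by blast
  qed
qed

lemma computable_exp: "computable (\<lambda>n. 2 ^ (d * n))"
proof -
  let ?one = "ECell (ECell EAtom EAtom) EAtom"
  let ?P = "[Call 1 [Var 0, ?one], power_body d]"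
  have "\<exists>t. runs ?P (enc_nat n) (enc_nat (2 ^ (d * n))) t" for n
  proof -
    let ?\<rho> = "[enc_nat n]"
    have v: "eval ?P ?\<rho> (Var 0) (enc_nat n) 1" using eval_Var[of 0 ?\<rho> ?P] by simp
    have "enc_nat 1 = Cell (Cell Atom Atom) Atom"
      by (subst enc_nat.simps) (simp add: enc_nat.simps)
    then have one: "eval ?P ?\<rho> ?one (enc_nat 1) (Suc (Suc (1 + 1) + 1))"
      by (simp only:) (intro eval_ECell eval_EAtom)
    obtain t where t: "eval ?P [enc_nat n, enc_nat 1] (power_body d) (enc_nat (2 ^ (d * n) * 1)) t"
      using eval_power_body[of ?P d 1 n] by auto
    obtain s where "eval ?P ?\<rho> (Call 1 [Var 0, ?one]) (enc_nat (2 ^ (d * n))) s"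
      using eval_Call[OF evals_Cons[OF v evals_Cons[OF one evals_Nil]], of 1 _ t] t by auto
    then show ?thesis
      unfolding runs_def using eval_Call[OF evals_Cons[OF v evals_Nil], of 0 _ s] by auto
  qed
  then show ?thesis unfolding computable_def by blast
qed

lemma enc_inst_triple: "enc_inst I = enc_triple (verts I, samples I, len I)"
  by (simp add: enc_inst_def enc_edges_def)

lemma length_negatives: "length (negatives (samples I)) = neg_count I"
  by (simp add: negatives_def neg_count_def case_prod_beta')

lemma solves_ConsCheck_Path:
  "\<exists>P d. solves_ConsCheck_Path_within P (\<lambda>I. 2 ^ (d * (len I + neg_count I)) * inst_size I ^ (3 * d))"
proof -
  obtain P e T where T: "poly_bounded triple_budget enc_triple T"
    "\<And>z. \<exists>t\<le>T z. eval P [enc_triple z] e (enc_option (enc_list enc_edge) (solve (fst z) (fst (snd z)) (snd (snd z)))) t"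
    using pt_solve0 by (rule ptE) (rule that)
  \<comment> \<open>Execution enters at function 0, so the expression becomes that body and the rest
    moves up by one.\<close>
  let ?P = "shift 1 e # map (shift 1) P"
  have "poly_bounded triple_budget enc_triple (\<lambda>z. 2 + T z)"
    by (intro pb_intros T)
  then obtain d where d: "\<And>z. 2 + T z \<le> scale triple_budget enc_triple z ^ d"
    by (auto simp: poly_bounded_def)
  have "\<exists>r t. runs ?P (enc_inst I) (enc_option enc_edges r) t \<and> correct_answer I r \<and>
      t \<le> 2 ^ (d * (len I + neg_count I)) * inst_size I ^ (3 * d)" if "valid_inst I" for I
  proof -
    let ?z = "(verts I, samples I, len I)" and ?r = "solve (verts I) (samples I) (len I)"
    obtain t where t: "t \<le> T ?z" "eval P [enc_inst I] e (enc_option enc_edges ?r) t"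
      using T(2)[of ?z] by (auto simp: enc_inst_triple enc_edges_def)
    have body: "eval ?P [enc_inst I] (shift 1 e) (enc_option enc_edges ?r) t"
      using eval_shift(1)[OF t(2), of "[shift 1 e]" "[]"] by simp
    have "eval ?P [enc_inst I] (Var 0) (enc_inst I) 1"
      using eval_Var[of 0 "[enc_inst I]" ?P] by simp
    from evals_Cons[OF this evals_Nil] have "runs ?P (enc_inst I) (enc_option enc_edges ?r) (Suc ((1 + 0) + t))"
      unfolding runs_def by (rule eval_Call) (use body in simp_all)
    moreover have "Suc ((1 + 0) + t) \<le> 2 ^ (d * (len I + neg_count I)) * inst_size I ^ (3 * d)"
    proof -
      let ?a = "2 ^ (len I + neg_count I)" and ?s = "inst_size I"
      have a: "1 \<le> (?a :: nat)" by simp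
      have s: "2 \<le> ?s" by (simp add: inst_size_def enc_inst_def)
      have "scale triple_budget enc_triple ?z = ?a + ?s + 2"
        by (simp add: scale_def triple_budget_def inst_size_def enc_inst_triple length_negatives)
      \<comment> \<open>The polynomial in budget plus size is turned into a product: each summand is
        at most \<open>?a * ?s\<close>, and the factor 3 is absorbed by \<open>?s * ?s\<close>,
        which is at least 4. This is the origin of the exponent \<open>3 * d\<close>.\<close>
      also have "\<dots> \<le> ?a * ?s + ?a * ?s + ?a * ?s"
      proof -
        have "?a * 1 \<le> ?a * ?s" "1 * ?s \<le> ?a * ?s" "1 * 2 \<le> ?a * ?s"
          using a s by (intro mult_mono; simp)+
        then show ?thesis by linarith
      qed
      also have "\<dots> = ?a * ?s * 3" by simp
      also have "\<dots> \<le> ?a * ?s * (?s * ?s)"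
        using mult_mono[of 2 ?s 2 ?s] s by (intro mult_left_mono) simp_all
      also have "\<dots> = ?a * ?s ^ 3" by (simp add: numeral_3_eq_3)
      finally have "scale triple_budget enc_triple ?z ^ d \<le> (?a * ?s ^ 3) ^ d"
        by (rule power_mono) simp
      also have "\<dots> = 2 ^ (d * (len I + neg_count I)) * ?s ^ (3 * d)"
        by (simp add: power_mult_distrib power_mult[symmetric] mult.commute)
      finally show ?thesis using d[of ?z] t(1) by linarith
    qed
    ultimately show ?thesis using solve_correct[OF that] by blast
  qed
  then show ?thesis unfolding solves_ConsCheck_Path_within_def by blast
qed

theorem theorem10:
  shows "(\<exists>P c d. solves_ConsCheck_Path_within P
            (\<lambda>I. 2 ^ (c * (len I + neg_count I)) * inst_size I ^ d))
       \<and> fpt_ConsCheck_Path (\<lambda>I. len I + neg_count I)"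
proof -
  obtain P d where P: "solves_ConsCheck_Path_within P
      (\<lambda>I. 2 ^ (d * (len I + neg_count I)) * inst_size I ^ (3 * d))"
    using solves_ConsCheck_Path by blast
  moreover have "fpt_ConsCheck_Path (\<lambda>I. len I + neg_count I)"
    unfolding fpt_ConsCheck_Path_def
    using P computable_exp[of d] by (intro exI[of _ P] exI[of _ "\<lambda>n. 2 ^ (d * n)"] exI[of _ "3 * d"]) simp
  ultimately show ?thesis by blast
qed

end
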